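(* Let $X$ be a nonzero complex Banach space. For $\psi\in L^1(\mathbb{R}_+;X)$ define the sequence $\mathcal{P}\psi:\mathbb{N}_0\to X$ by $$(\mathcal{P}\psi)(n):=\int_0^\infty p_n(t)\psi(t)\,dt,\qquad n\in\mathbb{N}_0,\qquad\text{where } p_n(t)=e^{-t}\frac{t^n}{n!}.$$ Then the following properties hold. (i) The map $\mathcal{P}$ defines a bounded linear operator from $L^1(\mathbb{R}_+;X)$ to $\ell^1(\mathbb{N}_0;X)$ and $\|\mathcal{P}\|=1$. (ii) For $\psi\in L^1(\mathbb{R}_+;X)$, $$\mathcal{P}(\psi)(n)=\frac{(-1)^n}{n!}\left[\widehat{\psi}(\lambda)\right]^{(n)}\Big|_{\lambda=1},\qquad n\in\mathbb{N}_0.$$ In particular, the map $\mathcal{P}$ is injective. (iii) For $\psi\in L^1(\mathbb{R}_+;X)$, $\widetilde{(\mathcal{P}\psi)}(z)=\widehat{\psi}(1-1/z)$ for all complex $z$ with $|z|>1$. (iv) For $a\in L^1(\mathbb{R}_+)$ and $\psi\in L^1(\mathbb{R}_+;X)$, $\mathcal{P}(a*\psi)=\mathcal{P}(a)*\mathcal{P}(\psi)$. (v) If there are constants $M>0$ and $\omega\ge 0$ such that $\|\psi(t)\|\le Me^{-\omega t}$ for a.e. $t\ge 0$, then $\|\mathcal{P}(\psi)(n)\|\le\frac{M}{(1+\omega)^{n+1}}$ for all $n\in\mathbb{N}_0$. In particular, if $\psi$ is (measurable and) bounded, then $\mathcal{P}(\psi)(n)$ is well-defined by the integral above for all $n\in\mathbb{N}_0$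 and $\{\mathcal{P}(\psi)(n)\}_{n\in\mathbb{N}_0}$ is bounded. (vi) If $X$ is a Banach lattice and $\psi(t)\ge 0$ for a.e. $t\ge 0$, then $\mathcal{P}(\psi)(n)\ge 0$ for all $n\in\mathbb{N}_0$. (vii) Suppose that $\{S(t)\}_{t\ge 0}\subset\mathcal{B}(X)$ is a strongly continuous, uniformly bounded family of operators. If $\{S(t)\}_{t\ge 0}$ is compact (that is, every $S(t)$ is a compact operator), then $\{\mathcal{P}(S)(n)\}_{n\in\mathbb{N}_0}$ is compact (that is, every $\mathcal{P}(S)(n)$ is a compact operator).
   Context: $\mathbb{N}_0=\{0,1,2,\dots\}$; $\mathbb{R}_+=[0,\infty)$; $\mathcal{B}(X)$ is the space of bounded linear operators on $X$. $L^1(\mathbb{R}_+;X)$ is the space of (strongly measurable) functions $f:\mathbb{R}_+\to X$ with $\|f\|_1=\int_0^\infty\|f(t)\|dt<\infty$, and $\ell^1(\mathbb{N}_0;X)$ the space of sequences $u:\mathbb{N}_0\to X$ with $\|u\|_1=\sum_{n\ge0}\|u(n)\|<\infty$. Laplace transform: $\widehat{f}(\lambda)=\int_0^\infty e^{-\lambda t}f(t)\,dt$ for $\mathrm{Re}\,\lambda>0$. $Z$-transform: $\widetilde{u}(z)=\sum_{j=0}^\infty z^{-j}u(j)$. Convolutions: $(a*\psi)(t)=\int_0^t a(t-s)\psi(s)\,ds$ for functions, and $(u*v)(n)=\sum_{j=0}^n u(n-j)v(j)$ for sequences. For a strongly continuous bounded operator family, $\mathcal{P}(S)(n)x:=\int_0^\infty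 p_n(t)S(t)x\,dt$, $x\in X$. *)

theory Defs
  imports "HOL-Analysis.Analysis"
begin

section \<open>Complex Banach spaces\<close>

class scaleC = scaleR +
  fixes scaleC :: "complex \<Rightarrow> 'a \<Rightarrow> 'a" (infixr "*\<^sub>C" 75)

class complex_normed_vector = scaleC + real_normed_vector +
  assumes scaleC_add_right: "c *\<^sub>C (x + y) = c *\<^sub>C x + c *\<^sub>C y"
    and scaleC_add_left: "(c + d) *\<^sub>C x = c *\<^sub>C x + d *\<^sub>C x"
    and scaleC_scaleC: "c *\<^sub>C d *\<^sub>C x = (c * d) *\<^sub>C x"
    and scaleC_of_real: "complex_of_real r *\<^sub>C x = r *\<^sub>R x"
    and norm_scaleC: "norm (c *\<^sub>C x) = cmod c * norm x"

class complex_banach = complex_normed_vector + banach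

instantiation complex :: complex_banach
begin

definition scaleC_complex :: "complex \<Rightarrow> complex \<Rightarrow> complex"
  where "scaleC_complex c x = c * x"

instance
  by standard (auto simp: scaleC_complex_def algebra_simps scaleR_conv_of_real norm_mult)

end

definition bounded_clinear :: "('a::complex_normed_vector \<Rightarrow> 'b::complex_normed_vector) \<Rightarrow> bool"
  where "bounded_clinear T \<longleftrightarrow> bounded_linear T \<and> (\<forall>c x. T (c *\<^sub>C x) = c *\<^sub>C T x)"

definition compact_operator :: "('a::complex_normed_vector \<Rightarrow> 'b::complex_normed_vector) \<Rightarrow> bool"
  where "compact_operator T \<longleftrightarrow>
    bounded_clinear T \<and> (\<forall>B. bounded B \<longrightarrow> compact (closure (T ` B)))"

section \<open>Bochner integral without separability\<close>

text \<open>The Bochner integral of \<^theory>\<open>HOL-Analysis.Bochner_Integration\<close> requires a second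
  countable range type. The notions below are the textbook ones for an arbitrary Banach space;
  they are meant for complete measures, where almost everywhere limits of simple functions have
  measurable norm.\<close>

definition strongly_measurable :: "'a measure \<Rightarrow> ('a \<Rightarrow> 'b::banach) \<Rightarrow> bool"
  where "strongly_measurable M f \<longleftrightarrow>
    (\<exists>s. (\<forall>i. simple_function M (s i)) \<and> (AE x in M. (\<lambda>i::nat. s i x) \<longlonglongrightarrow> f x))"

definition bochner_integrable :: "'a measure \<Rightarrow> ('a \<Rightarrow> 'b::banach) \<Rightarrow> bool"
  where "bochner_integrable M f \<longleftrightarrow>
    strongly_measurable M f \<and> integrable M (\<lambda>x. norm (f x))"

definition is_bochner_integral :: "'a measure \<Rightarrow> ('a \<Rightarrow> 'b::banach) \<Rightarrow> 'b \<Rightarrow> bool"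
  where "is_bochner_integral M f I \<longleftrightarrow>
    (\<exists>s. (\<forall>i::nat. Bochner_Integration.simple_bochner_integrable M (s i)) \<and>
         (\<lambda>i. \<integral>\<^sup>+x. norm (f x - s i x) \<partial>M) \<longlonglongrightarrow> 0 \<and>
         (\<lambda>i. Bochner_Integration.simple_bochner_integral M (s i)) \<longlonglongrightarrow> I)"

definition bochner_integral :: "'a measure \<Rightarrow> ('a \<Rightarrow> 'b::banach) \<Rightarrow> 'b"
  where "bochner_integral M f =
    (if bochner_integrable M f then THE I. is_bochner_integral M f I else 0)"

section \<open>Function and sequence spaces\<close>

abbreviation half_line :: "real measure"
  where "half_line \<equiv> lebesgue_on {0..}"

text \<open>Elements of \<open>L1\<close> are represented by functions on the whole real line whose values on the
  negative half line are irrelevant; the identification of functions that agree almost everywhere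
  is made explicit where it matters.\<close>

definition L1 :: "(real \<Rightarrow> 'a::banach) set"
  where "L1 = {f. bochner_integrable half_line f}"

definition L1_norm :: "(real \<Rightarrow> 'a::banach) \<Rightarrow> real"
  where "L1_norm f = (LINT t|half_line. norm (f t))"

definition L1_eq :: "(real \<Rightarrow> 'a::banach) \<Rightarrow> (real \<Rightarrow> 'a) \<Rightarrow> bool"
  where "L1_eq f g \<longleftrightarrow> (AE t in half_line. f t = g t)"

definition l1 :: "(nat \<Rightarrow> 'a::banach) set"
  where "l1 = {u. summable (\<lambda>n. norm (u n))}"

definition l1_norm :: "(nat \<Rightarrow> 'a::banach) \<Rightarrow> real"
  where "l1_norm u = (\<Sum>n. norm (u n))"

text \<open>Bounded complex linear operators from \<open>L1\<close> to \<open>l1\<close>, as maps on representatives that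
  descend to the quotient by almost everywhere equality.\<close>

definition bounded_operator_L1_l1 :: "((real \<Rightarrow> 'a::complex_banach) \<Rightarrow> nat \<Rightarrow> 'a) \<Rightarrow> bool"
  where "bounded_operator_L1_l1 T \<longleftrightarrow>
    (\<forall>f\<in>L1. T f \<in> l1) \<and>
    (\<forall>f\<in>L1. \<forall>g\<in>L1. L1_eq f g \<longrightarrow> T f = T g) \<and>
    (\<forall>f\<in>L1. \<forall>g\<in>L1. T (\<lambda>t. f t + g t) = (\<lambda>n. T f n + T g n)) \<and>
    (\<forall>c. \<forall>f\<in>L1. T (\<lambda>t. c *\<^sub>C f t) = (\<lambda>n. c *\<^sub>C T f n)) \<and>
    (\<exists>K. \<forall>f\<in>L1. l1_norm (T f) \<le> K * L1_norm f)"

definition opnorm_L1_l1 :: "((real \<Rightarrow> 'a::complex_banach) \<Rightarrow> nat \<Rightarrow> 'a) \<Rightarrow> real"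
  where "opnorm_L1_l1 T = Sup {l1_norm (T f) | f. f \<in> L1 \<and> L1_norm f \<le> 1}"

section \<open>Transforms and convolutions\<close>

definition laplace :: "(real \<Rightarrow> 'a::complex_banach) \<Rightarrow> complex \<Rightarrow> 'a"
  where "laplace f s = bochner_integral half_line (\<lambda>t. exp (- s * complex_of_real t) *\<^sub>C f t)"

definition Z_transform :: "(nat \<Rightarrow> 'a::complex_banach) \<Rightarrow> complex \<Rightarrow> 'a"
  where "Z_transform u z = (\<Sum>j. (1 / z ^ j) *\<^sub>C u j)"

definition fun_conv :: "(real \<Rightarrow> complex) \<Rightarrow> (real \<Rightarrow> 'a::complex_banach) \<Rightarrow> real \<Rightarrow> 'a"
  where "fun_conv a f t = bochner_integral (lebesgue_on {0..t}) (\<lambda>s. a (t - s) *\<^sub>C f s)"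

definition seq_conv :: "(nat \<Rightarrow> complex) \<Rightarrow> (nat \<Rightarrow> 'a::complex_banach) \<Rightarrow> nat \<Rightarrow> 'a"
  where "seq_conv u v n = (\<Sum>j\<le>n. u (n - j) *\<^sub>C v j)"

text \<open>Complex derivative of a vector valued function of a complex variable.\<close>

definition has_cderiv :: "(complex \<Rightarrow> 'a::complex_banach) \<Rightarrow> 'a \<Rightarrow> complex \<Rightarrow> bool"
  where "has_cderiv f D z \<longleftrightarrow> (f has_derivative (\<lambda>h. h *\<^sub>C D)) (at z)"

definition cderiv :: "(complex \<Rightarrow> 'a::complex_banach) \<Rightarrow> complex \<Rightarrow> 'a"
  where "cderiv f z = (THE D. has_cderiv f D z)"

section \<open>The Poisson transformation\<close>

definition poisson_weight :: "nat \<Rightarrow> real \<Rightarrow> real"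
  where "poisson_weight n t = exp (- t) * (t ^ n / fact n)"

definition poisson :: "(real \<Rightarrow> 'a::banach) \<Rightarrow> nat \<Rightarrow> 'a"
  where "poisson f n = bochner_integral half_line (\<lambda>t. poisson_weight n t *\<^sub>R f t)"

definition poisson_op :: "(real \<Rightarrow> 'a::banach \<Rightarrow> 'a) \<Rightarrow> nat \<Rightarrow> 'a \<Rightarrow> 'a"
  where "poisson_op S n x = poisson (\<lambda>t. S t x) n"

section \<open>Banach lattices\<close>

text \<open>Since the ambient space is complex, a Banach lattice structure on it is a complex one: the
  space is the complexification of a real Banach lattice \<open>E\<close> (realised as a real subspace, with
  an order \<open>le\<close> of which only the restriction to \<open>E\<close> matters), and the norm of \<open>x + i y\<close> is the
  norm of the modulus \<open>sup {cos \<theta> x + sin \<theta> y | \<theta>}\<close>.\<close>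

definition is_sup_in :: "'a set \<Rightarrow> ('a \<Rightarrow> 'a \<Rightarrow> bool) \<Rightarrow> 'a set \<Rightarrow> 'a \<Rightarrow> bool"
  where "is_sup_in E le A m \<longleftrightarrow>
    m \<in> E \<and> (\<forall>a\<in>A. le a m) \<and> (\<forall>u\<in>E. (\<forall>a\<in>A. le a u) \<longrightarrow> le m u)"

text \<open>Closedness of \<open>E\<close> in the ambient Banach space is completeness of \<open>E\<close>; infima exist because
  suprema do.\<close>

definition real_banach_lattice_on :: "'a::banach set \<Rightarrow> ('a \<Rightarrow> 'a \<Rightarrow> bool) \<Rightarrow> bool"
  where "real_banach_lattice_on E le \<longleftrightarrow>
    subspace E \<and> closed E \<and>
    (\<forall>x\<in>E. le x x) \<and>
    (\<forall>x\<in>E. \<forall>y\<in>E. le x y \<and> le y x \<longrightarrow> x = y) \<and>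
    (\<forall>x\<in>E. \<forall>y\<in>E. \<forall>z\<in>E. le x y \<and> le y z \<longrightarrow> le x z) \<and>
    (\<forall>x\<in>E. \<forall>y\<in>E. \<forall>z\<in>E. le x y \<longrightarrow> le (x + z) (y + z)) \<and>
    (\<forall>x\<in>E. \<forall>y\<in>E. \<forall>r\<ge>0. le x y \<longrightarrow> le (r *\<^sub>R x) (r *\<^sub>R y)) \<and>
    (\<forall>x\<in>E. \<forall>y\<in>E. \<exists>m. is_sup_in E le {x, y} m) \<and>
    (\<forall>x\<in>E. \<forall>y\<in>E. \<forall>a b. is_sup_in E le {x, - x} a \<and> is_sup_in E le {y, - y} b \<and> le a b
        \<longrightarrow> norm x \<le> norm y)"

definition complex_banach_lattice :: "'a::complex_banach set \<Rightarrow> ('a \<Rightarrow> 'a \<Rightarrow> bool) \<Rightarrow> bool"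
  where "complex_banach_lattice E le \<longleftrightarrow>
    real_banach_lattice_on E le \<and>
    (\<forall>z. \<exists>!p. fst p \<in> E \<and> snd p \<in> E \<and> z = fst p + \<i> *\<^sub>C snd p) \<and>
    (\<forall>x\<in>E. \<forall>y\<in>E. \<exists>m. is_sup_in E le {cos \<theta> *\<^sub>R x + sin \<theta> *\<^sub>R y | \<theta>. True} m \<and>
        norm (x + \<i> *\<^sub>C y) = norm m)"

text \<open>Positivity \<open>0 \<le> x\<close>; positive elements lie in the real part \<open>E\<close>.\<close>

definition nonneg_in :: "'a::zero set \<Rightarrow> ('a \<Rightarrow> 'a \<Rightarrow> bool) \<Rightarrow> 'a \<Rightarrow> bool"
  where "nonneg_in E le x \<longleftrightarrow> x \<in> E \<and> le 0 x"

end

theory Submission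
  imports Defs "HOL-Probability.Distributions"
begin

text \<open>The Poisson weights \<open>t \<mapsto> exp (- t) * t ^ n / fact n\<close> are nonnegative on the half line, sum to one
  over \<open>n\<close> at every \<open>t\<close>, and have integral one over \<open>t\<close> for every \<open>n\<close>. Nearly everything is read off
  from these facts, once the Bochner integral in an arbitrary Banach space is known to be linear,
  bounded by the integral of the norm, compatible with bounded linear maps and with dominated
  convergence, and once a property of \<open>L\<^sup>1\<close> functions may be checked on one-step functions
  (\<open>bochner_integrable_induct\<close>). All of this rests on one estimate: the integral of \<open>f\<close> differs from
  that of a simple function \<open>s\<close> by at most the integral of \<open>norm (f x - s x)\<close>.

  Summing the weights to one gives the operator bound, with equality for nonnegative scalar
  multiples of a fixed vector. Power series in the weights may be summed under the integral
  (\<open>bochner_integral_weight_series\<close>); this is the formula for the \<open>Z\<close>-transform. Differentiation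
  under the integral sign yields the derivatives of the Laplace transform, and the weights are, up
  to the factor \<open>(- 1) ^ n / fact n\<close>, the integrands of those derivatives at \<open>1\<close>. The exponential
  bound is the Gamma integral.

  For injectivity, suppose that all coefficients of \<open>f\<close> vanish. Then all derivatives of the Laplace
  transform vanish at \<open>1\<close>, therefore near \<open>1\<close>, and by repeated expansion at all natural numbers
  \<open>k > 0\<close>. In the variable \<open>u = exp (- t)\<close> this says that \<open>exp (- t) *\<^sub>R f t\<close> is annihilated by all
  polynomials in \<open>u\<close>, hence by the indicators of all initial intervals, hence by the indicators of
  all measurable sets, and such a function is zero almost everywhere
  (\<open>AE_zero_if_set_integrals_zero\<close>).

  The convolution identity is Fubini's theorem together with the addition theorem
  \<open>poisson_weight_add\<close>, which is the binomial theorem. Both are applied to scalar functions only: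
  the vector-valued case follows by approximating \<open>\<psi>\<close> in \<open>L\<^sup>1\<close> by one-step functions, and Young's
  inequality for the norms controls the error and supplies the measurability of the limit.

  Integrals of functions with values in a closed convex cone stay in the cone, and the positive cone
  of a Banach lattice is closed; this gives positivity. For compactness the obstacle is that strong
  continuity of \<open>S\<close> gives no continuity in the operator norm. Given a bounded sequence of vectors,
  all values \<open>S t (X n)\<close> lie in the closure of one countable set. Pointwise compactness makes
  finitely many of its elements nearly exhaust the values at \<open>t\<close>, uniformly in \<open>n\<close>, and dominated
  convergence transfers this to the integrals, which therefore lie close to the convex hull of
  finitely many points (\<open>compact_closure_integrals\<close>).\<close>

section \<open>Scalar multiplication on complex Banach spaces\<close>

lemma scaleR_eq_scaleC: "r *\<^sub>R x = complex_of_real r *\<^sub>C (x::'a::complex_normed_vector)"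
  by (simp add: scaleC_of_real)

lemma scaleC_one [simp]: "1 *\<^sub>C x = (x::'a::complex_normed_vector)"
  using scaleC_of_real[of 1 x] by simp

lemma bounded_bilinear_scaleC:
  "bounded_bilinear (scaleC :: complex \<Rightarrow> 'a::complex_normed_vector \<Rightarrow> 'a)"
proof
  fix a b :: complex and x y :: 'a and r :: real
  show "(a + b) *\<^sub>C x = a *\<^sub>C x + b *\<^sub>C x" "a *\<^sub>C (x + y) = a *\<^sub>C x + a *\<^sub>C y"
    by (rule scaleC_add_left scaleC_add_right)+
  show "(r *\<^sub>R a) *\<^sub>C x = r *\<^sub>R a *\<^sub>C x" "a *\<^sub>C r *\<^sub>R x = r *\<^sub>R a *\<^sub>C x"
    unfolding scaleC_of_real[of r, symmetric] scaleC_scaleC scaleC_complex_def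
    by (simp_all add: scaleR_conv_of_real mult.commute)
  show "\<exists>K. \<forall>(a::complex) (x::'a). norm (a *\<^sub>C x) \<le> norm a * norm x * K"
    by (rule exI[of _ 1]) (simp add: norm_scaleC)
qed

interpretation scaleC: bounded_bilinear "scaleC :: complex \<Rightarrow> 'a::complex_normed_vector \<Rightarrow> 'a"
  by (rule bounded_bilinear_scaleC)

section \<open>Strong measurability over a complete measure\<close>

lemma strongly_measurable_cong:
  assumes "AE x in M. f x = g x" "strongly_measurable M f"
  shows "strongly_measurable M g"
proof -
  obtain s where s: "\<And>i. simple_function M (s i)" "AE x in M. (\<lambda>i::nat. s i x) \<longlonglongrightarrow> f x"
    using assms(2) unfolding strongly_measurable_def by blast
  have "AE x in M. (\<lambda>i. s i x) \<longlonglongrightarrow> g x"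
    using s(2) assms(1) by eventually_elim simp
  then show ?thesis
    unfolding strongly_measurable_def using s(1) by blast
qed

lemma strongly_measurable_compose2:
  assumes f: "strongly_measurable M f" and g: "strongly_measurable M g"
    and h: "continuous_on UNIV (\<lambda>p. h (fst p) (snd p))"
  shows "strongly_measurable M (\<lambda>x. h (f x) (g x))"
proof -
  obtain s where s: "\<And>i. simple_function M (s i)" "AE x in M. (\<lambda>i::nat. s i x) \<longlonglongrightarrow> f x"
    using f unfolding strongly_measurable_def by blast
  obtain r where r: "\<And>i. simple_function M (r i)" "AE x in M. (\<lambda>i::nat. r i x) \<longlonglongrightarrow> g x"
    using g unfolding strongly_measurable_def by blast
  have "AE x in M. (\<lambda>i. h (s i x) (r i x)) \<longlonglongrightarrow> h (f x) (g x)"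
    using s(2) r(2)
  proof eventually_elim
    case (elim x)
    have "(\<lambda>i. (s i x, r i x)) \<longlonglongrightarrow> (f x, g x)"
      using elim by (intro tendsto_Pair)
    from continuous_on_tendsto_compose[OF h this] show ?case by simp
  qed
  moreover have "simple_function M (\<lambda>x. h (s i x) (r i x))" for i
    by (rule simple_function_compose2[OF s(1) r(1)])
  ultimately show ?thesis
    unfolding strongly_measurable_def by (intro exI[of _ "\<lambda>i x. h (s i x) (r i x)"]) blast
qed

lemma strongly_measurable_add:
  "strongly_measurable M f \<Longrightarrow> strongly_measurable M g \<Longrightarrow> strongly_measurable M (\<lambda>x. f x + g x)"
  by (erule (1) strongly_measurable_compose2[where h = "(+)"]) (intro continuous_intros)

lemma strongly_measurable_diff:
  "strongly_measurable M f \<Longrightarrow> strongly_measurable M g \<Longrightarrow> strongly_measurable M (\<lambda>x. f x - g x)"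
  by (erule (1) strongly_measurable_compose2[where h = "(-)"]) (intro continuous_intros)

lemma strongly_measurable_scaleR:
  "strongly_measurable M w \<Longrightarrow> strongly_measurable M f \<Longrightarrow> strongly_measurable M (\<lambda>x. w x *\<^sub>R f x)"
  by (erule (1) strongly_measurable_compose2[where h = scaleR]) (intro continuous_intros)

lemma strongly_measurable_scaleC:
  fixes f :: "'a \<Rightarrow> 'b::complex_banach"
  shows "strongly_measurable M w \<Longrightarrow> strongly_measurable M f \<Longrightarrow> strongly_measurable M (\<lambda>x. w x *\<^sub>C f x)"
  by (erule (1) strongly_measurable_compose2[where h = scaleC])
     (intro scaleC.continuous_on continuous_intros)

lemma strongly_measurable_simple: "simple_function M f \<Longrightarrow> strongly_measurable M f"
  unfolding strongly_measurable_def by (rule exI[of _ "\<lambda>_. f"]) simp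

lemma strongly_measurable_compose:
  assumes "strongly_measurable M f" "continuous_on UNIV h"
  shows "strongly_measurable M (\<lambda>x. h (f x))"
  by (rule strongly_measurable_compose2[OF assms(1) assms(1), where h="\<lambda>x y. h x"],
      rule continuous_on_compose2[OF assms(2) continuous_on_fst[OF continuous_on_id]]) simp

lemma strongly_measurable_borel:
  fixes f :: "'a \<Rightarrow> 'b::{banach, second_countable_topology}"
  assumes "f \<in> borel_measurable M"
  shows "strongly_measurable M f"
proof -
  obtain F where "\<And>i. simple_function M (F i)" "\<And>x. x \<in> space M \<Longrightarrow> (\<lambda>i. F i x) \<longlonglongrightarrow> f x"
    using borel_measurable_implies_sequence_metric[OF assms, of 0] by blast
  then show ?thesis
    unfolding strongly_measurable_def by (intro exI[of _ F] conjI allI AE_I2)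
qed

lemma simple_function_restrict:
  assumes "simple_function M f" "\<Omega> \<in> sets M"
  shows "simple_function (restrict_space M \<Omega>) f"
  unfolding simple_function_def
proof (intro conjI ballI)
  have sp: "space (restrict_space M \<Omega>) = \<Omega>"
    using sets.sets_into_space[OF assms(2)] by (auto simp: space_restrict_space)
  show "finite (f ` space (restrict_space M \<Omega>))"
    by (rule finite_subset[OF _ simple_functionD(1)[OF assms(1)]])
      (use sets.sets_into_space[OF assms(2)] in \<open>auto simp: sp\<close>)
  fix y
  have "f -` {y} \<inter> \<Omega> = (f -` {y} \<inter> space M) \<inter> \<Omega>"
    using sets.sets_into_space[OF assms(2)] by auto
  then show "f -` {y} \<inter> space (restrict_space M \<Omega>) \<in> sets (restrict_space M \<Omega>)"
    unfolding sp sets_restrict_space using simple_functionD(2)[OF assms(1), of "{y}"] by auto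
qed

lemma strongly_measurable_restrict:
  assumes "strongly_measurable M f" "\<Omega> \<in> sets M"
  shows "strongly_measurable (restrict_space M \<Omega>) f"
proof -
  have \<Omega>: "\<Omega> \<inter> space M \<in> sets M" using assms(2) by auto
  obtain s where s: "\<And>i. simple_function M (s i)" "AE x in M. (\<lambda>i::nat. s i x) \<longlonglongrightarrow> f x"
    using assms(1) unfolding strongly_measurable_def by blast
  have "AE x in restrict_space M \<Omega>. (\<lambda>i. s i x) \<longlonglongrightarrow> f x"
    unfolding AE_restrict_space_iff[OF \<Omega>] using s(2) by eventually_elim simp
  then show ?thesis
    unfolding strongly_measurable_def using simple_function_restrict[OF s(1) assms(2)] by blast
qed

context complete_measure
begin

text \<open>An exceptional null set carries no measurability obligation, because all its subsets are
  measurable.\<close>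

lemma borel_measurable_AE_eq:
  fixes f :: "'a \<Rightarrow> 'b::topological_space"
  assumes f: "f \<in> borel_measurable M" and ae: "AE x in M. f x = g x"
  shows "g \<in> borel_measurable M"
proof (rule measurableI)
  fix B :: "'b set" assume B: "B \<in> sets borel"
  show "g -` B \<inter> space M \<in> sets M"
  proof (rule in_sets_AE[where A = "f -` B \<inter> space M"])
    show "AE x in M. (x \<in> f -` B \<inter> space M) = (x \<in> g -` B \<inter> space M)"
      using ae by eventually_elim auto
  qed (use measurable_sets[OF f B] in auto)
qed simp

text \<open>After removal of the exceptional null set this is the measurability of pointwise limits of
  measurable functions, which holds in every metric space, separable or not.\<close>

lemma strongly_measurable_imp_borel:
  fixes f :: "'a \<Rightarrow> 'b::banach"
  assumes "strongly_measurable M f"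
  shows "f \<in> borel_measurable M"
proof -
  obtain s where s: "\<And>i. simple_function M (s i)" and ae: "AE x in M. (\<lambda>i::nat. s i x) \<longlonglongrightarrow> f x"
    using assms unfolding strongly_measurable_def by blast
  define N where "N = {x \<in> space M. \<not> (\<lambda>i. s i x) \<longlonglongrightarrow> f x}"
  have N: "N \<in> null_sets M" "N \<in> sets M"
    using ae unfolding N_def AE_iff_null_sets by auto
  define r where "r i x = (if x \<in> N then 0 else s i x)" for i x
  define g where "g x = (if x \<in> N then 0 else f x)" for x
  have r: "r i \<in> borel_measurable M" for i
    unfolding r_def using borel_measurable_simple_function[OF s, of i] N(2)
    by (intro measurable_If_set) auto
  have "g \<in> borel_measurable M"
  proof (rule borel_measurable_LIMSEQ_metric[OF r])
    show "(\<lambda>i. r i x) \<longlonglongrightarrow> g x" if "x \<in> space M" for x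
      using that by (cases "x \<in> N") (auto simp: r_def g_def N_def)
  qed
  moreover have "AE x in M. g x = f x"
    using AE_not_in[OF N(1)] by eventually_elim (simp add: g_def)
  ultimately show ?thesis
    by (rule borel_measurable_AE_eq)
qed

lemma borel_measurable_norm_strongly_measurable:
  fixes f :: "'a \<Rightarrow> 'b::banach"
  assumes "strongly_measurable M f"
  shows "(\<lambda>x. norm (f x)) \<in> borel_measurable M"
  using strongly_measurable_imp_borel[OF strongly_measurable_compose[OF assms continuous_on_norm_id]] .

end

section \<open>The Bochner integral over a complete measure\<close>

abbreviation simple_bochner_integrable :: "'a measure \<Rightarrow> ('a \<Rightarrow> 'b::real_vector) \<Rightarrow> bool"
  where "simple_bochner_integrable \<equiv> Bochner_Integration.simple_bochner_integrable"

abbreviation simple_bochner_integral :: "'a measure \<Rightarrow> ('a \<Rightarrow> 'b::real_vector) \<Rightarrow> 'b"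
  where "simple_bochner_integral \<equiv> Bochner_Integration.simple_bochner_integral"

lemma simple_bochner_integral_le:
  fixes s :: "'a \<Rightarrow> 'b::banach"
  assumes "simple_bochner_integrable M s"
  shows "integrable M (\<lambda>x. norm (s x))"
    and "norm (simple_bochner_integral M s) \<le> (LINT x|M. norm (s x))"
proof -
  have n: "simple_bochner_integrable M (\<lambda>x. norm (s x))"
    using simple_bochner_integrable_compose2[of "\<lambda>x y. norm x" M s s] assms by simp
  show "integrable M (\<lambda>x. norm (s x))"
    using has_bochner_integral_simple_bochner_integrable[OF n] by (rule integrable.intros)
  show "norm (simple_bochner_integral M s) \<le> (LINT x|M. norm (s x))"
    using simple_bochner_integral_norm_bound[OF assms] simple_bochner_integrable_eq_integral[OF n]
    by simp
qed

lemma simple_bochner_integrable_imp_simple: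
  "simple_bochner_integrable M s \<Longrightarrow> simple_function M s"
  by (erule simple_bochner_integrable.cases)

context complete_measure
begin

lemma bochner_integrable_bound:
  fixes f :: "'a \<Rightarrow> 'b::banach"
  assumes f: "strongly_measurable M f" and w: "integrable M w"
    and le: "AE x in M. norm (f x) \<le> w x"
  shows "bochner_integrable M f"
proof -
  have "AE x in M. norm (norm (f x)) \<le> norm (w x)"
    using le by eventually_elim simp
  then have "integrable M (\<lambda>x. norm (f x))"
    by (rule Bochner_Integration.integrable_bound[OF w borel_measurable_norm_strongly_measurable[OF f]])
  then show ?thesis
    using f by (simp add: bochner_integrable_def)
qed

lemma bochner_integrableD:
  fixes f :: "'a \<Rightarrow> 'b::banach"
  assumes "bochner_integrable M f"
  shows "strongly_measurable M f" "integrable M (\<lambda>x. norm (f x))"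
  using assms by (auto simp: bochner_integrable_def)

lemma bochner_integrable_cong:
  fixes f :: "'a \<Rightarrow> 'b::banach"
  assumes "AE x in M. f x = g x" "bochner_integrable M f"
  shows "bochner_integrable M g"
proof (rule bochner_integrable_bound)
  show "strongly_measurable M g"
    by (rule strongly_measurable_cong[OF assms(1) bochner_integrableD(1)[OF assms(2)]])
  show "integrable M (\<lambda>x. norm (f x))"
    by (rule bochner_integrableD(2)[OF assms(2)])
  show "AE x in M. norm (g x) \<le> norm (f x)"
    using assms(1) by eventually_elim simp
qed

lemma bochner_integrable_add:
  fixes f :: "'a \<Rightarrow> 'b::banach"
  assumes "bochner_integrable M f" "bochner_integrable M g"
  shows "bochner_integrable M (\<lambda>x. f x + g x)"
  by (rule bochner_integrable_bound[where w = "\<lambda>x. norm (f x) + norm (g x)"])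
     (use assms in \<open>auto intro!: strongly_measurable_add norm_triangle_ineq simp: bochner_integrable_def\<close>)

lemma bochner_integrable_diff:
  fixes f :: "'a \<Rightarrow> 'b::banach"
  assumes "bochner_integrable M f" "bochner_integrable M g"
  shows "bochner_integrable M (\<lambda>x. f x - g x)"
  by (rule bochner_integrable_bound[where w = "\<lambda>x. norm (f x) + norm (g x)"])
     (use assms in \<open>auto intro!: strongly_measurable_diff norm_triangle_ineq4 simp: bochner_integrable_def\<close>)

lemma integrable_norm_diff:
  fixes f :: "'a \<Rightarrow> 'b::banach"
  assumes "bochner_integrable M f" "bochner_integrable M g"
  shows "integrable M (\<lambda>x. norm (f x - g x))"
  by (rule bochner_integrableD(2)[OF bochner_integrable_diff[OF assms]])

lemma bochner_integrable_bounded_linear: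
  fixes f :: "'a \<Rightarrow> 'b::banach" and T :: "'b \<Rightarrow> 'c::banach"
  assumes T: "bounded_linear T" and f: "bochner_integrable M f"
  shows "bochner_integrable M (\<lambda>x. T (f x))"
proof -
  obtain K where K: "\<And>x. norm (T x) \<le> norm x * K"
    using bounded_linear.pos_bounded[OF T] by blast
  show ?thesis
  proof (rule bochner_integrable_bound[where w = "\<lambda>x. norm (f x) * K"])
    show "strongly_measurable M (\<lambda>x. T (f x))"
      by (rule strongly_measurable_compose[OF bochner_integrableD(1)[OF f] linear_continuous_on[OF T]])
  qed (use K bochner_integrableD(2)[OF f] in auto)
qed

lemma bochner_integrable_simple:
  fixes s :: "'a \<Rightarrow> 'b::banach"
  shows "simple_bochner_integrable M s \<Longrightarrow> bochner_integrable M s"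
  unfolding bochner_integrable_def
  using simple_bochner_integral_le(1) strongly_measurable_simple simple_bochner_integrable_imp_simple
  by blast

text \<open>Cutting a simple function off where it exceeds twice the norm of \<open>f\<close> does not disturb the
  pointwise convergence and makes dominated convergence applicable to the real functions
  \<open>norm (f x - s x)\<close>.\<close>

lemma bochner_integrable_simple_approx:
  fixes f :: "'a \<Rightarrow> 'b::banach"
  assumes f: "bochner_integrable M f" and e: "0 < e"
  obtains s where "simple_bochner_integrable M s" "(LINT x|M. norm (f x - s x)) < e"
proof -
  note nf = bochner_integrableD(2)[OF f]
  obtain s where s: "\<And>i. simple_function M (s i)" and ae: "AE x in M. (\<lambda>i::nat. s i x) \<longlonglongrightarrow> f x"
    using bochner_integrableD(1)[OF f] unfolding strongly_measurable_def by blast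
  define A where "A i = {x \<in> space M. norm (s i x) \<le> 2 * norm (f x)}" for i
  define r where "r i x = (if x \<in> A i then s i x else 0)" for i x
  have A: "A i \<in> sets M" for i
  proof -
    have [measurable]: "(\<lambda>x. norm (f x)) \<in> borel_measurable M"
      using nf by auto
    have [measurable]: "(\<lambda>x. norm (s i x)) \<in> borel_measurable M"
      by (rule borel_measurable_simple_function[OF simple_function_compose1[OF s]])
    show ?thesis unfolding A_def by measurable
  qed
  have sr: "simple_function M (r i)" for i
    unfolding r_def using A[of i] by (intro simple_function_If_set s) auto
  have r_le: "norm (r i x) \<le> 2 * norm (f x)" for i x
    by (auto simp: r_def A_def)
  have br: "bochner_integrable M (r i)" for i
    by (rule bochner_integrable_bound[OF strongly_measurable_simple[OF sr], of "\<lambda>x. 2 * norm (f x)"])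
       (use nf r_le in auto)
  have sbr: "simple_bochner_integrable M (r i)" for i
    using bochner_integrableD(2)[OF br, of i]
    by (intro simple_bochner_integrableI_bounded sr) (auto simp: integrable_iff_bounded)
  have lim: "AE x in M. (\<lambda>i. r i x) \<longlonglongrightarrow> f x"
    using ae AE_space
  proof eventually_elim
    case (elim x)
    show ?case
    proof (cases "f x = 0")
      case True
      then have "r i x = 0" for i using r_le[of i x] by simp
      then show ?thesis using True by simp
    next
      case False
      then have "norm (f x) < 2 * norm (f x)" by simp
      with tendsto_norm[OF elim(1)] have "\<forall>\<^sub>F i in sequentially. norm (s i x) < 2 * norm (f x)"
        by (rule order_tendstoD)
      then have "\<forall>\<^sub>F i in sequentially. s i x = r i x"
        by eventually_elim (use elim in \<open>simp add: r_def A_def\<close>)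
      with elim(1) show ?thesis by (rule Lim_transform_eventually)
    qed
  qed
  have "(\<lambda>i. LINT x|M. norm (f x - r i x)) \<longlonglongrightarrow> (LINT x|M. 0)"
  proof (rule integral_dominated_convergence[where w = "\<lambda>x. 3 * norm (f x)"])
    show "AE x in M. (\<lambda>i. norm (f x - r i x)) \<longlonglongrightarrow> 0"
      using lim
    proof eventually_elim
      case (elim x)
      show ?case
        using tendsto_norm[OF tendsto_diff[OF tendsto_const[of "f x"] elim]] by simp
    qed
    show "AE x in M. norm (norm (f x - r i x)) \<le> 3 * norm (f x)" for i
    proof (rule AE_I2)
      fix x show "norm (norm (f x - r i x)) \<le> 3 * norm (f x)"
        using norm_triangle_ineq4[of "f x" "r i x"] r_le[of i x] by simp
    qed
    show "(\<lambda>x. norm (f x - r i x)) \<in> borel_measurable M" for i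
      using integrable_norm_diff[OF f br] by auto
  qed (use nf in auto)
  then have "\<forall>\<^sub>F i in sequentially. (LINT x|M. norm (f x - r i x)) < e"
    using e by (intro order_tendstoD(2)) auto
  then obtain i where "(LINT x|M. norm (f x - r i x)) < e"
    by (auto simp: eventually_sequentially)
  with sbr show thesis by (rule that)
qed

lemma integrable_norm_diff_simple:
  fixes f :: "'a \<Rightarrow> 'b::banach"
  shows "bochner_integrable M f \<Longrightarrow> simple_bochner_integrable M s \<Longrightarrow> integrable M (\<lambda>x. norm (f x - s x))"
  by (rule integrable_norm_diff[OF _ bochner_integrable_simple])

lemma simple_bochner_integral_dist:
  fixes f :: "'a \<Rightarrow> 'b::banach"
  assumes f: "bochner_integrable M f"
    and s: "simple_bochner_integrable M s" and r: "simple_bochner_integrable M r"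
  shows "norm (simple_bochner_integral M s - simple_bochner_integral M r)
    \<le> (LINT x|M. norm (f x - s x)) + (LINT x|M. norm (f x - r x))"
proof -
  note fs = integrable_norm_diff_simple[OF f s] and fr = integrable_norm_diff_simple[OF f r]
  have sr: "simple_bochner_integrable M (\<lambda>x. s x - r x)"
    using simple_bochner_integrable_compose2[of "(-)" M s r] s r by simp
  have "norm (simple_bochner_integral M s - simple_bochner_integral M r) \<le> (LINT x|M. norm (s x - r x))"
    using simple_bochner_integral_le(2)[OF sr] simple_bochner_integral_diff[OF s r] by simp
  also have "\<dots> \<le> (LINT x|M. norm (f x - s x) + norm (f x - r x))"
  proof (rule integral_mono)
    fix x show "norm (s x - r x) \<le> norm (f x - s x) + norm (f x - r x)"
      using norm_triangle_ineq4[of "f x - r x" "f x - s x"] by simp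
  qed (use fs fr simple_bochner_integral_le(1)[OF sr] in auto)
  also have "\<dots> = (LINT x|M. norm (f x - s x)) + (LINT x|M. norm (f x - r x))"
    using fs fr by (rule Bochner_Integration.integral_add)
  finally show ?thesis .
qed

text \<open>Approximation by simple functions determines the integral: uniqueness, linearity and the norm
  bound (the case \<open>s = 0\<close>) all follow from this estimate.\<close>

lemma is_bochner_integral_dist_simple:
  fixes f :: "'a \<Rightarrow> 'b::banach"
  assumes f: "bochner_integrable M f" and J: "is_bochner_integral M f J"
    and s: "simple_bochner_integrable M s"
  shows "norm (J - simple_bochner_integral M s) \<le> (LINT x|M. norm (f x - s x))"
proof -
  obtain r where r: "\<And>i::nat. simple_bochner_integrable M (r i)"
      "(\<lambda>i. \<integral>\<^sup>+x. norm (f x - r i x) \<partial>M) \<longlonglongrightarrow> 0"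
      "(\<lambda>i. simple_bochner_integral M (r i)) \<longlonglongrightarrow> J"
    using J unfolding is_bochner_integral_def by blast
  have "(\<integral>\<^sup>+x. norm (f x - r i x) \<partial>M) = ennreal (LINT x|M. norm (f x - r i x))" for i
    by (rule nn_integral_eq_integral[OF integrable_norm_diff[OF f bochner_integrable_simple[OF r(1)]]]) simp
  with r(2) have "(\<lambda>i. ennreal (LINT x|M. norm (f x - r i x))) \<longlonglongrightarrow> ennreal 0"
    by simp
  then have "(\<lambda>i. LINT x|M. norm (f x - r i x)) \<longlonglongrightarrow> 0"
    by (subst (asm) tendsto_ennreal_iff) auto
  then have "(\<lambda>i. (LINT x|M. norm (f x - r i x)) + (LINT x|M. norm (f x - s x)))
      \<longlonglongrightarrow> 0 + (LINT x|M. norm (f x - s x))"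
    by (intro tendsto_intros)
  moreover have "(\<lambda>i. norm (simple_bochner_integral M (r i) - simple_bochner_integral M s))
      \<longlonglongrightarrow> norm (J - simple_bochner_integral M s)"
    by (intro tendsto_intros r(3))
  ultimately show ?thesis
    using simple_bochner_integral_dist[OF f r(1) s]
    by (intro tendsto_le[OF sequentially_bot]) auto
qed

lemma is_bochner_integral_bochner_integral:
  fixes f :: "'a \<Rightarrow> 'b::banach"
  assumes f: "bochner_integrable M f"
  shows "is_bochner_integral M f (bochner_integral M f)"
proof -
  \<comment> \<open>The integrals of simple functions approaching \<open>f\<close> form a Cauchy sequence.\<close>
  have "\<exists>s. simple_bochner_integrable M s \<and> (LINT x|M. norm (f x - s x)) < inverse (real (Suc n))" for n
    using bochner_integrable_simple_approx[OF f, of "inverse (real (Suc n))"] by auto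
  then obtain r where r: "\<And>n. simple_bochner_integrable M (r n)"
      "\<And>n. (LINT x|M. norm (f x - r n x)) < inverse (real (Suc n))"
    by metis
  have lim: "(\<lambda>n. LINT x|M. norm (f x - r n x)) \<longlonglongrightarrow> 0"
    by (rule tendsto_sandwich[OF _ _ tendsto_const LIMSEQ_inverse_real_of_nat])
       (use r(2) in \<open>auto intro!: always_eventually integral_nonneg_AE less_imp_le\<close>)
  have "Cauchy (\<lambda>n. simple_bochner_integral M (r n))"
  proof (rule CauchyI)
    fix e :: real assume "0 < e"
    then have "\<forall>\<^sub>F n in sequentially. (LINT x|M. norm (f x - r n x)) < e / 2"
      using lim by (intro order_tendstoD(2)) auto
    then obtain N where N: "\<And>n. N \<le> n \<Longrightarrow> (LINT x|M. norm (f x - r n x)) < e / 2"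
      by (auto simp: eventually_sequentially)
    have "norm (simple_bochner_integral M (r m) - simple_bochner_integral M (r n)) < e"
      if "N \<le> m" "N \<le> n" for m n
      using simple_bochner_integral_dist[OF f r(1) r(1), of m n] N[OF that(1)] N[OF that(2)] by linarith
    then show "\<exists>K. \<forall>m\<ge>K. \<forall>n\<ge>K. norm (simple_bochner_integral M (r m) - simple_bochner_integral M (r n)) < e"
      by blast
  qed
  then obtain I where I: "(\<lambda>n. simple_bochner_integral M (r n)) \<longlonglongrightarrow> I"
    using Cauchy_convergent convergent_def by blast
  have "(\<integral>\<^sup>+x. norm (f x - r i x) \<partial>M) = ennreal (LINT x|M. norm (f x - r i x))" for i
    by (rule nn_integral_eq_integral[OF integrable_norm_diff[OF f bochner_integrable_simple[OF r(1)]]]) simp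
  with tendsto_ennrealI[OF lim] have "(\<lambda>i. \<integral>\<^sup>+x. norm (f x - r i x) \<partial>M) \<longlonglongrightarrow> 0"
    by simp
  with r(1) I have isI: "is_bochner_integral M f I"
    unfolding is_bochner_integral_def by blast
  have "J = I" if J: "is_bochner_integral M f J" for J
  proof -
    have "(\<lambda>n. simple_bochner_integral M (r n)) \<longlonglongrightarrow> J"
    proof (rule LIM_zero_cancel, rule tendsto_norm_zero_cancel)
      show "(\<lambda>n. norm (simple_bochner_integral M (r n) - J)) \<longlonglongrightarrow> 0"
        by (rule tendsto_sandwich[OF _ _ tendsto_const lim])
           (use is_bochner_integral_dist_simple[OF f J r(1)] in \<open>auto simp: norm_minus_commute\<close>)
    qed
    then show ?thesis using I LIMSEQ_unique by blast
  qed
  with isI show ?thesis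
    unfolding bochner_integral_def using f by (auto intro: theI2)
qed

lemmas bochner_integral_dist_simple =
  is_bochner_integral_dist_simple[OF _ is_bochner_integral_bochner_integral]

lemma bochner_integral_eqI:
  fixes f :: "'a \<Rightarrow> 'b::banach"
  assumes f: "bochner_integrable M f"
    and approx: "\<And>e. 0 < e \<Longrightarrow> \<exists>s. simple_bochner_integrable M s \<and>
      (LINT x|M. norm (f x - s x)) < e \<and> norm (I - simple_bochner_integral M s) < e"
  shows "bochner_integral M f = I"
proof (rule ccontr)
  assume "bochner_integral M f \<noteq> I"
  then have "0 < norm (bochner_integral M f - I) / 2" by simp
  from approx[OF this] obtain s where s: "simple_bochner_integrable M s"
      "(LINT x|M. norm (f x - s x)) < norm (bochner_integral M f - I) / 2"
      "norm (I - simple_bochner_integral M s) < norm (bochner_integral M f - I) / 2"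
    by blast
  then show False
    using bochner_integral_dist_simple[OF f f s(1)]
      norm_triangle_ineq4[of "bochner_integral M f - simple_bochner_integral M s"
        "I - simple_bochner_integral M s"] by simp
qed

lemma norm_bochner_integral_le:
  fixes f :: "'a \<Rightarrow> 'b::banach"
  assumes "bochner_integrable M f"
  shows "norm (bochner_integral M f) \<le> (LINT x|M. norm (f x))"
proof -
  have 0: "simple_bochner_integrable M (\<lambda>x. 0 :: 'b)"
    by (auto intro!: simple_bochner_integrable.intros)
  have "simple_bochner_integral M (\<lambda>x. 0 :: 'b) = 0"
    using simple_bochner_integral_le(2)[OF 0] by simp
  then show ?thesis
    using bochner_integral_dist_simple[OF assms assms 0] by simp
qed

lemma bochner_integral_add:
  fixes f :: "'a \<Rightarrow> 'b::banach"
  assumes f: "bochner_integrable M f" and g: "bochner_integrable M g"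
  shows "bochner_integral M (\<lambda>x. f x + g x) = bochner_integral M f + bochner_integral M g"
proof (rule bochner_integral_eqI[OF bochner_integrable_add[OF f g]])
  fix e :: real assume "0 < e"
  then have e: "0 < e / 2" by simp
  obtain s where s: "simple_bochner_integrable M s" "(LINT x|M. norm (f x - s x)) < e / 2"
    using bochner_integrable_simple_approx[OF f e] by blast
  obtain r where r: "simple_bochner_integrable M r" "(LINT x|M. norm (g x - r x)) < e / 2"
    using bochner_integrable_simple_approx[OF g e] by blast
  have sr: "simple_bochner_integrable M (\<lambda>x. s x + r x)"
    using simple_bochner_integrable_compose2[of "(+)" M s r] s r by simp
  have "(LINT x|M. norm (f x + g x - (s x + r x))) \<le> (LINT x|M. norm (f x - s x) + norm (g x - r x))"
    using f g s r sr
    by (intro integral_mono norm_diff_triangle_ineq Bochner_Integration.integrable_add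
        integrable_norm_diff_simple bochner_integrable_add)
  also have "\<dots> = (LINT x|M. norm (f x - s x)) + (LINT x|M. norm (g x - r x))"
    using f g s r by (intro Bochner_Integration.integral_add integrable_norm_diff_simple)
  also have "\<dots> < e" using s(2) r(2) by simp
  finally have 1: "(LINT x|M. norm (f x + g x - (s x + r x))) < e" .
  have "norm (bochner_integral M f + bochner_integral M g - simple_bochner_integral M (\<lambda>x. s x + r x))
    \<le> norm (bochner_integral M f - simple_bochner_integral M s)
      + norm (bochner_integral M g - simple_bochner_integral M r)"
    unfolding simple_bochner_integral_add[OF s(1) r(1)] by (rule norm_diff_triangle_ineq)
  also have "\<dots> < e"
    using bochner_integral_dist_simple[OF f f s(1)] bochner_integral_dist_simple[OF g g r(1)] s(2) r(2)
    by simp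
  finally show "\<exists>s. simple_bochner_integrable M s \<and> (LINT x|M. norm (f x + g x - s x)) < e \<and>
      norm (bochner_integral M f + bochner_integral M g - simple_bochner_integral M s) < e"
    using sr 1 by blast
qed

lemma bochner_integral_bounded_linear:
  fixes f :: "'a \<Rightarrow> 'b::banach" and T :: "'b \<Rightarrow> 'c::banach"
  assumes T: "bounded_linear T" and f: "bochner_integrable M f"
  shows "bochner_integral M (\<lambda>x. T (f x)) = T (bochner_integral M f)"
proof (rule bochner_integral_eqI[OF bochner_integrable_bounded_linear[OF T f]])
  interpret T: bounded_linear T by fact
  fix e :: real assume e: "0 < e"
  obtain K where K: "0 < K" "\<And>x. norm (T x) \<le> norm x * K"
    using T.pos_bounded by blast
  obtain s where s: "simple_bochner_integrable M s" "(LINT x|M. norm (f x - s x)) < e / K"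
    using bochner_integrable_simple_approx[OF f, of "e / K"] e K(1) by auto
  have Ts: "simple_bochner_integrable M (\<lambda>x. T (s x))"
    using simple_bochner_integrable_compose2[of "\<lambda>x y. T x" M s s] s T.zero by simp
  have "(LINT x|M. norm (T (f x) - T (s x))) \<le> (LINT x|M. norm (f x - s x) * K)"
    using integrable_norm_diff_simple[OF f s(1)]
      integrable_norm_diff_simple[OF bochner_integrable_bounded_linear[OF T f] Ts] K(2)
    by (intro integral_mono integrable_mult_left) (auto simp: T.diff[symmetric])
  also have "\<dots> < e" using s(2) K(1) by (simp add: pos_less_divide_eq)
  finally have 1: "(LINT x|M. norm (T (f x) - T (s x))) < e" .
  have "norm (T (bochner_integral M f) - simple_bochner_integral M (\<lambda>x. T (s x)))
    = norm (T (bochner_integral M f - simple_bochner_integral M s))"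
    unfolding simple_bochner_integral_linear[OF T.linear_axioms s(1)] by (simp add: T.diff)
  also have "\<dots> \<le> (LINT x|M. norm (f x - s x)) * K"
    using bochner_integral_dist_simple[OF f f s(1)] K order_trans mult_right_mono less_imp_le by metis
  also have "\<dots> < e" using s(2) K(1) by (simp add: pos_less_divide_eq)
  finally show "\<exists>s. simple_bochner_integrable M s \<and> (LINT x|M. norm (T (f x) - s x)) < e \<and>
      norm (T (bochner_integral M f) - simple_bochner_integral M s) < e"
    using Ts 1 by blast
qed

lemma bochner_integral_diff:
  fixes f :: "'a \<Rightarrow> 'b::banach"
  assumes f: "bochner_integrable M f" and g: "bochner_integrable M g"
  shows "bochner_integral M (\<lambda>x. f x - g x) = bochner_integral M f - bochner_integral M g"
  using bochner_integral_add[OF bochner_integrable_diff[OF f g] g] by (simp add: algebra_simps)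

lemma bochner_integral_cong:
  fixes f :: "'a \<Rightarrow> 'b::banach"
  assumes ae: "AE x in M. f x = g x"
  shows "bochner_integral M f = bochner_integral M g"
proof (cases "bochner_integrable M f")
  case True
  then have g: "bochner_integrable M g" by (rule bochner_integrable_cong[OF ae])
  have "(LINT x|M. norm (f x - g x)) = (LINT x|M. 0)"
    by (rule integral_cong_AE)
       (use ae integrable_norm_diff[OF True g] in \<open>auto elim!: eventually_mono\<close>)
  then have "norm (bochner_integral M f - bochner_integral M g) \<le> 0"
    using norm_bochner_integral_le[OF bochner_integrable_diff[OF True g]] bochner_integral_diff[OF True g]
    by simp
  then show ?thesis by simp
next
  case False
  moreover have "\<not> bochner_integrable M g"
    using False bochner_integrable_cong[of g f] ae by (auto simp: eq_commute)
  ultimately show ?thesis by (simp add: bochner_integral_def)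
qed

lemma bochner_integral_sum:
  fixes f :: "'i \<Rightarrow> 'a \<Rightarrow> 'b::banach"
  assumes "\<And>i. i \<in> A \<Longrightarrow> bochner_integrable M (f i)"
  shows "bochner_integrable M (\<lambda>x. \<Sum>i\<in>A. f i x) \<and>
    bochner_integral M (\<lambda>x. \<Sum>i\<in>A. f i x) = (\<Sum>i\<in>A. bochner_integral M (f i))"
  using assms
proof (induction A rule: infinite_finite_induct)
  case (insert i A)
  then show ?case
    using bochner_integrable_add[of "f i" "\<lambda>x. \<Sum>i\<in>A. f i x"] bochner_integral_add[of "f i" "\<lambda>x. \<Sum>i\<in>A. f i x"]
    by simp
qed (use bochner_integrable_simple[of "\<lambda>_. 0::'b"] norm_bochner_integral_le[of "\<lambda>_. 0::'b"]
      in \<open>auto simp: simple_bochner_integrable.simps\<close>)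

lemma bochner_integral_dominated_convergence:
  fixes f :: "nat \<Rightarrow> 'a \<Rightarrow> 'b::banach"
  assumes f: "\<And>i. strongly_measurable M (f i)" and g: "strongly_measurable M g"
    and w: "integrable M w" and le: "\<And>i. AE x in M. norm (f i x) \<le> w x"
    and lim: "AE x in M. (\<lambda>i. f i x) \<longlonglongrightarrow> g x"
  shows "bochner_integrable M g" "(\<lambda>i. bochner_integral M (f i)) \<longlonglongrightarrow> bochner_integral M g"
proof -
  have fi: "bochner_integrable M (f i)" for i
    by (rule bochner_integrable_bound[OF f w le])
  have all: "AE x in M. \<forall>i. norm (f i x) \<le> w x"
    unfolding AE_all_countable using le by blast
  have gle: "AE x in M. norm (g x) \<le> w x"
    using lim all
  proof eventually_elim
    case (elim x)
    then show ?case by (intro tendsto_upperbound[OF tendsto_norm[OF elim(1)]]) auto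
  qed
  show gi: "bochner_integrable M g"
    by (rule bochner_integrable_bound[OF g w gle])
  have "(\<lambda>i. LINT x|M. norm (f i x - g x)) \<longlonglongrightarrow> (LINT x|M. 0)"
  proof (rule integral_dominated_convergence[where w = "\<lambda>x. 2 * w x"])
    show "AE x in M. (\<lambda>i. norm (f i x - g x)) \<longlonglongrightarrow> 0"
      using lim by eventually_elim (intro tendsto_norm_zero LIM_zero)
    show "AE x in M. norm (norm (f i x - g x)) \<le> 2 * w x" for i
      using le[of i] gle
    proof eventually_elim
      case (elim x) then show ?case using norm_triangle_ineq4[of "f i x" "g x"] by simp
    qed
    show "(\<lambda>x. norm (f i x - g x)) \<in> borel_measurable M" for i
      using integrable_norm_diff[OF fi gi] by auto
  qed (use w in auto)
  then have lim0: "(\<lambda>i. LINT x|M. norm (f i x - g x)) \<longlonglongrightarrow> 0" by simp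
  show "(\<lambda>i. bochner_integral M (f i)) \<longlonglongrightarrow> bochner_integral M g"
  proof (rule LIM_zero_cancel, rule tendsto_norm_zero_cancel)
    show "(\<lambda>i. norm (bochner_integral M (f i) - bochner_integral M g)) \<longlonglongrightarrow> 0"
      by (rule tendsto_sandwich[OF _ _ tendsto_const lim0])
         (use norm_bochner_integral_le[OF bochner_integrable_diff[OF fi gi]]
           bochner_integral_diff[OF fi gi] in auto)
  qed
qed

lemma bochner_integral_eq_lebesgue:
  fixes f :: "'a \<Rightarrow> 'b::{banach, second_countable_topology}"
  shows "bochner_integrable M f \<longleftrightarrow> integrable M f"
    and "integrable M f \<Longrightarrow> bochner_integral M f = integral\<^sup>L M f"
proof -
  show iff: "bochner_integrable M f \<longleftrightarrow> integrable M f"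
    unfolding bochner_integrable_def using strongly_measurable_imp_borel strongly_measurable_borel
    by (metis borel_measurable_integrable integrable_norm integrable_norm_cancel)
  assume f: "integrable M f"
  show "bochner_integral M f = integral\<^sup>L M f"
  proof (rule bochner_integral_eqI)
    show bf: "bochner_integrable M f" using f iff by simp
    fix e :: real assume "0 < e"
    then obtain s where s: "simple_bochner_integrable M s" "(LINT x|M. norm (f x - s x)) < e"
      using bochner_integrable_simple_approx[OF bf] by blast
    have si: "integrable M s"
      using has_bochner_integral_simple_bochner_integrable[OF s(1)] by (rule integrable.intros)
    have "norm (integral\<^sup>L M f - simple_bochner_integral M s) = norm (LINT x|M. f x - s x)"
      using simple_bochner_integrable_eq_integral[OF s(1)] f si by simp
    also have "\<dots> \<le> (LINT x|M. norm (f x - s x))" by (rule integral_norm_bound)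
    finally show "\<exists>s. simple_bochner_integrable M s \<and> (LINT x|M. norm (f x - s x)) < e \<and>
        norm (integral\<^sup>L M f - simple_bochner_integral M s) < e"
      using s by force
  qed
qed

text \<open>Induction over \<open>L\<^sup>1\<close>: a property that is additive and closed under approximation in the
  \<open>L\<^sup>1\<close> norm need only be checked on one-step functions.\<close>

lemma bochner_integrable_induct [consumes 1, case_names indicator add lim]:
  fixes f :: "'a \<Rightarrow> 'b::banach"
  assumes f: "bochner_integrable M f"
    and ind: "\<And>A x. A \<in> sets M \<Longrightarrow> emeasure M A < \<infinity> \<Longrightarrow> P (\<lambda>t. indicator A t *\<^sub>R x)"
    and add: "\<And>f g. bochner_integrable M f \<Longrightarrow> bochner_integrable M g \<Longrightarrow> P f \<Longrightarrow> P g
      \<Longrightarrow> P (\<lambda>t. f t + g t)"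
    and lim: "\<And>f. bochner_integrable M f \<Longrightarrow>
      (\<And>e. 0 < e \<Longrightarrow> \<exists>g. bochner_integrable M g \<and> P g \<and> (LINT t|M. norm (f t - g t)) < e) \<Longrightarrow> P f"
  shows "P f"
proof (rule lim[OF f])
  fix e :: real assume "0 < e"
  then obtain s where s: "simple_bochner_integrable M s" "(LINT x|M. norm (f x - s x)) < e"
    using bochner_integrable_simple_approx[OF f] by blast
  note ss = simple_bochner_integrable_imp_simple[OF s(1)]
  define A where "A y = s -` {y} \<inter> space M" for y
  have A: "A y \<in> sets M" for y
    unfolding A_def by (rule simple_functionD(2)[OF ss])
  have fin: "emeasure M (A y) < \<infinity>" if "y \<noteq> 0" for y
  proof -
    have S: "{x \<in> space M. s x \<noteq> 0} \<in> sets M"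
      using simple_functionD(2)[OF ss, of "- {0}"] by (simp add: vimage_def Int_def conj_commute)
    have "emeasure M (A y) \<le> emeasure M {x \<in> space M. s x \<noteq> 0}"
      by (rule emeasure_mono[OF _ S]) (use that in \<open>auto simp: A_def\<close>)
    also have "\<dots> < \<infinity>"
      using s(1) by (auto simp: simple_bochner_integrable.simps less_top)
    finally show ?thesis .
  qed
  \<comment> \<open>The value zero is left out, since its level set may have infinite measure.\<close>
  define D where "D = s ` space M - {0}"
  have D: "finite D" unfolding D_def using simple_functionD(1)[OF ss] by simp
  have step: "bochner_integrable M (\<lambda>t. indicator (A y) t *\<^sub>R y)" if "y \<in> D" for y
  proof -
    have "y \<noteq> 0" using that by (simp add: D_def)
    have "simple_bochner_integrable M (\<lambda>t. indicator (A y) t *\<^sub>R y)"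
    proof
      show "simple_function M (\<lambda>t. indicator (A y) t *\<^sub>R y)"
        by (intro simple_function_compose1[OF simple_function_indicator[OF A], of "\<lambda>r. r *\<^sub>R y"])
      have "{t \<in> space M. indicator (A y) t *\<^sub>R y \<noteq> 0} = A y"
        using \<open>y \<noteq> 0\<close> by (auto simp: A_def indicator_def)
      then show "emeasure M {t \<in> space M. indicator (A y) t *\<^sub>R y \<noteq> 0} \<noteq> \<infinity>"
        using fin[OF \<open>y \<noteq> 0\<close>] by simp
    qed
    then show ?thesis by (rule bochner_integrable_simple)
  qed
  have "P (\<lambda>t. \<Sum>y\<in>F. indicator (A y) t *\<^sub>R y)" if "finite F" "F \<subseteq> D" for F
    using that
  proof (induction F)
    case empty
    then show ?case using ind[of "{}" 0] by simp
  next
    case (insert y F)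
    have "y \<noteq> 0" using insert.prems by (auto simp: D_def)
    have "P (\<lambda>t. indicator (A y) t *\<^sub>R y + (\<Sum>y\<in>F. indicator (A y) t *\<^sub>R y))"
    proof (rule add)
      show "bochner_integrable M (\<lambda>t. indicator (A y) t *\<^sub>R y)"
        using step insert.prems by simp
      show "bochner_integrable M (\<lambda>t. \<Sum>y\<in>F. indicator (A y) t *\<^sub>R y)"
        using bochner_integral_sum[of F "\<lambda>y t. indicator (A y) t *\<^sub>R y"] step insert.prems by auto
      show "P (\<lambda>t. indicator (A y) t *\<^sub>R y)"
        by (rule ind[OF A fin[OF \<open>y \<noteq> 0\<close>]])
      show "P (\<lambda>t. \<Sum>y\<in>F. indicator (A y) t *\<^sub>R y)"
        using insert by blast
    qed
    then show ?case unfolding sum.insert[OF insert.hyps] .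
  qed
  from this[OF D subset_refl] have P: "P (\<lambda>t. \<Sum>y\<in>D. indicator (A y) t *\<^sub>R y)" .
  have int: "bochner_integrable M (\<lambda>t. \<Sum>y\<in>D. indicator (A y) t *\<^sub>R y)"
    using bochner_integral_sum[of D "\<lambda>y t. indicator (A y) t *\<^sub>R y"] step by auto
  have eq: "(\<Sum>y\<in>D. indicator (A y) t *\<^sub>R y) = s t" if t: "t \<in> space M" for t
  proof -
    have "(\<Sum>y\<in>D. indicator (A y) t *\<^sub>R y) = (\<Sum>y\<in>D. if y = s t then y else 0)"
      by (rule sum.cong) (use t in \<open>auto simp: A_def indicator_def\<close>)
    also have "\<dots> = s t" using D t by (auto simp: D_def)
    finally show ?thesis .
  qed
  have "(LINT x|M. norm (f x - (\<Sum>y\<in>D. indicator (A y) x *\<^sub>R y))) = (LINT x|M. norm (f x - s x))"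
    by (rule Bochner_Integration.integral_cong) (simp_all add: eq)
  with s(2) int P show "\<exists>g. bochner_integrable M g \<and> P g \<and> (LINT x|M. norm (f x - g x)) < e"
    by auto
qed

text \<open>\<open>L\<^sup>1\<close> is closed under approximation in the \<open>L\<^sup>1\<close> norm even if the limit is not known to be
  measurable: it suffices that the errors have integrable majorants of small integral, since a
  subsequence of those majorants tends to zero almost everywhere.\<close>

lemma bochner_integrable_limit:
  fixes f :: "'a \<Rightarrow> 'b::banach"
  assumes "\<And>e. 0 < e \<Longrightarrow> \<exists>g h. bochner_integrable M g \<and> integrable M h \<and>
    (AE x in M. norm (f x - g x) \<le> h x) \<and> (LINT x|M. h x) < e"
  shows "bochner_integrable M f"
proof -
  have "\<exists>s h. simple_bochner_integrable M s \<and> integrable M h \<and>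
    (AE x in M. norm (f x - s x) \<le> h x) \<and> (LINT x|M. h x) < inverse (real (Suc n))" for n
  proof -
    define e where "e = inverse (real (Suc n)) / 2"
    have e: "0 < e" by (simp add: e_def)
    obtain g h where g: "bochner_integrable M g" "integrable M h"
        "AE x in M. norm (f x - g x) \<le> h x" "(LINT x|M. h x) < e"
      using assms[OF e] by blast
    obtain s where s: "simple_bochner_integrable M s" "(LINT x|M. norm (g x - s x)) < e"
      using bochner_integrable_simple_approx[OF g(1) e] by blast
    note i = integrable_norm_diff[OF g(1) bochner_integrable_simple[OF s(1)]]
    show ?thesis
    proof (intro exI conjI)
      show "AE x in M. norm (f x - s x) \<le> h x + norm (g x - s x)"
        using g(3)
      proof eventually_elim
        case (elim x)
        then show ?case using norm_triangle_ineq[of "f x - g x" "g x - s x"] by simp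
      qed
      show "(LINT x|M. h x + norm (g x - s x)) < inverse (real (Suc n))"
        using g(2,4) s(2) i by (simp add: e_def)
    qed (use s g i in auto)
  qed
  then obtain s h where s: "\<And>n. simple_bochner_integrable M (s n)" and h: "\<And>n. integrable M (h n)"
      and le: "\<And>n. AE x in M. norm (f x - s n x) \<le> h n x"
      and hn: "\<And>n. (LINT x|M. h n x) < inverse (real (Suc n))"
    by metis
  have h0: "AE x in M. 0 \<le> h n x" for n
    using le[of n] by eventually_elim (meson norm_ge_zero order_trans)
  have habs: "AE x in M. norm (h n x) = h n x" for n
    using h0[of n] by eventually_elim simp
  have "(LINT x|M. norm (h n x)) = (LINT x|M. h n x)" for n
    by (rule integral_cong_AE[OF _ _ habs]) (use h in auto)
  moreover have "0 \<le> (LINT x|M. norm (h n x))" for n by simp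
  ultimately have "(\<lambda>n. LINT x|M. norm (h n x)) \<longlonglongrightarrow> 0"
    using hn by (intro tendsto_sandwich[OF _ _ tendsto_const LIMSEQ_inverse_real_of_nat])
      (auto intro!: always_eventually less_imp_le)
  from tendsto_L1_AE_subseq[OF h this] obtain r :: "nat \<Rightarrow> nat"
    where r: "AE x in M. (\<lambda>n. h (r n) x) \<longlonglongrightarrow> 0" by blast
  have all: "AE x in M. \<forall>n. norm (f x - s n x) \<le> h n x"
    unfolding AE_all_countable using le by blast
  have "AE x in M. (\<lambda>n. s (r n) x) \<longlonglongrightarrow> f x"
    using r all
  proof eventually_elim
    case (elim x)
    have "(\<lambda>n. norm (s (r n) x - f x)) \<longlonglongrightarrow> 0"
      by (rule tendsto_sandwich[OF _ _ tendsto_const elim(1)])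
         (use elim(2) in \<open>auto intro!: always_eventually simp: norm_minus_commute\<close>)
    then show ?case by (rule LIM_zero_cancel[OF tendsto_norm_zero_cancel])
  qed
  then have f: "strongly_measurable M f"
    unfolding strongly_measurable_def
    using simple_bochner_integrable_imp_simple[OF s] by (intro exI[of _ "\<lambda>n. s (r n)"]) blast
  show ?thesis
  proof (rule bochner_integrable_bound[OF f])
    show "integrable M (\<lambda>x. h 0 x + norm (s 0 x))"
      using h simple_bochner_integral_le(1)[OF s] by simp
    show "AE x in M. norm (f x) \<le> h 0 x + norm (s 0 x)"
      using le[of 0]
    proof eventually_elim
      case (elim x)
      then show ?case using norm_triangle_ineq[of "f x - s 0 x" "s 0 x"] by simp
    qed
  qed
qed

end

context complete_measure
begin

lemma bochner_integrable_scaleC: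
  fixes f :: "'a \<Rightarrow> 'b::complex_banach"
  assumes w: "w \<in> borel_measurable M" "AE x in M. cmod (w x) \<le> C" and f: "bochner_integrable M f"
  shows "bochner_integrable M (\<lambda>x. w x *\<^sub>C f x)"
proof (rule bochner_integrable_bound)
  show "strongly_measurable M (\<lambda>x. w x *\<^sub>C f x)"
    by (intro strongly_measurable_scaleC strongly_measurable_borel w(1) bochner_integrableD(1)[OF f])
  show "integrable M (\<lambda>x. C * norm (f x))"
    using bochner_integrableD(2)[OF f] by simp
  show "AE x in M. norm (w x *\<^sub>C f x) \<le> C * norm (f x)"
    using w(2) by eventually_elim (simp add: norm_scaleC mult_right_mono)
qed

lemma norm_bochner_integral_scaleC_le:
  fixes f :: "'a \<Rightarrow> 'b::complex_banach"
  assumes w: "w \<in> borel_measurable M" "AE x in M. cmod (w x) \<le> C" and f: "bochner_integrable M f"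
  shows "norm (bochner_integral M (\<lambda>x. w x *\<^sub>C f x)) \<le> C * (LINT x|M. norm (f x))"
proof -
  note i = bochner_integrable_scaleC[OF w f]
  have "norm (bochner_integral M (\<lambda>x. w x *\<^sub>C f x)) \<le> (LINT x|M. norm (w x *\<^sub>C f x))"
    by (rule norm_bochner_integral_le[OF i])
  also have "\<dots> \<le> (LINT x|M. C * norm (f x))"
  proof (rule integral_mono_AE)
    show "AE x in M. norm (w x *\<^sub>C f x) \<le> C * norm (f x)"
      using w(2) by eventually_elim (simp add: norm_scaleC mult_right_mono)
  qed (use bochner_integrableD(2)[OF f] bochner_integrableD(2)[OF i] in auto)
  finally show ?thesis by simp
qed

text \<open>Weights with absolutely bounded sum may be summed under the integral; this interchange is
  behind the power series identities below.\<close>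

lemma bochner_integral_weight_series:
  fixes f :: "'a \<Rightarrow> 'b::complex_banach" and w :: "nat \<Rightarrow> 'a \<Rightarrow> complex"
  assumes w: "\<And>j. w j \<in> borel_measurable M"
    and sm: "\<And>x. x \<in> space M \<Longrightarrow> summable (\<lambda>j. cmod (w j x))"
    and C: "\<And>x. x \<in> space M \<Longrightarrow> (\<Sum>j. cmod (w j x)) \<le> C"
    and f: "bochner_integrable M f"
  shows "(\<lambda>j. bochner_integral M (\<lambda>x. w j x *\<^sub>C f x)) sums
    bochner_integral M (\<lambda>x. (\<Sum>j. w j x) *\<^sub>C f x)"
proof -
  have bound: "(\<Sum>j\<in>J. cmod (w j x)) \<le> C" if "x \<in> space M" "finite J" for x J
    using sum_le_suminf[OF sm[OF that(1)] that(2)] C[OF that(1)] by force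
  have wi: "bochner_integrable M (\<lambda>x. w j x *\<^sub>C f x)" for j
    by (rule bochner_integrable_scaleC[OF w _ f, where C = C])
       (use bound[of _ "{j}"] in \<open>auto intro: AE_I2\<close>)
  have m: "(\<lambda>x. \<Sum>j<n. w j x) \<in> borel_measurable M" for n
    by (intro borel_measurable_sum w)
  have eq: "(\<Sum>j<n. bochner_integral M (\<lambda>x. w j x *\<^sub>C f x))
      = bochner_integral M (\<lambda>x. (\<Sum>j<n. w j x) *\<^sub>C f x)" for n
    using bochner_integral_sum[of "{..<n}" "\<lambda>j x. w j x *\<^sub>C f x"] wi
    by (simp add: scaleC.sum_left)
  have "(\<lambda>n. bochner_integral M (\<lambda>x. (\<Sum>j<n. w j x) *\<^sub>C f x)) \<longlonglongrightarrow>
      bochner_integral M (\<lambda>x. (\<Sum>j. w j x) *\<^sub>C f x)"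
  proof (rule bochner_integral_dominated_convergence(2)[where w = "\<lambda>x. C * norm (f x)"])
    show "strongly_measurable M (\<lambda>x. (\<Sum>j<n. w j x) *\<^sub>C f x)" for n
      by (intro strongly_measurable_scaleC strongly_measurable_borel m bochner_integrableD(1)[OF f])
    show "strongly_measurable M (\<lambda>x. (\<Sum>j. w j x) *\<^sub>C f x)"
      by (intro strongly_measurable_scaleC strongly_measurable_borel borel_measurable_suminf w
          bochner_integrableD(1)[OF f])
    show "integrable M (\<lambda>x. C * norm (f x))"
      using bochner_integrableD(2)[OF f] by simp
    show "AE x in M. norm ((\<Sum>j<n. w j x) *\<^sub>C f x) \<le> C * norm (f x)" for n
    proof (rule AE_I2)
      fix x assume x: "x \<in> space M"
      have "cmod (\<Sum>j<n. w j x) \<le> C"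
        using norm_sum[of "\<lambda>j. w j x" "{..<n}"] bound[OF x, of "{..<n}"] by simp
      then show "norm ((\<Sum>j<n. w j x) *\<^sub>C f x) \<le> C * norm (f x)"
        by (simp add: norm_scaleC mult_right_mono)
    qed
    show "AE x in M. (\<lambda>n. (\<Sum>j<n. w j x) *\<^sub>C f x) \<longlonglongrightarrow> (\<Sum>j. w j x) *\<^sub>C f x"
      by (rule AE_I2) (rule scaleC.tendsto[OF summable_LIMSEQ[OF summable_norm_cancel[OF sm]] tendsto_const])
  qed
  then show ?thesis unfolding sums_def eq .
qed

end

section \<open>The half line\<close>

lemma complete_measure_lebesgue_on:
  assumes S: "S \<in> sets lebesgue"
  shows "complete_measure (lebesgue_on S)"
proof
  fix A B :: "'a set" assume BA: "B \<subseteq> A" and A: "A \<in> null_sets (lebesgue_on S)"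
  have A': "A \<subseteq> S" "A \<in> null_sets lebesgue"
    using A by (auto simp: null_sets_restrict_space[OF S])
  then have "B \<in> sets lebesgue" "B \<subseteq> S"
    using completion.complete[OF BA] BA by auto
  then show "B \<in> sets (lebesgue_on S)"
    using S by (auto simp: sets_restrict_space_iff)
qed

interpretation half_line: complete_measure half_line
  by (rule complete_measure_lebesgue_on) simp

lemma AE_half_lineI: "(\<And>t. 0 \<le> t \<Longrightarrow> P t) \<Longrightarrow> AE t in half_line. P t"
  by (rule AE_I2) simp

lemma half_line_measurable_continuous:
  fixes f :: "real \<Rightarrow> 'b::euclidean_space"
  shows "continuous_on {0..} f \<Longrightarrow> f \<in> borel_measurable half_line"
  by (rule continuous_imp_measurable_on_sets_lebesgue) auto

lemma strongly_measurable_continuous: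
  fixes f :: "real \<Rightarrow> 'b::banach"
  assumes f: "continuous_on {0..} f"
  shows "strongly_measurable half_line f"
proof -
  have "(\<lambda>t. t) \<in> borel_measurable half_line"
    by (rule half_line_measurable_continuous) (rule continuous_on_id)
  \<comment> \<open>\<open>f\<close> is composed with simple approximations of the identity, which may leave the half line and
    are therefore cut off at zero.\<close>
  from borel_measurable_implies_sequence_metric[OF this, of 0] obtain s :: "nat \<Rightarrow> real \<Rightarrow> real"
    where s: "\<And>i. simple_function half_line (s i)" "\<And>t. 0 \<le> t \<Longrightarrow> (\<lambda>i. s i t) \<longlonglongrightarrow> t"
    by auto
  have "(\<lambda>i. f (max 0 (s i t))) \<longlonglongrightarrow> f t" if "0 \<le> t" for t
    using tendsto_max[OF tendsto_const[of 0] s(2)[OF that]] that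
    by (intro continuous_on_tendsto_compose[OF f]) (auto simp: max_def)
  then show ?thesis
    unfolding strongly_measurable_def
    by (intro exI[of _ "\<lambda>i t. f (max 0 (s i t))"] conjI allI AE_half_lineI)
       (auto intro: simple_function_compose1[OF s(1), of "\<lambda>r. f (max 0 r)"])
qed

section \<open>Poisson weights\<close>

lemma poisson_weight_nonneg: "0 \<le> t \<Longrightarrow> 0 \<le> poisson_weight n t"
  by (simp add: poisson_weight_def)

lemma poisson_weight_sums: "(\<lambda>n. poisson_weight n t) sums 1"
proof -
  have "(\<lambda>n. exp (- t) * (t ^ n / fact n)) sums (exp (- t) * exp t)"
    using exp_converges[of t] by (intro sums_mult) (simp add: divide_inverse mult.commute)
  then show ?thesis by (simp add: poisson_weight_def exp_minus)
qed

lemma poisson_weight_le_1: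
  assumes "0 \<le> t" shows "poisson_weight n t \<le> 1"
  using sum_le_suminf[OF sums_summable[OF poisson_weight_sums], of "{n}" t]
    sums_unique[OF poisson_weight_sums, of t] poisson_weight_nonneg[OF assms] by simp

lemma continuous_on_poisson_weight: "continuous_on S (poisson_weight n)"
  unfolding poisson_weight_def by (intro continuous_intros) auto

lemma poisson_weight_measurable: "poisson_weight n \<in> borel_measurable half_line"
  by (rule half_line_measurable_continuous[OF continuous_on_poisson_weight])

text \<open>The Gamma integral, read off from the normalisation of the Erlang density.\<close>

lemma poisson_weight_exp_integral:
  assumes w: "0 \<le> w"
  shows "integrable half_line (\<lambda>t. poisson_weight n t * exp (- w * t))"
    and "(LINT t|half_line. poisson_weight n t * exp (- w * t)) = 1 / (1 + w) ^ (n + 1)"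
proof -
  let ?f = "\<lambda>t. poisson_weight n t * exp (- w * t)"
  have [simp]: "1 + w > 0" using w by simp
  interpret E: prob_space "density lborel (erlang_density n (1 + w))"
    by (rule prob_space_erlang_density) simp
  have "(\<integral>\<^sup>+t. ennreal (erlang_density n (1 + w) t) \<partial>lborel) = 1"
    using E.emeasure_space_1 by (simp add: emeasure_density)
  then have "(\<integral>\<^sup>+t. ennreal (1 / (1 + w) ^ (n + 1)) * ennreal (erlang_density n (1 + w) t) \<partial>lborel)
      = ennreal (1 / (1 + w) ^ (n + 1))"
    by (subst nn_integral_cmult) auto
  moreover have "ennreal (1 / (1 + w) ^ (n + 1)) * ennreal (erlang_density n (1 + w) t)
      = ennreal (?f t) * indicator {0..} t" for t
  proof (cases "0 \<le> t")
    case True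
    have "exp (- (1 + w) * t) = exp (- t) * exp (- w * t)"
      unfolding exp_add[symmetric] by (simp add: algebra_simps)
    moreover have "(1 + w) ^ Suc n \<noteq> 0" using w by simp
    ultimately have "1 / (1 + w) ^ (n + 1) * erlang_density n (1 + w) t = ?f t"
      using True unfolding erlang_density_def poisson_weight_def by simp
    then show ?thesis
      using True w by (simp add: ennreal_mult[symmetric] erlang_density_def)
  qed (simp add: erlang_density_def)
  moreover have "(\<integral>\<^sup>+t. ennreal (?f t) \<partial>half_line) = (\<integral>\<^sup>+t. ennreal (?f t) * indicator {0..} t \<partial>lborel)"
    by (subst nn_integral_restrict_space) (auto simp: nn_integral_completion)
  ultimately have nn: "(\<integral>\<^sup>+t. ennreal (?f t) \<partial>half_line) = ennreal (1 / (1 + w) ^ (n + 1))"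
    by simp
  have m: "?f \<in> borel_measurable half_line"
    by (intro half_line_measurable_continuous continuous_intros continuous_on_poisson_weight)
  have "0 \<le> 1 / (1 + w) ^ (n + 1)" using w by simp
  moreover have "AE t in half_line. 0 \<le> ?f t"
    by (rule AE_half_lineI) (simp add: poisson_weight_nonneg)
  ultimately show "integrable half_line ?f" "(LINT t|half_line. ?f t) = 1 / (1 + w) ^ (n + 1)"
    using nn nn_integral_eq_integrable[OF m] by blast+
qed

lemma poisson_weight_integral:
  "integrable half_line (poisson_weight n)" "(LINT t|half_line. poisson_weight n t) = 1"
  using poisson_weight_exp_integral[of 0 n] by auto

lemma power_exp_le:
  fixes t d :: real
  assumes "0 \<le> t" "0 < d"
  shows "t ^ n * exp (- d * t) \<le> fact n / d ^ n"
  using poisson_weight_le_1[of "d * t" n] assms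
  by (simp add: poisson_weight_def power_mult_distrib field_simps)

section \<open>The Poisson transformation as an operator\<close>

lemma L1_iff: "f \<in> L1 \<longleftrightarrow> bochner_integrable half_line f"
  by (simp add: L1_def)

lemma poisson_integrable:
  fixes f :: "real \<Rightarrow> 'a::complex_banach"
  assumes f: "f \<in> L1"
  shows "bochner_integrable half_line (\<lambda>t. poisson_weight n t *\<^sub>R f t)"
  unfolding scaleR_eq_scaleC
proof (rule half_line.bochner_integrable_scaleC[where C = 1])
  show "AE t in half_line. cmod (complex_of_real (poisson_weight n t)) \<le> 1"
    by (rule AE_half_lineI) (simp add: poisson_weight_le_1 poisson_weight_nonneg)
qed (use f poisson_weight_measurable in \<open>auto simp: L1_iff\<close>)

lemma L1_add: "f \<in> L1 \<Longrightarrow> g \<in> L1 \<Longrightarrow> (\<lambda>t. f t + g t) \<in> L1"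
  unfolding L1_iff by (rule half_line.bochner_integrable_add)

lemma L1_diff: "f \<in> L1 \<Longrightarrow> g \<in> L1 \<Longrightarrow> (\<lambda>t. f t - g t) \<in> L1"
  unfolding L1_iff by (rule half_line.bochner_integrable_diff)

lemma poisson_add:
  fixes f :: "real \<Rightarrow> 'a::complex_banach"
  assumes "f \<in> L1" "g \<in> L1"
  shows "poisson (\<lambda>t. f t + g t) n = poisson f n + poisson g n"
  unfolding poisson_def scaleR_add_right
  by (rule half_line.bochner_integral_add[OF poisson_integrable[OF assms(1)] poisson_integrable[OF assms(2)]])

lemma poisson_diff:
  fixes f :: "real \<Rightarrow> 'a::complex_banach"
  assumes "f \<in> L1" "g \<in> L1"
  shows "poisson (\<lambda>t. f t - g t) n = poisson f n - poisson g n"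
  unfolding poisson_def scaleR_diff_right
  by (rule half_line.bochner_integral_diff[OF poisson_integrable[OF assms(1)] poisson_integrable[OF assms(2)]])

lemma poisson_scaleC:
  fixes f :: "real \<Rightarrow> 'a::complex_banach"
  assumes "f \<in> L1"
  shows "poisson (\<lambda>t. c *\<^sub>C f t) n = c *\<^sub>C poisson f n"
proof -
  have "(\<lambda>t. poisson_weight n t *\<^sub>R c *\<^sub>C f t) = (\<lambda>t. c *\<^sub>C poisson_weight n t *\<^sub>R f t)"
    by (simp add: scaleR_eq_scaleC scaleC_scaleC mult.commute)
  then show ?thesis
    unfolding poisson_def
    using half_line.bochner_integral_bounded_linear[OF scaleC.bounded_linear_right
        poisson_integrable[OF assms], of c n] by simp
qed

lemma poisson_cong: "AE t in half_line. f t = g t \<Longrightarrow> poisson f n = poisson g n"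
  unfolding poisson_def by (rule half_line.bochner_integral_cong) (auto elim: eventually_mono)

lemma norm_poisson_le:
  fixes f :: "real \<Rightarrow> 'a::complex_banach"
  assumes f: "f \<in> L1"
  shows "norm (poisson f n) \<le> (LINT t|half_line. poisson_weight n t * norm (f t))"
proof -
  have "norm (poisson f n) \<le> (LINT t|half_line. norm (poisson_weight n t *\<^sub>R f t))"
    unfolding poisson_def by (rule half_line.norm_bochner_integral_le[OF poisson_integrable[OF f]])
  also have "\<dots> = (LINT t|half_line. poisson_weight n t * norm (f t))"
    by (rule Bochner_Integration.integral_cong) (simp_all add: poisson_weight_nonneg)
  finally show ?thesis .
qed

text \<open>Since the Poisson weights sum to one at every point, integrating them against the norm of
  \<open>f\<close> distributes the \<open>L\<^sup>1\<close> norm over the sequence without loss.\<close>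

lemma poisson_weight_norm_sums:
  fixes f :: "real \<Rightarrow> 'a::complex_banach"
  assumes f: "f \<in> L1"
  shows "(\<lambda>n. LINT t|half_line. poisson_weight n t * norm (f t)) sums L1_norm f"
proof -
  have nf: "integrable half_line (\<lambda>t. norm (f t))"
    using f half_line.bochner_integrableD(2) by (simp add: L1_iff)
  have le: "(\<Sum>n\<in>N. poisson_weight n t) \<le> 1" if "0 \<le> t" "finite N" for t N
    using sum_le_suminf[OF sums_summable[OF poisson_weight_sums] that(2), of t]
      sums_unique[OF poisson_weight_sums, of t] poisson_weight_nonneg[OF that(1)] by simp
  have pi: "integrable half_line (\<lambda>t. poisson_weight n t * norm (f t))" for n
  proof (rule Bochner_Integration.integrable_bound[OF nf])
    show "AE t in half_line. norm (poisson_weight n t * norm (f t)) \<le> norm (norm (f t))"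
      by (rule AE_half_lineI)
         (simp add: abs_mult poisson_weight_nonneg poisson_weight_le_1 mult_left_le_one_le)
  qed (use nf poisson_weight_measurable in \<open>auto intro!: borel_measurable_times\<close>)
  have "(\<lambda>m. LINT t|half_line. (\<Sum>n<m. poisson_weight n t) * norm (f t)) \<longlonglongrightarrow>
      (LINT t|half_line. norm (f t))"
  proof (rule integral_dominated_convergence[where w = "\<lambda>t. norm (f t)"])
    show "AE t in half_line. (\<lambda>m. (\<Sum>n<m. poisson_weight n t) * norm (f t)) \<longlonglongrightarrow> norm (f t)"
      using tendsto_mult_right[OF poisson_weight_sums[unfolded sums_def]] by (intro AE_half_lineI) simp
    show "AE t in half_line. norm ((\<Sum>n<m. poisson_weight n t) * norm (f t)) \<le> norm (f t)" for m
      by (rule AE_half_lineI)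
         (simp add: abs_mult sum_nonneg poisson_weight_nonneg le mult_left_le_one_le)
  qed (use nf poisson_weight_measurable in \<open>auto intro!: borel_measurable_times borel_measurable_sum\<close>)
  then show ?thesis
    unfolding sums_def L1_norm_def using pi by (simp add: sum_distrib_right)
qed

lemma poisson_in_l1:
  fixes f :: "real \<Rightarrow> 'a::complex_banach"
  assumes f: "f \<in> L1"
  shows "poisson f \<in> l1" "l1_norm (poisson f) \<le> L1_norm f"
proof -
  note s = poisson_weight_norm_sums[OF f]
  have sm: "summable (\<lambda>n. norm (poisson f n))"
    by (rule summable_comparison_test'[OF sums_summable[OF s], of 0]) (simp add: norm_poisson_le[OF f])
  then show "poisson f \<in> l1" by (simp add: l1_def)
  show "l1_norm (poisson f) \<le> L1_norm f"
    unfolding l1_norm_def sums_unique[OF s]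
    by (rule suminf_le[OF norm_poisson_le[OF f] sm sums_summable[OF s]])
qed

lemma poisson_scaleC_const:
  fixes x :: "'a::complex_banach"
  assumes "integrable half_line c"
  shows "(\<lambda>t. c t *\<^sub>C x) \<in> L1"
    and "poisson (\<lambda>t. c t *\<^sub>C x) n = (LINT t|half_line. complex_of_real (poisson_weight n t) * c t) *\<^sub>C x"
proof -
  have c: "bochner_integrable half_line c"
    using assms half_line.bochner_integral_eq_lebesgue(1) by blast
  show "(\<lambda>t. c t *\<^sub>C x) \<in> L1"
    unfolding L1_iff
    by (rule half_line.bochner_integrable_bounded_linear[OF scaleC.bounded_linear_left c])
  have "integrable half_line (\<lambda>t. complex_of_real (poisson_weight n t) * c t)"
  proof (rule Bochner_Integration.integrable_bound[OF assms])
    show "AE t in half_line. norm (complex_of_real (poisson_weight n t) * c t) \<le> norm (c t)"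
      by (rule AE_half_lineI)
         (simp add: norm_mult poisson_weight_nonneg poisson_weight_le_1 mult_left_le_one_le)
  qed (use assms poisson_weight_measurable[of n] in \<open>auto intro!: borel_measurable_times\<close>)
  then show "poisson (\<lambda>t. c t *\<^sub>C x) n = (LINT t|half_line. complex_of_real (poisson_weight n t) * c t) *\<^sub>C x"
    unfolding poisson_def scaleR_eq_scaleC scaleC_scaleC
    using half_line.bochner_integral_bounded_linear[OF scaleC.bounded_linear_left,
        of "\<lambda>t. complex_of_real (poisson_weight n t) * c t" x]
      half_line.bochner_integral_eq_lebesgue[of "\<lambda>t. complex_of_real (poisson_weight n t) * c t"] by simp
qed

lemma poisson_bounded_operator:
  "bounded_operator_L1_l1 (poisson :: (real \<Rightarrow> 'a::complex_banach) \<Rightarrow> nat \<Rightarrow> 'a)"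
  unfolding bounded_operator_L1_l1_def
proof (intro conjI ballI allI impI exI)
  fix f :: "real \<Rightarrow> 'a" assume f: "f \<in> L1"
  show "poisson f \<in> l1" "l1_norm (poisson f) \<le> 1 * L1_norm f"
    using poisson_in_l1[OF f] by auto
  show "poisson (\<lambda>t. c *\<^sub>C f t) = (\<lambda>n. c *\<^sub>C poisson f n)" for c
    by (rule ext) (rule poisson_scaleC[OF f])
  fix g :: "real \<Rightarrow> 'a" assume g: "g \<in> L1"
  show "poisson (\<lambda>t. f t + g t) = (\<lambda>n. poisson f n + poisson g n)"
    by (rule ext) (rule poisson_add[OF f g])
  show "poisson f = poisson g" if "L1_eq f g"
    using that unfolding L1_eq_def by (intro ext poisson_cong)
qed

text \<open>The bound one is attained at every nonnegative scalar function times a fixed vector, because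
  no cancellation occurs; the scalar function is taken to be \<open>poisson_weight 0\<close>.\<close>

lemma opnorm_poisson:
  assumes "\<exists>x::'a::complex_banach. x \<noteq> 0"
  shows "opnorm_L1_l1 (poisson :: (real \<Rightarrow> 'a) \<Rightarrow> nat \<Rightarrow> 'a) = 1"
proof -
  obtain x0 :: 'a where "x0 \<noteq> 0" using assms by blast
  define x where "x = inverse (norm x0) *\<^sub>R x0"
  have x: "norm x = 1" using \<open>x0 \<noteq> 0\<close> by (simp add: x_def)
  define f where "f t = complex_of_real (poisson_weight 0 t) *\<^sub>C x" for t
  have w0: "integrable half_line (\<lambda>t. complex_of_real (poisson_weight 0 t))"
    using poisson_weight_integral(1)[of 0] by simp
  have f: "f \<in> L1"
    unfolding f_def by (rule poisson_scaleC_const(1)[OF w0])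
  have nf: "norm (f t) = poisson_weight 0 t" if "0 \<le> t" for t
    using that x by (simp add: f_def norm_scaleC poisson_weight_nonneg)
  have "L1_norm f = (LINT t|half_line. poisson_weight 0 t)"
    unfolding L1_norm_def by (rule Bochner_Integration.integral_cong) (simp_all add: nf)
  then have L: "L1_norm f = 1" by (simp add: poisson_weight_integral(2))
  have "norm (poisson f n) = (LINT t|half_line. poisson_weight n t * norm (f t))" for n
  proof -
    have "(LINT t|half_line. poisson_weight n t * norm (f t))
        = (LINT t|half_line. poisson_weight n t * poisson_weight 0 t)"
      by (rule Bochner_Integration.integral_cong) (simp_all add: nf)
    moreover have "0 \<le> (LINT t|half_line. poisson_weight n t * poisson_weight 0 t)"
      by (rule integral_nonneg_AE) (auto intro!: AE_half_lineI mult_nonneg_nonneg poisson_weight_nonneg)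
    ultimately show ?thesis
      unfolding f_def poisson_scaleC_const(2)[OF w0] of_real_mult[symmetric] integral_complex_of_real
      using x by (simp add: norm_scaleC)
  qed
  then have l: "l1_norm (poisson f) = 1"
    unfolding l1_norm_def using sums_unique[OF poisson_weight_norm_sums[OF f]] L by simp
  show ?thesis
    unfolding opnorm_L1_l1_def
  proof (rule cSup_eq_maximum)
    show "1 \<in> {l1_norm (poisson f) |f::real \<Rightarrow> 'a. f \<in> L1 \<and> L1_norm f \<le> 1}"
      using f L l by force
    show "y \<le> 1" if "y \<in> {l1_norm (poisson f) |f::real \<Rightarrow> 'a. f \<in> L1 \<and> L1_norm f \<le> 1}" for y
      using that poisson_in_l1(2) by fastforce
  qed
qed

lemma poisson_Z_transform:
  fixes f :: "real \<Rightarrow> 'a::complex_banach"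
  assumes f: "f \<in> L1" and z: "1 < cmod z"
  shows "(\<lambda>j. (1 / z ^ j) *\<^sub>C poisson f j) sums laplace f (1 - 1 / z)"
proof -
  define w where "w j t = (1 / z ^ j) * complex_of_real (poisson_weight j t)" for j t
  have le: "cmod (w j t) \<le> poisson_weight j t" if "0 \<le> t" for j t
  proof -
    have "cmod (1 / z ^ j) \<le> 1"
      using one_le_power[of "cmod z" j] z by (simp add: norm_divide norm_power divide_le_eq)
    from mult_right_mono[OF this poisson_weight_nonneg[OF that, of j]] show ?thesis
      unfolding w_def norm_mult norm_of_real abs_of_nonneg[OF poisson_weight_nonneg[OF that]] by simp
  qed
  have sm: "summable (\<lambda>j. cmod (w j t))" if "0 \<le> t" for t
    by (rule summable_comparison_test'[OF sums_summable[OF poisson_weight_sums[of t]], of 0])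
       (simp add: le[OF that])
  have "(\<lambda>j. w j t) sums exp (- (1 - 1 / z) * complex_of_real t)" for t
  proof -
    have "(\<lambda>j. exp (- of_real t) * ((of_real t / z) ^ j /\<^sub>R fact j)) sums (exp (- of_real t) * exp (of_real t / z))"
      by (intro sums_mult exp_converges)
    moreover have "exp (- of_real t) * exp (of_real t / z) = exp (- (1 - 1 / z) * complex_of_real t)"
      unfolding exp_add[symmetric] by (rule arg_cong[where f = exp]) (simp add: algebra_simps)
    moreover have "exp (- of_real t) * ((of_real t / z) ^ j /\<^sub>R fact j) = w j t" for j
      unfolding w_def poisson_weight_def
      by (simp add: exp_of_real[symmetric] power_mult_distrib power_inverse scaleR_conv_of_real divide_inverse)
    ultimately show ?thesis by simp
  qed
  then have w_eq: "(\<Sum>j. w j t) = exp (- (1 - 1 / z) * complex_of_real t)" for t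
    by (rule sums_unique[symmetric])
  have "(\<lambda>j. bochner_integral half_line (\<lambda>t. w j t *\<^sub>C f t)) sums
      bochner_integral half_line (\<lambda>t. (\<Sum>j. w j t) *\<^sub>C f t)"
  proof (rule half_line.bochner_integral_weight_series[where C = 1])
    show "w j \<in> borel_measurable half_line" for j
      unfolding w_def using poisson_weight_measurable[of j] by measurable
    show "(\<Sum>j. cmod (w j t)) \<le> 1" if "t \<in> space half_line" for t
      using that suminf_le[OF le sm sums_summable[OF poisson_weight_sums[of t]]]
        sums_unique[OF poisson_weight_sums, of t] by simp
  qed (use sm f in \<open>auto simp: L1_iff\<close>)
  moreover have "bochner_integral half_line (\<lambda>t. w j t *\<^sub>C f t) = (1 / z ^ j) *\<^sub>C poisson f j" for j
    unfolding poisson_def w_def scaleR_eq_scaleC scaleC_scaleC[symmetric]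
    by (rule half_line.bochner_integral_bounded_linear[OF scaleC.bounded_linear_right])
       (use poisson_integrable[OF f, of j] in \<open>simp add: scaleR_eq_scaleC\<close>)
  ultimately show ?thesis
    unfolding laplace_def w_eq by simp
qed

lemma poisson_decay:
  fixes f :: "real \<Rightarrow> 'a::complex_banach"
  assumes f: "strongly_measurable half_line f" and w: "0 \<le> w"
    and le: "AE t in half_line. norm (f t) \<le> C * exp (- w * t)"
  shows "bochner_integrable half_line (\<lambda>t. poisson_weight n t *\<^sub>R f t)"
    and "norm (poisson f n) \<le> C / (1 + w) ^ (n + 1)"
proof -
  have i: "integrable half_line (\<lambda>t. C * (poisson_weight n t * exp (- w * t)))"
    using poisson_weight_exp_integral(1)[OF w] by simp
  have le': "AE t in half_line. norm (poisson_weight n t *\<^sub>R f t) \<le> C * (poisson_weight n t * exp (- w * t))"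
    using le AE_space
  proof eventually_elim
    case (elim t)
    then have "poisson_weight n t * norm (f t) \<le> poisson_weight n t * (C * exp (- w * t))"
      by (intro mult_left_mono poisson_weight_nonneg) auto
    then show ?case using elim by (simp add: poisson_weight_nonneg mult_ac)
  qed
  show b: "bochner_integrable half_line (\<lambda>t. poisson_weight n t *\<^sub>R f t)"
    by (rule half_line.bochner_integrable_bound[OF strongly_measurable_scaleR[OF
          strongly_measurable_borel[OF poisson_weight_measurable] f] i le'])
  have "norm (poisson f n) \<le> (LINT t|half_line. norm (poisson_weight n t *\<^sub>R f t))"
    unfolding poisson_def by (rule half_line.norm_bochner_integral_le[OF b])
  also have "\<dots> \<le> (LINT t|half_line. C * (poisson_weight n t * exp (- w * t)))"
    by (rule integral_mono_AE[OF half_line.bochner_integrableD(2)[OF b] i le'])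
  also have "\<dots> = C / (1 + w) ^ (n + 1)"
    using poisson_weight_exp_integral(2)[OF w, of n] by simp
  finally show "norm (poisson f n) \<le> C / (1 + w) ^ (n + 1)" .
qed

section \<open>The Laplace transform and its derivatives\<close>

text \<open>The \<open>n\<close>-th derivative of the Laplace transform, in integral form.\<close>

definition laplace_moment :: "(real \<Rightarrow> 'a::complex_banach) \<Rightarrow> nat \<Rightarrow> complex \<Rightarrow> 'a"
  where "laplace_moment f n s =
    bochner_integral half_line (\<lambda>t. ((- complex_of_real t) ^ n * exp (- s * complex_of_real t)) *\<^sub>C f t)"

lemma laplace_weight_measurable:
  "(\<lambda>t. (- complex_of_real t) ^ n * exp (- s * complex_of_real t)) \<in> borel_measurable half_line"
  by (intro half_line_measurable_continuous continuous_intros)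

lemma laplace_weight_bound:
  assumes "0 < d" "d \<le> Re s"
  shows "AE t in half_line. cmod ((- complex_of_real t) ^ n * exp (- s * complex_of_real t)) \<le> fact n / d ^ n"
proof (rule AE_half_lineI)
  fix t :: real assume t: "0 \<le> t"
  have "cmod ((- complex_of_real t) ^ n * exp (- s * complex_of_real t)) = t ^ n * exp (- Re s * t)"
    using t by (simp add: norm_mult norm_power)
  also have "\<dots> \<le> t ^ n * exp (- d * t)"
    using assms t by (intro mult_left_mono) (auto intro: mult_right_mono)
  also have "\<dots> \<le> fact n / d ^ n" by (rule power_exp_le[OF t assms(1)])
  finally show "cmod ((- complex_of_real t) ^ n * exp (- s * complex_of_real t)) \<le> fact n / d ^ n" .
qed

text \<open>Differentiation under the integral sign, with the second order Taylor remainder of the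
  exponential: half of the decay of the exponential pays for the growth of the remainder, the other
  half absorbs the powers of \<open>t\<close>.\<close>

lemma laplace_weight_remainder:
  assumes d: "0 < d" "2 * d \<le> Re s" and h: "cmod h \<le> d" and t: "0 \<le> t"
  defines "e \<equiv> \<lambda>s. exp (- s * complex_of_real t)"
  shows "cmod ((- complex_of_real t) ^ n * e (s + h) - (- complex_of_real t) ^ n * e s
      - h * ((- complex_of_real t) ^ Suc n * e s)) \<le> fact (n + 2) / d ^ (n + 2) * (cmod h)\<^sup>2"
proof -
  define u where "u = - h * complex_of_real t"
  have "e (s + h) = e s * exp u"
    unfolding e_def u_def exp_add[symmetric] by (simp add: algebra_simps)
  then have "(- complex_of_real t) ^ n * e (s + h) - (- complex_of_real t) ^ n * e s
      - h * ((- complex_of_real t) ^ Suc n * e s) = (- complex_of_real t) ^ n * e s * (exp u - (1 + u))"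
    by (simp add: u_def algebra_simps)
  moreover have "cmod (exp u - (1 + u)) \<le> exp (d * t) * (cmod h * t)\<^sup>2"
  proof -
    have "cmod (exp u - (1 + u)) \<le> exp \<bar>Re u\<bar> * (cmod u)\<^sup>2"
      using Taylor_exp[of u 1] by (simp add: power2_eq_square)
    also have "cmod u = cmod h * t" using t by (simp add: u_def norm_mult)
    also have "\<bar>Re u\<bar> \<le> cmod u" by (rule abs_Re_le_cmod)
    also have "cmod u \<le> d * t" using h t by (simp add: u_def norm_mult mult_right_mono)
    finally show ?thesis by (simp add: mult_right_mono)
  qed
  ultimately have "cmod ((- complex_of_real t) ^ n * e (s + h) - (- complex_of_real t) ^ n * e s
      - h * ((- complex_of_real t) ^ Suc n * e s)) \<le> t ^ n * exp (- Re s * t) * (exp (d * t) * (cmod h * t)\<^sup>2)"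
    using t by (simp add: norm_mult norm_power e_def mult_left_mono)
  also have "\<dots> \<le> t ^ n * exp (- (2 * d) * t) * (exp (d * t) * (cmod h * t)\<^sup>2)"
    using d t by (intro mult_right_mono mult_left_mono) (auto intro: mult_right_mono)
  also have "\<dots> = (t ^ (n + 2) * exp (- d * t)) * (cmod h)\<^sup>2"
  proof -
    have "exp (- (2 * d) * t) * exp (d * t) = exp (- d * t)"
      unfolding exp_add[symmetric] by (simp add: algebra_simps)
    moreover have "t ^ n * x * (y * (cmod h * t)\<^sup>2) = t ^ (n + 2) * (x * y) * (cmod h)\<^sup>2" for x y
      by (simp add: power_mult_distrib power_add power2_eq_square mult_ac)
    ultimately show ?thesis by (simp only:)
  qed
  also have "\<dots> \<le> fact (n + 2) / d ^ (n + 2) * (cmod h)\<^sup>2"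
    by (rule mult_right_mono[OF power_exp_le[OF t d(1)]]) simp
  finally show ?thesis .
qed

lemma has_cderiv_laplace_moment:
  fixes f :: "real \<Rightarrow> 'a::complex_banach"
  assumes f: "f \<in> L1" and s: "0 < Re s"
  shows "has_cderiv (laplace_moment f n) (laplace_moment f (Suc n) s) s"
proof -
  define w where "w n s t = (- complex_of_real t) ^ n * exp (- s * complex_of_real t)" for n s t
  have bf: "bochner_integrable half_line f" using f by (simp add: L1_iff)
  have G: "laplace_moment f n s = bochner_integral half_line (\<lambda>t. w n s t *\<^sub>C f t)" for n s
    by (simp add: laplace_moment_def w_def)
  have wm: "w n s \<in> borel_measurable half_line" for n s
    unfolding w_def by (rule laplace_weight_measurable)
  have int: "bochner_integrable half_line (\<lambda>t. w n s t *\<^sub>C f t)" if "0 < Re s" for n s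
    by (rule half_line.bochner_integrable_scaleC[OF wm _ bf])
       (use laplace_weight_bound[OF that order_refl] in \<open>simp add: w_def\<close>)
  define d where "d = Re s / 2"
  have d: "0 < d" "2 * d \<le> Re s" using s by (auto simp: d_def)
  define K where "K = fact (n + 2) / d ^ (n + 2) * L1_norm f"
  have rem: "norm (laplace_moment f n (s + h) - laplace_moment f n s - h *\<^sub>C laplace_moment f (Suc n) s)
      \<le> K * (cmod h)\<^sup>2" if h: "cmod h \<le> d" for h
  proof -
    have "0 < Re (s + h)" using h d abs_Re_le_cmod[of h] s by simp
    note i = int[OF this, of n] int[OF s, of n] int[OF s, of "Suc n"]
    note i3 = half_line.bochner_integrable_bounded_linear[OF scaleC.bounded_linear_right i(3), of h]
    have "laplace_moment f n (s + h) - laplace_moment f n s - h *\<^sub>C laplace_moment f (Suc n) s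
        = bochner_integral half_line
            (\<lambda>t. w n (s + h) t *\<^sub>C f t - w n s t *\<^sub>C f t - h *\<^sub>C w (Suc n) s t *\<^sub>C f t)"
      unfolding G half_line.bochner_integral_diff[OF half_line.bochner_integrable_diff[OF i(1,2)] i3]
        half_line.bochner_integral_diff[OF i(1,2)]
        half_line.bochner_integral_bounded_linear[OF scaleC.bounded_linear_right i(3)] ..
    also have "\<dots> = bochner_integral half_line
        (\<lambda>t. (w n (s + h) t - w n s t - h * w (Suc n) s t) *\<^sub>C f t)"
      by (simp add: scaleC.diff_left scaleC_scaleC)
    finally have eq: "laplace_moment f n (s + h) - laplace_moment f n s - h *\<^sub>C laplace_moment f (Suc n) s
        = bochner_integral half_line (\<lambda>t. (w n (s + h) t - w n s t - h * w (Suc n) s t) *\<^sub>C f t)" .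
    show ?thesis
      unfolding eq
    proof (rule order_trans[OF half_line.norm_bochner_integral_scaleC_le[OF _ _ bf]])
      show "AE t in half_line. cmod (w n (s + h) t - w n s t - h * w (Suc n) s t)
          \<le> fact (n + 2) / d ^ (n + 2) * (cmod h)\<^sup>2"
        unfolding w_def by (rule AE_half_lineI) (rule laplace_weight_remainder[OF d h])
      show "(\<lambda>t. w n (s + h) t - w n s t - h * w (Suc n) s t) \<in> borel_measurable half_line"
        by (intro borel_measurable_diff borel_measurable_times borel_measurable_const wm)
    qed (simp add: K_def L1_norm_def mult_ac)
  qed
  show ?thesis
    unfolding has_cderiv_def has_derivative_at
  proof
    show "bounded_linear (\<lambda>h. h *\<^sub>C laplace_moment f (Suc n) s)"
      by (rule scaleC.bounded_linear_left)
    have "\<forall>\<^sub>F h in at (0::complex). cmod h < d"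
      using d(1) by (auto simp: eventually_at intro!: exI[of _ d])
    then have ev: "\<forall>\<^sub>F h in at 0. norm (laplace_moment f n (s + h) - laplace_moment f n s
        - h *\<^sub>C laplace_moment f (Suc n) s) / cmod h \<le> K * cmod h"
    proof eventually_elim
      case (elim h)
      then have "norm (laplace_moment f n (s + h) - laplace_moment f n s
          - h *\<^sub>C laplace_moment f (Suc n) s) \<le> K * cmod h * cmod h"
        using rem[of h] by (simp add: power2_eq_square)
      then show ?case by (cases "h = 0") (simp_all add: divide_le_eq)
    qed
    have lim: "((\<lambda>h::complex. K * cmod h) \<longlongrightarrow> 0) (at 0)"
      by (auto intro!: tendsto_eq_intros)
    show "((\<lambda>h. norm (laplace_moment f n (s + h) - laplace_moment f n s
        - h *\<^sub>C laplace_moment f (Suc n) s) / cmod h) \<longlongrightarrow> 0) (at 0)"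
      by (rule tendsto_sandwich[OF _ ev tendsto_const lim]) simp
  qed
qed

lemma cderiv_eqI:
  assumes "has_cderiv f D z"
  shows "cderiv f z = D"
proof -
  have "E = D" if "has_cderiv f E z" for E
  proof -
    have "(\<lambda>h. h *\<^sub>C E) = (\<lambda>h. h *\<^sub>C D)"
      using that assms unfolding has_cderiv_def by (rule has_derivative_unique)
    from fun_cong[OF this, of 1] show ?thesis by simp
  qed
  with assms show ?thesis unfolding cderiv_def by (intro the_equality)
qed

lemma has_cderiv_transform:
  assumes "has_cderiv f D z" "open S" "z \<in> S" "\<And>x. x \<in> S \<Longrightarrow> f x = g x"
  shows "has_cderiv g D z"
  using assms has_derivative_transform_within_open[of f _ z UNIV S g] unfolding has_cderiv_def by blast

lemma has_cderiv_laplace: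
  fixes f :: "real \<Rightarrow> 'a::complex_banach"
  assumes f: "f \<in> L1" and s: "0 < Re s"
  shows "(cderiv ^^ n) (laplace f) s = laplace_moment f n s"
    and "has_cderiv ((cderiv ^^ n) (laplace f)) (laplace_moment f (Suc n) s) s"
proof -
  have eq: "(cderiv ^^ n) (laplace f) s = laplace_moment f n s" if "0 < Re s" for s n
    using that
  proof (induction n arbitrary: s)
    case 0
    then show ?case by (simp add: laplace_def laplace_moment_def)
  next
    case (Suc n)
    have "has_cderiv ((cderiv ^^ n) (laplace f)) (laplace_moment f (Suc n) s) s"
      by (rule has_cderiv_transform[OF has_cderiv_laplace_moment[OF f Suc.prems] open_halfspace_Re_gt[of 0]])
         (use Suc in auto)
    then show ?case by (simp add: cderiv_eqI)
  qed
  show "(cderiv ^^ n) (laplace f) s = laplace_moment f n s" by (rule eq[OF s])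
  show "has_cderiv ((cderiv ^^ n) (laplace f)) (laplace_moment f (Suc n) s) s"
    by (rule has_cderiv_transform[OF has_cderiv_laplace_moment[OF f s] open_halfspace_Re_gt[of 0]])
       (use eq s in auto)
qed

lemma laplace_moment_integrable:
  fixes f :: "real \<Rightarrow> 'a::complex_banach"
  assumes f: "f \<in> L1" and s: "0 < Re s"
  shows "bochner_integrable half_line
    (\<lambda>t. ((- complex_of_real t) ^ n * exp (- s * complex_of_real t)) *\<^sub>C f t)"
  by (rule half_line.bochner_integrable_scaleC[OF laplace_weight_measurable laplace_weight_bound[OF s order_refl]])
     (use f in \<open>simp add: L1_iff\<close>)

lemma poisson_eq_laplace_moment:
  fixes f :: "real \<Rightarrow> 'a::complex_banach"
  assumes f: "f \<in> L1"
  shows "poisson f n = ((- 1) ^ n / fact n) *\<^sub>R laplace_moment f n 1"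
proof -
  have "((- 1) ^ n / fact n) *\<^sub>R ((- complex_of_real t) ^ n * exp (- 1 * complex_of_real t)) *\<^sub>C f t
      = poisson_weight n t *\<^sub>R f t" for t
  proof -
    have "complex_of_real ((- 1) ^ n / fact n) * ((- complex_of_real t) ^ n * exp (- 1 * complex_of_real t))
        = complex_of_real ((- 1) ^ n / fact n * ((- t) ^ n * exp (- t)))"
      by (simp add: exp_of_real[symmetric])
    also have "(- 1) ^ n / fact n * ((- t) ^ n * exp (- t)) = poisson_weight n t"
      by (simp add: poisson_weight_def power_minus[of t])
    finally show ?thesis unfolding scaleR_eq_scaleC scaleC_scaleC by (rule arg_cong)
  qed
  then show ?thesis
    unfolding poisson_def laplace_moment_def
    using half_line.bochner_integral_bounded_linear[OF bounded_linear_scaleR_right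
        laplace_moment_integrable[OF f, of 1 n], of "(- 1) ^ n / fact n"] by simp
qed

section \<open>Injectivity\<close>

text \<open>The Taylor series about \<open>l\<close> represents the Laplace transform in the disc of radius \<open>l\<close>, so
  derivatives that all vanish at \<open>l\<close> vanish at \<open>l + c\<close>. Steps of \<open>1 / 2\<close>, starting from \<open>1\<close>, stay
  inside the discs and reach every positive natural number.\<close>

lemma laplace_moments_vanish_step:
  fixes f :: "real \<Rightarrow> 'a::complex_banach"
  assumes f: "f \<in> L1" and c: "0 \<le> c" "c < l"
    and 0: "\<And>n. laplace_moment f n (of_real l) = 0"
  shows "laplace_moment f n (of_real (l + c)) = 0"
proof -
  define v where "v n l t = (- complex_of_real t) ^ n * exp (- of_real l * complex_of_real t)" for n t and l :: real
  \<comment> \<open>The terms of the Taylor series of the weight \<open>v n\<close> about \<open>l\<close>, evaluated at \<open>l + c\<close>.\<close>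
  define w where "w j t = (of_real c ^ j / fact j) * v (n + j) l t" for j t
  have w: "w j t = v n l t * ((- of_real (c * t)) ^ j /\<^sub>R fact j)" for j t
  proof -
    have "- of_real (c * t) = of_real c * (- complex_of_real t)" by simp
    then have "(- of_real (c * t)) ^ j = of_real c ^ j * (- complex_of_real t) ^ j"
      by (simp only: power_mult_distrib)
    then show ?thesis
      by (simp only: w_def v_def power_add scaleR_conv_of_real of_real_inverse of_real_fact
          divide_inverse mult_ac)
  qed
  have "(\<lambda>j. w j t) sums (v n l t * exp (- of_real (c * t)))" for t
    unfolding w by (intro sums_mult exp_converges)
  moreover have "v n l t * exp (- of_real (c * t)) = v n (l + c) t" for t
  proof -
    have "exp (- of_real l * of_real t) * exp (- of_real (c * t)) = exp (- of_real (l + c) * complex_of_real t)"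
      unfolding exp_add[symmetric] by (simp add: algebra_simps)
    then show ?thesis unfolding v_def by (simp only: mult.assoc)
  qed
  ultimately have sm: "(\<Sum>j. w j t) = v n (l + c) t" for t
    using sums_unique by metis
  have "(\<lambda>j. cmod (w j t)) sums (t ^ n * exp (- (l - c) * t))" if t: "0 \<le> t" for t
  proof -
    have "(\<lambda>j. cmod (v n l t) * ((c * t) ^ j /\<^sub>R fact j)) sums (cmod (v n l t) * exp (c * t))"
      by (intro sums_mult exp_converges)
    moreover have "cmod (v n l t) * ((c * t) ^ j /\<^sub>R fact j) = cmod (w j t)" for j
      using t c by (simp add: w norm_mult norm_power norm_inverse power_mult_distrib)
    moreover have "cmod (v n l t) * exp (c * t) = t ^ n * (exp (- l * t) * exp (c * t))"
      using t by (simp add: v_def norm_mult norm_power)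
    moreover have "exp (- l * t) * exp (c * t) = exp (- (l - c) * t)"
      unfolding exp_add[symmetric] by (simp add: algebra_simps)
    ultimately show ?thesis by simp
  qed
  note cs = this
  have bf: "bochner_integrable half_line f" using f by (simp add: L1_iff)
  have vm: "v n l \<in> borel_measurable half_line" for n l
    unfolding v_def by (rule laplace_weight_measurable)
  have "(\<lambda>j. bochner_integral half_line (\<lambda>t. w j t *\<^sub>C f t)) sums
      bochner_integral half_line (\<lambda>t. (\<Sum>j. w j t) *\<^sub>C f t)"
  proof (rule half_line.bochner_integral_weight_series[OF _ _ _ bf])
    show "w j \<in> borel_measurable half_line" for j
      unfolding w_def by (intro borel_measurable_times borel_measurable_const vm)
    show "summable (\<lambda>j. cmod (w j t))" if "t \<in> space half_line" for t
      using sums_summable[OF cs] that by simp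
    show "(\<Sum>j. cmod (w j t)) \<le> fact n / (l - c) ^ n" if "t \<in> space half_line" for t
      using sums_unique[OF cs, of t] power_exp_le[of t "l - c" n] that c by simp
  qed
  moreover have "bochner_integral half_line (\<lambda>t. w j t *\<^sub>C f t) = 0" for j
  proof -
    have "w j t *\<^sub>C f t = (of_real c ^ j / fact j) *\<^sub>C (v (n + j) l t *\<^sub>C f t)" for t
      by (simp add: w_def scaleC_scaleC)
    moreover have "bochner_integrable half_line (\<lambda>t. v (n + j) l t *\<^sub>C f t)"
      unfolding v_def by (rule laplace_moment_integrable[OF f]) (use c in simp)
    ultimately have "bochner_integral half_line (\<lambda>t. w j t *\<^sub>C f t)
        = (of_real c ^ j / fact j) *\<^sub>C laplace_moment f (n + j) (of_real l)"
      using half_line.bochner_integral_bounded_linear[OF scaleC.bounded_linear_right]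
      by (simp add: laplace_moment_def v_def)
    then show ?thesis by (simp add: 0 scaleC.zero_right)
  qed
  ultimately have "bochner_integral half_line (\<lambda>t. v n (l + c) t *\<^sub>C f t) = 0"
    unfolding sm using sums_unique2[OF sums_zero] by simp
  then show ?thesis by (simp add: laplace_moment_def v_def)
qed

lemma laplace_vanishes_at_naturals:
  fixes f :: "real \<Rightarrow> 'a::complex_banach"
  assumes f: "f \<in> L1" and 0: "\<And>n. poisson f n = 0"
  shows "laplace f (of_nat (Suc k)) = 0"
proof -
  have *: "laplace_moment f n (of_real (1 + real k / 2)) = 0" for k n
  proof (induction k arbitrary: n)
    case 0
    then show ?case using assms(2)[of n] poisson_eq_laplace_moment[OF f, of n] by simp
  next
    case (Suc k)
    have "1 + real (Suc k) / 2 = (1 + real k / 2) + 1 / 2" by (simp add: field_simps)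
    moreover have "laplace_moment f n (of_real ((1 + real k / 2) + 1 / 2)) = 0"
      by (rule laplace_moments_vanish_step[OF f _ _ Suc.IH]) (simp_all add: add_pos_nonneg)
    ultimately show ?case by simp
  qed
  have "of_real (1 + real (2 * k) / 2) = (of_nat (Suc k) :: complex)" by simp
  then show ?thesis
    using *[of 0 "2 * k"] by (simp add: laplace_moment_def laplace_def)
qed

context complete_measure
begin

text \<open>On the level sets of a simple function \<open>s\<close> close to \<open>f\<close> the integral of \<open>s\<close> equals that of
  \<open>s - f\<close>, and there the norm of the integral of \<open>s\<close> is the integral of its norm. Hence the
  \<open>L\<^sup>1\<close> norm of \<open>s\<close> is at most the distance from \<open>f\<close> to \<open>s\<close>, and that of \<open>f\<close> at most twice this
  distance.\<close>

lemma AE_zero_if_set_integrals_zero: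
  fixes f :: "'a \<Rightarrow> 'b::banach"
  assumes f: "bochner_integrable M f"
    and 0: "\<And>A. A \<in> sets M \<Longrightarrow> bochner_integral M (\<lambda>x. indicator A x *\<^sub>R f x) = 0"
  shows "AE x in M. f x = 0"
proof -
  have ind: "bochner_integrable M (\<lambda>x. indicator A x *\<^sub>R g x)" if "bochner_integrable M g" "A \<in> sets M"
    for g :: "'a \<Rightarrow> 'b" and A
  proof (rule bochner_integrable_bound)
    show "strongly_measurable M (\<lambda>x. indicator A x *\<^sub>R g x)"
      by (intro strongly_measurable_scaleR strongly_measurable_borel bochner_integrableD(1) that
          borel_measurable_indicator)
    show "AE x in M. norm (indicator A x *\<^sub>R g x) \<le> norm (g x)"
      by (rule AE_I2) (auto simp: indicator_def)
  qed (rule bochner_integrableD(2)[OF that(1)])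
  have small: "(LINT x|M. norm (f x)) \<le> 2 * e" if e: "0 < e" for e
  proof -
    obtain s where s: "simple_bochner_integrable M s" "(LINT x|M. norm (f x - s x)) < e"
      using bochner_integrable_simple_approx[OF f e] by blast
    note ss = simple_bochner_integrable_imp_simple[OF s(1)]
    note bs = bochner_integrable_simple[OF s(1)]
    define D where "D = s ` space M"
    define A where "A y = s -` {y} \<inter> space M" for y
    have A: "A y \<in> sets M" for y
      unfolding A_def by (rule simple_functionD(2)[OF ss])
    have D: "finite D" unfolding D_def by (rule simple_functionD(1)[OF ss])
    have split: "(LINT x|M. norm (g x)) = (\<Sum>y\<in>D. LINT x|M. norm (indicator (A y) x *\<^sub>R g x))"
      if g: "bochner_integrable M g" for g :: "'a \<Rightarrow> 'b"
    proof -
      have "(LINT x|M. norm (g x)) = (LINT x|M. (\<Sum>y\<in>D. norm (indicator (A y) x *\<^sub>R g x)))"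
      proof (rule Bochner_Integration.integral_cong)
        fix x assume x: "x \<in> space M"
        have "(\<Sum>y\<in>D. norm (indicator (A y) x *\<^sub>R g x)) = (\<Sum>y\<in>D. if y = s x then norm (g x) else 0)"
          by (rule sum.cong) (use x in \<open>auto simp: A_def indicator_def\<close>)
        also have "\<dots> = norm (g x)" using D x by (simp add: D_def)
        finally show "norm (g x) = (\<Sum>y\<in>D. norm (indicator (A y) x *\<^sub>R g x))" ..
      qed simp
      then show ?thesis
        using Bochner_Integration.integral_sum[of D M "\<lambda>y x. norm (indicator (A y) x *\<^sub>R g x)"]
          bochner_integrableD(2)[OF ind[OF g A]] by simp
    qed
    have le: "(LINT x|M. norm (indicator (A y) x *\<^sub>R s x))
        \<le> (LINT x|M. norm (indicator (A y) x *\<^sub>R (f x - s x)))" for y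
    proof (cases "y = 0")
      case True
      then have "(LINT x|M. norm (indicator (A y) x *\<^sub>R s x)) = (LINT x|M. 0)"
        by (intro Bochner_Integration.integral_cong) (auto simp: A_def indicator_def)
      then show ?thesis by simp
    next
      case False
      have eq: "indicator (A y) x *\<^sub>R s x = indicator (A y) x *\<^sub>R y" for x
        by (simp add: A_def indicator_def)
      note i = ind[OF bs A, of y]
      have "integrable M (\<lambda>x. norm (indicator (A y) x *\<^sub>R y))"
        using bochner_integrableD(2)[OF i] unfolding eq .
      then have "integrable M (\<lambda>x. indicator (A y) x * norm y :: real)"
        by simp
      then have iA: "integrable M (indicator (A y) :: 'a \<Rightarrow> real)"
        using False by (simp add: integrable_mult_left_iff)
      then have iA': "bochner_integrable M (indicator (A y) :: 'a \<Rightarrow> real)"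
        using bochner_integral_eq_lebesgue(1) by blast
      have "(LINT x|M. norm (indicator (A y) x *\<^sub>R s x)) = (LINT x|M. indicator (A y) x) * norm y"
        unfolding eq by simp
      also have "\<dots> = norm ((LINT x|M. indicator (A y) x) *\<^sub>R y)"
        by (simp add: integral_nonneg_AE)
      also have "(LINT x|M. indicator (A y) x) *\<^sub>R y = bochner_integral M (\<lambda>x. indicator (A y) x *\<^sub>R s x)"
        unfolding eq
        using bochner_integral_bounded_linear[OF bounded_linear_scaleR_left iA', of y]
          bochner_integral_eq_lebesgue(2)[OF iA] by simp
      also have "norm \<dots> = norm (bochner_integral M (\<lambda>x. indicator (A y) x *\<^sub>R (f x - s x)))"
        unfolding scaleR_diff_right bochner_integral_diff[OF ind[OF f A] i] by (simp add: 0[OF A])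
      also have "\<dots> \<le> (LINT x|M. norm (indicator (A y) x *\<^sub>R (f x - s x)))"
        by (rule norm_bochner_integral_le[OF ind[OF bochner_integrable_diff[OF f bs] A]])
      finally show ?thesis .
    qed
    have "(LINT x|M. norm (s x)) \<le> (LINT x|M. norm (f x - s x))"
      unfolding split[OF bs] split[OF bochner_integrable_diff[OF f bs]] by (rule sum_mono) (rule le)
    moreover have "(LINT x|M. norm (f x)) \<le> (LINT x|M. norm (f x - s x) + norm (s x))"
    proof (rule integral_mono)
      fix x show "norm (f x) \<le> norm (f x - s x) + norm (s x)"
        using norm_triangle_ineq[of "f x - s x" "s x"] by simp
    qed (use bochner_integrableD(2)[OF f] bochner_integrableD(2)[OF bs] integrable_norm_diff[OF f bs] in auto)
    moreover have "\<dots> = (LINT x|M. norm (f x - s x)) + (LINT x|M. norm (s x))"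
      by (rule Bochner_Integration.integral_add[OF integrable_norm_diff[OF f bs] bochner_integrableD(2)[OF bs]])
    ultimately show ?thesis using s(2) by simp
  qed
  have "(LINT x|M. norm (f x)) \<le> 0"
  proof (rule field_le_epsilon)
    fix e :: real assume "0 < e"
    then show "(LINT x|M. norm (f x)) \<le> 0 + e" using small[of "e / 2"] by simp
  qed
  then have "(LINT x|M. norm (f x)) = 0"
    by (intro antisym) (simp_all add: integral_nonneg_AE)
  then show ?thesis
    using integral_nonneg_eq_0_iff_AE[OF bochner_integrableD(2)[OF f]] by simp
qed

end

text \<open>In the variable \<open>u = exp (- t)\<close> the indicator of \<open>t < b\<close> is a bounded pointwise limit of
  continuous functions on \<open>{0..1}\<close>, hence, by the Weierstrass theorem, of polynomials.\<close>

lemma indicator_limit_of_polynomials: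
  obtains q :: "nat \<Rightarrow> real \<Rightarrow> real" where
    "\<And>m. real_polynomial_function (q m)"
    "\<And>m u. 0 \<le> u \<Longrightarrow> u \<le> 1 \<Longrightarrow> \<bar>q m u\<bar> \<le> 2"
    "\<And>u. 0 \<le> u \<Longrightarrow> u \<le> 1 \<Longrightarrow> (\<lambda>m. q m u) \<longlonglongrightarrow> indicator {a<..} u"
proof -
  define f :: "nat \<Rightarrow> real \<Rightarrow> real" where "f m u = min 1 (max 0 (real m * (u - a)))" for m u
  have fc: "continuous_on {0..1} (f m)" for m
    unfolding f_def by (intro continuous_intros)
  have "\<exists>q. real_polynomial_function q \<and> (\<forall>u\<in>{0..1}. \<bar>f m u - q u\<bar> < inverse (real (Suc m)))" for m
  proof -
    have "0 < inverse (real (Suc m))" by simp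
    from Stone_Weierstrass_real_polynomial_function[OF compact_Icc fc this] obtain q
      where "real_polynomial_function q" "\<And>u. u \<in> {0..1} \<Longrightarrow> \<bar>f m u - q u\<bar> < inverse (real (Suc m))"
      by metis
    then show ?thesis by (intro exI[of _ q] conjI ballI)
  qed
  from choice[OF allI[OF this]] obtain q where q:
      "\<forall>m. real_polynomial_function (q m) \<and> (\<forall>u\<in>{0..1}. \<bar>f m u - q m u\<bar> < inverse (real (Suc m)))"
    by (rule exE)
  then have qp: "real_polynomial_function (q m)" for m by blast
  have qf: "\<bar>f m u - q m u\<bar> < inverse (real (Suc m))" if "0 \<le> u" "u \<le> 1" for m u
    using q that by (meson atLeastAtMost_iff)
  show thesis
  proof
    show "real_polynomial_function (q m)" for m by (rule qp)
    fix u :: real assume u: "0 \<le> u" "u \<le> 1"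
    show "\<bar>q m u\<bar> \<le> 2" for m
    proof -
      have "inverse (real (Suc m)) \<le> 1" by (simp add: inverse_le_1_iff)
      moreover have "0 \<le> f m u" "f m u \<le> 1" by (auto simp: f_def)
      ultimately show ?thesis using qf[OF u, of m] by linarith
    qed
    have "\<forall>\<^sub>F m in sequentially. f m u = indicator {a<..} u"
    proof (cases "a < u")
      case True
      obtain N :: nat where N: "1 / (u - a) < real N" using reals_Archimedean2 by blast
      have "f m u = 1" if "N \<le> m" for m
      proof -
        have "1 / (u - a) \<le> real m" using N that by linarith
        then have "1 \<le> real m * (u - a)" using True by (simp add: divide_le_eq)
        then show ?thesis by (simp add: f_def)
      qed
      then show ?thesis using True by (auto simp: eventually_sequentially)
    next
      case False
      then have "f m u = 0" for m by (simp add: f_def mult_nonneg_nonpos)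
      then show ?thesis using False by simp
    qed
    then have "\<forall>\<^sub>F m in sequentially. norm (q m u - indicator {a<..} u) \<le> inverse (real (Suc m))"
    proof eventually_elim
      case (elim m)
      show ?case
        using qf[OF u, of m] unfolding elim real_norm_def abs_minus_commute[of "q m u"] by simp
    qed
    then have "(\<lambda>m. q m u - indicator {a<..} u) \<longlonglongrightarrow> 0"
      by (rule Lim_null_comparison[OF _ LIMSEQ_inverse_real_of_nat])
    then show "(\<lambda>m. q m u) \<longlonglongrightarrow> indicator {a<..} u" by (rule LIM_zero_cancel)
  qed
qed

lemma indicator_measurable_half_line:
  assumes "B \<in> sets borel"
  shows "(indicator B :: real \<Rightarrow> real) \<in> borel_measurable half_line"
proof (rule measurable_restrict_space1)
  show "(indicator B :: real \<Rightarrow> real) \<in> borel_measurable lebesgue"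
    using assms by (intro borel_measurable_indicator) auto
qed

text \<open>The sets over which the integral vanishes form a Dynkin system, by dominated convergence, and
  the initial intervals are stable under intersection and generate the Borel sets. A Lebesgue set
  differs from a Borel set by a null set.\<close>

lemma half_line_set_integrals_zero:
  fixes f :: "real \<Rightarrow> 'a::banach"
  assumes f: "bochner_integrable half_line f"
    and 0: "\<And>b. bochner_integral half_line (\<lambda>t. indicator {..<b} t *\<^sub>R f t) = 0"
    and A: "A \<in> sets half_line"
  shows "bochner_integral half_line (\<lambda>t. indicator A t *\<^sub>R f t) = 0"
proof -
  let ?I = "\<lambda>B. bochner_integral half_line (\<lambda>t. indicator B t *\<^sub>R f t)"
  have sm: "strongly_measurable half_line (\<lambda>t. indicator B t *\<^sub>R f t)" if "B \<in> sets borel" for B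
    by (intro strongly_measurable_scaleR strongly_measurable_borel half_line.bochner_integrableD(1)[OF f]
        indicator_measurable_half_line that)
  have le: "AE t in half_line. norm (indicator B t *\<^sub>R f t) \<le> norm (f t)" for B
    by (rule AE_I2) (auto simp: indicator_def)
  note nf = half_line.bochner_integrableD(2)[OF f]
  note lim = half_line.bochner_integral_dominated_convergence(2)[OF sm sm nf le]
  have bi: "bochner_integrable half_line (\<lambda>t. indicator B t *\<^sub>R f t)" if "B \<in> sets borel" for B
    by (rule half_line.bochner_integrable_bound[OF sm[OF that] nf le])
  have UNIV0: "?I UNIV = 0"
  proof -
    have "(\<lambda>i. ?I {..<real i}) \<longlonglongrightarrow> ?I UNIV"
    proof (rule lim)
      show "AE t in half_line. (\<lambda>i. indicator {..<real i} t *\<^sub>R f t) \<longlonglongrightarrow> indicator UNIV t *\<^sub>R f t"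
      proof (rule AE_I2)
        fix t :: real
        obtain N :: nat where "t < real N" using reals_Archimedean2 by blast
        then have "\<forall>\<^sub>F i in sequentially. indicator {..<real i} t *\<^sub>R f t = indicator UNIV t *\<^sub>R f t"
          unfolding eventually_sequentially by (intro exI[of _ N]) auto
        then show "(\<lambda>i. indicator {..<real i} t *\<^sub>R f t) \<longlonglongrightarrow> indicator UNIV t *\<^sub>R f t"
          by (rule tendsto_eventually)
      qed
    qed auto
    then show ?thesis using 0 by (simp add: LIMSEQ_const_iff)
  qed
  have borel0: "?I B = 0" if "B \<in> sets borel" for B
  proof -
    have sb: "sets borel = sigma_sets UNIV (range lessThan :: real set set)"
      by (subst borel_Iio) simp
    have "Int_stable (range lessThan :: real set set)"
    proof (rule Int_stableI_image)
      fix a b :: real show "\<exists>k\<in>UNIV. {..<a} \<inter> {..<b} = {..<k}"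
        by (rule bexI[of _ "min a b"]) auto
    qed
    moreover have "range lessThan \<subseteq> Pow (UNIV :: real set)" by simp
    moreover from that have "B \<in> sigma_sets UNIV (range lessThan)" unfolding sb .
    ultimately show ?thesis
    proof (induction rule: sigma_sets_induct_disjoint[consumes 3])
      case (basic B)
      then show ?case using 0 by auto
    next
      case empty
      then show ?case using 0[of 0] bi[of "{}"] half_line.norm_bochner_integral_le[OF bi[of "{}"]] by simp
    next
      case (compl B)
      then have B: "B \<in> sets borel" using sb by simp
      have "(\<lambda>t. indicator (UNIV - B) t *\<^sub>R f t) = (\<lambda>t. indicator UNIV t *\<^sub>R f t - indicator B t *\<^sub>R f t)"
        by (auto simp: indicator_def)
      then show ?case
        using half_line.bochner_integral_diff[OF bi bi, of UNIV B] B UNIV0 compl by simp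
    next
      case (union B)
      then have B: "B i \<in> sets borel" for i using sb by auto
      have "?I (\<Union>i<n. B i) = (\<Sum>i<n. ?I (B i))" for n
      proof -
        have "indicator (\<Union>i<n. B i) t = (\<Sum>i<n. indicator (B i) t :: real)" for t
          by (rule indicator_UN_disjoint) (use union(1) in \<open>auto simp: disjoint_family_on_def\<close>)
        then have "(\<lambda>t. indicator (\<Union>i<n. B i) t *\<^sub>R f t) = (\<lambda>t. \<Sum>i<n. indicator (B i) t *\<^sub>R f t)"
          by (simp only: scaleR_sum_left)
        then show ?thesis
          using half_line.bochner_integral_sum[of "{..<n}" "\<lambda>i t. indicator (B i) t *\<^sub>R f t"] bi[OF B]
          by simp
      qed
      then have z: "?I (\<Union>i<n. B i) = 0" for n using union by simp
      have "(\<lambda>n. ?I (\<Union>i<n. B i)) \<longlonglongrightarrow> ?I (\<Union>i. B i)"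
      proof (rule lim)
        show "AE t in half_line. (\<lambda>n. indicator (\<Union>i<n. B i) t *\<^sub>R f t) \<longlonglongrightarrow> indicator (\<Union>i. B i) t *\<^sub>R f t"
          by (rule AE_I2, rule tendsto_scaleR[OF _ tendsto_const], rule LIMSEQ_indicator_UN)
      qed (use B in auto)
      then show ?case using z by (simp add: LIMSEQ_const_iff)
    qed
  qed
  have A': "A \<in> sets lebesgue" using A by (simp add: sets_restrict_space_iff)
  have "AE t in lebesgue. t \<in> main_part lborel A \<longleftrightarrow> t \<in> A"
    using AE_in_main_part[OF A'] by (rule AE_completion)
  then have "AE t in lebesgue. t \<in> {0..} \<longrightarrow> (t \<in> main_part lborel A \<longleftrightarrow> t \<in> A)"
    by eventually_elim simp
  then have "AE t in half_line. t \<in> main_part lborel A \<longleftrightarrow> t \<in> A"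
    by (simp add: AE_restrict_space_iff)
  then have ae: "AE t in half_line. indicator A t *\<^sub>R f t = indicator (main_part lborel A) t *\<^sub>R f t"
    by eventually_elim (simp add: indicator_def)
  have "main_part lborel A \<in> sets borel"
    using main_part_sets[OF A'] by simp
  from half_line.bochner_integral_cong[OF ae] borel0[OF this] show ?thesis by (rule trans)
qed

lemma poisson_eq_0_imp_AE_0:
  fixes f :: "real \<Rightarrow> 'a::complex_banach"
  assumes f: "f \<in> L1" and 0: "\<And>n. poisson f n = 0"
  shows "AE t in half_line. f t = 0"
proof -
  have bf: "bochner_integrable half_line f" using f by (simp add: L1_iff)
  \<comment> \<open>The factor \<open>exp (- t)\<close> is split off because the Laplace transform is known to vanish at
    \<open>k + 1\<close> only; in terms of \<open>g\<close> all powers of \<open>u = exp (- t)\<close> become available, the constants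
    included.\<close>
  define g where "g t = complex_of_real (exp (- t)) *\<^sub>C f t" for t
  have g: "bochner_integrable half_line g"
    unfolding g_def
    by (rule half_line.bochner_integrable_scaleC[where C = 1, OF _ _ bf])
       (auto intro!: AE_half_lineI half_line_measurable_continuous continuous_intros)
  have pow: "bochner_integral half_line (\<lambda>t. complex_of_real (exp (- t) ^ k) *\<^sub>C g t) = 0" for k
  proof -
    have "complex_of_real (exp (- t) ^ k) *\<^sub>C g t = exp (- of_nat (Suc k) * complex_of_real t) *\<^sub>C f t" for t
    proof -
      have "complex_of_real (exp (- t) ^ k) * complex_of_real (exp (- t)) = of_real (exp (- real (Suc k) * t))"
        unfolding of_real_mult[symmetric] exp_of_nat_mult[symmetric] exp_add[symmetric]
        by (simp add: algebra_simps)
      also have "\<dots> = exp (- of_nat (Suc k) * complex_of_real t)"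
        unfolding exp_of_real[symmetric] by simp
      finally show ?thesis unfolding g_def scaleC_scaleC by (rule arg_cong)
    qed
    then show ?thesis
      using laplace_vanishes_at_naturals[OF f 0, of k] by (simp add: laplace_def)
  qed
  have m: "(\<lambda>t. complex_of_real (q (exp (- t)))) \<in> borel_measurable half_line"
    if "continuous_on UNIV q" for q :: "real \<Rightarrow> real"
  proof -
    have "continuous_on {0..} (\<lambda>t. q (exp (- t)))"
      by (rule continuous_on_compose2[OF that]) (auto intro!: continuous_intros)
    then show ?thesis
      by (intro half_line_measurable_continuous continuous_on_of_real)
  qed
  have poly: "bochner_integral half_line (\<lambda>t. complex_of_real (q (exp (- t))) *\<^sub>C g t) = 0"
    if "real_polynomial_function q" for q
  proof -
    from real_polynomial_function_imp_sum[OF that] obtain a n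
      where q: "q = (\<lambda>x. \<Sum>i\<le>n. a i * x ^ i)" by (elim exE)
    have i: "bochner_integrable half_line (\<lambda>t. complex_of_real (exp (- t) ^ k) *\<^sub>C g t)" for k
    proof (rule half_line.bochner_integrable_scaleC[where C = 1, OF _ _ g])
      show "(\<lambda>t. complex_of_real (exp (- t) ^ k)) \<in> borel_measurable half_line"
        by (rule m[of "\<lambda>x. x ^ k"]) (rule continuous_on_power[OF continuous_on_id])
      show "AE t in half_line. cmod (complex_of_real (exp (- t) ^ k)) \<le> 1"
      proof (rule AE_half_lineI)
        fix t :: real assume "0 \<le> t"
        then have "exp (- t) ^ k \<le> 1" by (intro power_le_one) simp_all
        moreover have "0 \<le> exp (- t) ^ k" by (intro zero_le_power) simp
        ultimately show "cmod (complex_of_real (exp (- t) ^ k)) \<le> 1"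
          unfolding norm_of_real by linarith
      qed
    qed
    note i' = half_line.bochner_integrable_bounded_linear[OF scaleC.bounded_linear_right i]
    have A: "complex_of_real (q (exp (- t))) *\<^sub>C g t
        = (\<Sum>k\<le>n. of_real (a k) *\<^sub>C complex_of_real (exp (- t) ^ k) *\<^sub>C g t)" for t
      by (simp only: q of_real_sum of_real_mult scaleC_scaleC scaleC.sum_left)
    have B: "bochner_integral half_line (\<lambda>t. \<Sum>k\<le>n. of_real (a k) *\<^sub>C complex_of_real (exp (- t) ^ k) *\<^sub>C g t)
        = (\<Sum>k\<le>n. bochner_integral half_line (\<lambda>t. of_real (a k) *\<^sub>C complex_of_real (exp (- t) ^ k) *\<^sub>C g t))"
      by (rule half_line.bochner_integral_sum[THEN conjunct2]) (rule i')
    have C: "bochner_integral half_line (\<lambda>t. of_real (a k) *\<^sub>C complex_of_real (exp (- t) ^ k) *\<^sub>C g t) = 0" for k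
      by (rule trans[OF half_line.bochner_integral_bounded_linear[OF scaleC.bounded_linear_right i]])
         (simp only: pow scaleC.zero_right)
    show ?thesis unfolding A B C by simp
  qed
  have "bochner_integral half_line (\<lambda>t. indicator {..<b} t *\<^sub>R g t) = 0" for b
  proof -
    obtain q :: "nat \<Rightarrow> real \<Rightarrow> real" where q: "\<And>m. real_polynomial_function (q m)"
        "\<And>m u. 0 \<le> u \<Longrightarrow> u \<le> 1 \<Longrightarrow> \<bar>q m u\<bar> \<le> 2"
        "\<And>u. 0 \<le> u \<Longrightarrow> u \<le> 1 \<Longrightarrow> (\<lambda>m. q m u) \<longlonglongrightarrow> indicator {exp (- b)<..} u"
      by (rule indicator_limit_of_polynomials[of "exp (- b)"]) blast
    have qc: "continuous_on UNIV (q i)" for i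
      by (rule continuous_on_polymonial_function[OF real_polynomial_function_eq[THEN iffD1, OF q(1)]])
    have "(\<lambda>i. bochner_integral half_line (\<lambda>t. complex_of_real (q i (exp (- t))) *\<^sub>C g t)) \<longlonglongrightarrow>
        bochner_integral half_line (\<lambda>t. indicator {..<b} t *\<^sub>R g t)"
    proof (rule half_line.bochner_integral_dominated_convergence(2)[where w = "\<lambda>t. 2 * norm (g t)"])
      show "strongly_measurable half_line (\<lambda>t. complex_of_real (q i (exp (- t))) *\<^sub>C g t)" for i
        by (intro strongly_measurable_scaleC strongly_measurable_borel m qc half_line.bochner_integrableD(1)[OF g])
      show "strongly_measurable half_line (\<lambda>t. indicator {..<b} t *\<^sub>R g t)"
        by (intro strongly_measurable_scaleR strongly_measurable_borel half_line.bochner_integrableD(1)[OF g]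
            indicator_measurable_half_line) simp
      show "AE t in half_line. norm (complex_of_real (q i (exp (- t))) *\<^sub>C g t) \<le> 2 * norm (g t)" for i
        by (rule AE_half_lineI) (simp add: norm_scaleC mult_right_mono q(2))
      show "AE t in half_line. (\<lambda>i. complex_of_real (q i (exp (- t))) *\<^sub>C g t) \<longlonglongrightarrow> indicator {..<b} t *\<^sub>R g t"
      proof (rule AE_half_lineI)
        fix t :: real assume "0 \<le> t"
        then have "(\<lambda>i. q i (exp (- t))) \<longlonglongrightarrow> indicator {exp (- b)<..} (exp (- t))"
          by (intro q(3)) auto
        also have "indicator {exp (- b)<..} (exp (- t)) = (indicator {..<b} t :: real)"
          by (simp add: indicator_def)
        finally show "(\<lambda>i. complex_of_real (q i (exp (- t))) *\<^sub>C g t) \<longlonglongrightarrow> indicator {..<b} t *\<^sub>R g t"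
          unfolding scaleR_eq_scaleC by (intro scaleC.tendsto tendsto_of_real tendsto_const)
      qed
    qed (use half_line.bochner_integrableD(2)[OF g] in simp)
    then show ?thesis using poly[OF q(1)] by (simp add: LIMSEQ_const_iff)
  qed
  from half_line_set_integrals_zero[OF g this] have "AE t in half_line. g t = 0"
    by (rule half_line.AE_zero_if_set_integrals_zero[OF g])
  then show ?thesis
  proof eventually_elim
    case (elim t)
    then have "norm (g t) = 0" by simp
    then show ?case by (simp add: g_def norm_scaleC)
  qed
qed

section \<open>Convolution\<close>

text \<open>Fubini's theorem is applied to Borel functions on the whole line that vanish on the negative
  half line; every integrable function on the half line has such a version.\<close>

lemma borel_version:
  fixes f :: "real \<Rightarrow> complex"
  assumes f: "f \<in> borel_measurable half_line"
  obtains g where "g \<in> borel_measurable borel" "\<And>t. t < 0 \<Longrightarrow> g t = 0"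
    "AE t in lborel. 0 \<le> t \<longrightarrow> f t = g t"
proof -
  define h where "h t = (if t \<in> {0..} then f t else 0)" for t
  have h: "h \<in> borel_measurable lebesgue"
    unfolding h_def by (rule borel_measurable_if_I[OF f]) simp
  have "(\<lambda>t. Re (h t)) \<in> borel_measurable lebesgue" "(\<lambda>t. Im (h t)) \<in> borel_measurable lebesgue"
    using h by auto
  from this[THEN completion_ex_borel_measurable_real] obtain u v
    where u: "u \<in> borel_measurable borel" "AE t in lborel. Re (h t) = u t"
      and v: "v \<in> borel_measurable borel" "AE t in lborel. Im (h t) = v t"
    by auto
  define g where "g t = indicator {0..} t * Complex (u t) (v t)" for t
  have [measurable]: "u \<in> borel_measurable borel" "v \<in> borel_measurable borel" by fact+
  have "(\<lambda>t. Complex (u t) (v t)) = (\<lambda>t. complex_of_real (u t) + \<i> * complex_of_real (v t))"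
    by (simp add: fun_eq_iff complex_eq_iff)
  then have "(\<lambda>t. Complex (u t) (v t)) \<in> borel_measurable borel" by simp
  then have "g \<in> borel_measurable borel"
    unfolding g_def by (intro borel_measurable_times borel_measurable_indicator) auto
  moreover have "AE t in lborel. 0 \<le> t \<longrightarrow> f t = g t"
    using u(2) v(2) by eventually_elim (auto simp: g_def h_def complex_eq_iff)
  ultimately show thesis by (intro that[of g]) (auto simp: g_def)
qed

lemma AE_half_line_iff: "(AE t in half_line. P t) \<longleftrightarrow> (AE t in lborel. 0 \<le> t \<longrightarrow> P t)"
  by (simp add: AE_restrict_space_iff AE_completion_iff)

lemma half_line_integral_eq_lborel:
  fixes g :: "real \<Rightarrow> 'b::{banach, second_countable_topology}"
  assumes g: "g \<in> borel_measurable borel" and 0: "\<And>t. t < 0 \<Longrightarrow> g t = 0"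
  shows "integrable half_line g \<longleftrightarrow> integrable lborel g"
    and "integral\<^sup>L half_line g = integral\<^sup>L lborel g"
proof -
  have eq: "(\<lambda>t. indicat_real {0..} t *\<^sub>R g t) = g"
    using 0 by (auto simp: fun_eq_iff indicator_def not_le)
  show "integrable half_line g \<longleftrightarrow> integrable lborel g"
    using g by (simp add: integrable_restrict_space eq integrable_completion)
  show "integral\<^sup>L half_line g = integral\<^sup>L lborel g"
    using g by (simp add: integral_restrict_space eq integral_completion)
qed

lemma AE_reflect:
  assumes "AE x in lborel. P (x::real)"
  shows "AE s in lborel. P (t - s)"
proof -
  obtain N where N: "{x \<in> space lborel. \<not> P x} \<subseteq> N" "emeasure lborel N = 0" "N \<in> sets lborel"
    using assms by (rule AE_E)
  then have "N \<in> null_sets lborel" by (simp add: null_sets_def)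
  then have "AE x in lborel. x \<notin> N" by (rule AE_not_in)
  then have "AE s in lborel. t + (- 1) * s \<notin> N"
    using N(3) by (intro AE_borel_affine[where P = "\<lambda>x. x \<notin> N"]) auto
  then show ?thesis
    by eventually_elim (use N(1) in auto)
qed

text \<open>Integrated first over \<open>t\<close>, the norm of the kernel gives the norm of \<open>\<alpha>\<close> times that of \<open>\<gamma> s\<close>, by
  translation invariance.\<close>

lemma scalar_convolution_Borel:
  fixes \<alpha> \<gamma> :: "real \<Rightarrow> complex"
  assumes \<alpha>: "integrable lborel \<alpha>" and \<gamma>: "integrable lborel \<gamma>"
  shows "integrable (lborel \<Otimes>\<^sub>M lborel) (\<lambda>(t, s). \<alpha> (t - s) * \<gamma> s)"
proof -
  have [measurable]: "\<alpha> \<in> borel_measurable borel" "\<gamma> \<in> borel_measurable borel"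
    using \<alpha> \<gamma> by auto
  have sh: "integrable lborel (\<lambda>t. \<alpha> (t - s))" for s
    using lborel_integrable_real_affine[OF \<alpha>, of 1 "- s"] by simp
  have "integrable lborel (\<lambda>t. cmod (\<alpha> t))" using \<alpha> by simp
  have nsh: "(LINT t|lborel. cmod (\<alpha> (t - s))) = (LINT t|lborel. cmod (\<alpha> t))" for s
    using lborel_integral_real_affine[of 1 "\<lambda>t. cmod (\<alpha> t)" "- s"] by simp
  have "integrable (lborel \<Otimes>\<^sub>M lborel) (\<lambda>(s, t). \<alpha> (t - s) * \<gamma> s)"
  proof (rule lborel_pair.Fubini_integrable)
    show "(\<lambda>(s, t). \<alpha> (t - s) * \<gamma> s) \<in> borel_measurable (lborel \<Otimes>\<^sub>M lborel)"
      by measurable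
    have "(\<lambda>s. LINT t|lborel. norm (case (s, t) of (s, t) \<Rightarrow> \<alpha> (t - s) * \<gamma> s))
        = (\<lambda>s. (LINT t|lborel. cmod (\<alpha> t)) * cmod (\<gamma> s))"
      by (simp add: norm_mult nsh)
    then show "integrable lborel (\<lambda>s. LINT t|lborel. norm (case (s, t) of (s, t) \<Rightarrow> \<alpha> (t - s) * \<gamma> s))"
      using \<gamma> by simp
    show "AE s in lborel. integrable lborel (\<lambda>t. case (s, t) of (s, t) \<Rightarrow> \<alpha> (t - s) * \<gamma> s)"
      using sh by simp
  qed
  from lborel_pair.integrable_product_swap[OF this] show ?thesis
    by (simp add: case_prod_unfold)
qed

text \<open>The scalar convolution theorem, for kernels \<open>w\<close> with a finite addition theorem
  \<open>w (t + s) = (\<Sum>j\<le>n. u j t * v j s)\<close>. The constant kernel gives Young's inequality, the Poisson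
  weights give the discrete convolution.\<close>

lemma scalar_convolution:
  fixes a c :: "real \<Rightarrow> complex"
  assumes a: "integrable half_line a" and c: "integrable half_line c"
  defines "conv \<equiv> \<lambda>t. LINT s|lebesgue_on {0..t}. a (t - s) * c s"
  shows "AE t in half_line. integrable (lebesgue_on {0..t}) (\<lambda>s. a (t - s) * c s)"
    and "integrable half_line conv"
    and "\<And>w u v (n::nat) B. continuous_on UNIV w \<Longrightarrow> (\<And>t. 0 \<le> t \<Longrightarrow> cmod (w t) \<le> B) \<Longrightarrow>
      (\<And>j. continuous_on UNIV (u j)) \<Longrightarrow> (\<And>j t. 0 \<le> t \<Longrightarrow> cmod (u j t) \<le> B) \<Longrightarrow>
      (\<And>j. continuous_on UNIV (v j)) \<Longrightarrow> (\<And>j t. 0 \<le> t \<Longrightarrow> cmod (v j t) \<le> B) \<Longrightarrow>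
      (\<And>t s. w (t + s) = (\<Sum>j\<le>n. u j t * v j s)) \<Longrightarrow>
      (LINT t|half_line. w t * conv t) =
        (\<Sum>j\<le>n. (LINT t|half_line. u j t * a t) * (LINT t|half_line. v j t * c t))"
proof -
  have am: "a \<in> borel_measurable half_line" and cm: "c \<in> borel_measurable half_line"
    using a c by auto
  obtain \<alpha> where \<alpha>: "\<alpha> \<in> borel_measurable borel" "\<And>t. t < 0 \<Longrightarrow> \<alpha> t = 0"
      "AE t in lborel. 0 \<le> t \<longrightarrow> a t = \<alpha> t"
    using borel_version[OF am] by metis
  obtain \<gamma> where \<gamma>: "\<gamma> \<in> borel_measurable borel" "\<And>t. t < 0 \<Longrightarrow> \<gamma> t = 0"
      "AE t in lborel. 0 \<le> t \<longrightarrow> c t = \<gamma> t"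
    using borel_version[OF cm] by metis
  have [measurable]: "\<alpha> \<in> borel_measurable borel" "\<gamma> \<in> borel_measurable borel" by fact+
  have hm: "f \<in> borel_measurable half_line" if "f \<in> borel_measurable borel" for f :: "real \<Rightarrow> complex"
    using that by (intro measurable_restrict_space1 measurable_completion) simp
  have "integrable half_line \<alpha>" "integrable half_line \<gamma>"
    using a c integrable_cong_AE[OF am hm[OF \<alpha>(1)]] integrable_cong_AE[OF cm hm[OF \<gamma>(1)]] \<alpha>(3) \<gamma>(3)
    unfolding AE_half_line_iff by auto
  then have il: "integrable lborel \<alpha>" "integrable lborel \<gamma>"
    using half_line_integral_eq_lborel(1)[OF \<alpha>(1,2)] half_line_integral_eq_lborel(1)[OF \<gamma>(1,2)] by auto
  define K where "K t s = \<alpha> (t - s) * \<gamma> s" for t s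
  have [measurable]: "(\<lambda>x. K (fst x) (snd x)) \<in> borel_measurable (lborel \<Otimes>\<^sub>M lborel)"
    unfolding K_def by measurable
  have K: "integrable (lborel \<Otimes>\<^sub>M lborel) (\<lambda>(t, s). K t s)"
    unfolding K_def by (rule scalar_convolution_Borel[OF il])
  have K0: "K t s = 0" if "t < 0" for t s
    using that \<alpha>(2)[of "t - s"] \<gamma>(2)[of s] by (cases "s < 0") (auto simp: K_def)
  define k where "k = (\<lambda>t. LINT s|lborel. K t s)"
  have k0: "k t = 0" if "t < 0" for t
  proof -
    have "K t = (\<lambda>s. 0)" using K0[OF that] by (simp add: fun_eq_iff)
    then show ?thesis by (simp add: k_def)
  qed
  have ki: "integrable lborel k"
    unfolding k_def using lborel_pair.integrable_fst'[OF K] by simp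
  then have km: "k \<in> borel_measurable borel" by auto
  have loc: "(integrable (lebesgue_on {0..t}) (\<lambda>s. a (t - s) * c s) \<longleftrightarrow> integrable lborel (K t)) \<and> conv t = k t"
    for t
  proof -
    have ae: "AE s in lebesgue. K t s = indicator {0..t} s *\<^sub>R (a (t - s) * c s)"
      unfolding AE_completion_iff using AE_reflect[OF \<alpha>(3), of t] \<gamma>(3)
      by eventually_elim (use \<alpha>(2) \<gamma>(2) in \<open>auto simp: K_def indicator_def\<close>)
    have Kb: "K t \<in> borel_measurable borel" unfolding K_def by measurable
    then have Km: "K t \<in> borel_measurable lebesgue" by (intro measurable_completion) simp
    have m: "(\<lambda>s. indicator {0..t} s *\<^sub>R (a (t - s) * c s)) \<in> borel_measurable lebesgue"
      by (rule completion.borel_measurable_AE_eq[OF Km ae])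
    show ?thesis
      using integrable_cong_AE[OF Km m ae] integral_cong_AE[OF Km m ae] Kb
      by (simp add: conv_def k_def integrable_restrict_space integral_restrict_space
          integrable_completion integral_completion)
  qed
  show "AE t in half_line. integrable (lebesgue_on {0..t}) (\<lambda>s. a (t - s) * c s)"
  proof -
    have "AE t in lborel. integrable lborel (K t)"
      using lborel_pair.AE_integrable_fst'[OF K] by simp
    then show ?thesis
      unfolding AE_half_line_iff by eventually_elim (use loc in blast)
  qed
  have ck: "conv = k" using loc by auto
  show "integrable half_line conv"
    unfolding ck using half_line_integral_eq_lborel(1)[OF km k0] ki by simp
  fix w :: "real \<Rightarrow> complex" and u v :: "nat \<Rightarrow> real \<Rightarrow> complex" and n B
  assume w: "continuous_on UNIV w" "\<And>t. 0 \<le> t \<Longrightarrow> cmod (w t) \<le> B"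
    and u: "\<And>j. continuous_on UNIV (u j)" "\<And>j t. 0 \<le> t \<Longrightarrow> cmod (u j t) \<le> B"
    and v: "\<And>j. continuous_on UNIV (v j)" "\<And>j t. 0 \<le> t \<Longrightarrow> cmod (v j t) \<le> B"
    and add: "\<And>t s. w (t + s) = (\<Sum>j\<le>n. u j t * v j s)"
  have cb: "f \<in> borel_measurable borel" if "continuous_on UNIV f" for f :: "real \<Rightarrow> complex"
    using that by (rule borel_measurable_continuous_onI)
  note [measurable] = cb[OF w(1)] cb[OF u(1)] cb[OF v(1)]
  have wint: "integrable lborel (\<lambda>t. r t * f t)"
    if "integrable lborel f" "\<And>t. t < 0 \<Longrightarrow> f t = 0" "continuous_on UNIV r" "\<And>t. 0 \<le> t \<Longrightarrow> cmod (r t) \<le> B"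
    for r f :: "real \<Rightarrow> complex"
  proof (rule Bochner_Integration.integrable_bound)
    show "integrable lborel (\<lambda>t. B * cmod (f t))" using that(1) by simp
    show "(\<lambda>t. r t * f t) \<in> borel_measurable lborel"
      using that(1) cb[OF that(3)] by auto
    show "AE t in lborel. norm (r t * f t) \<le> norm (B * cmod (f t))"
    proof (rule AE_I2)
      fix t show "norm (r t * f t) \<le> norm (B * cmod (f t))"
      proof (cases "t < 0")
        case False
        then have "cmod (r t) * cmod (f t) \<le> B * cmod (f t)"
          by (intro mult_right_mono that(4)) auto
        then show ?thesis by (simp add: norm_mult abs_if split: if_splits)
      qed (simp add: that(2))
    qed
  qed
  have half: "(LINT t|half_line. r t * f t) = (LINT t|lborel. r t * g t)"
    if "f \<in> borel_measurable half_line" "g \<in> borel_measurable borel" "\<And>t. t < 0 \<Longrightarrow> g t = 0"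
      "AE t in lborel. 0 \<le> t \<longrightarrow> f t = g t" "continuous_on UNIV r" for f g r :: "real \<Rightarrow> complex"
  proof -
    have "(LINT t|half_line. r t * f t) = (LINT t|half_line. r t * g t)"
    proof (rule integral_cong_AE)
      show "AE t in half_line. r t * f t = r t * g t"
        unfolding AE_half_line_iff using that(4) by eventually_elim simp
    qed (use that(1) hm[OF that(2)] hm[OF cb[OF that(5)]] in auto)
    also have "\<dots> = (LINT t|lborel. r t * g t)"
      by (rule half_line_integral_eq_lborel(2)) (use that(2,3) cb[OF that(5)] in auto)
    finally show ?thesis .
  qed
  have wK: "integrable (lborel \<Otimes>\<^sub>M lborel) (\<lambda>(t, s). w t * K t s)"
  proof (rule Bochner_Integration.integrable_bound)
    show "integrable (lborel \<Otimes>\<^sub>M lborel) (\<lambda>x. B * norm (case x of (t, s) \<Rightarrow> K t s))"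
      using integrable_norm[OF K] by simp
    show "(\<lambda>(t, s). w t * K t s) \<in> borel_measurable (lborel \<Otimes>\<^sub>M lborel)"
      unfolding K_def by measurable
    show "AE x in lborel \<Otimes>\<^sub>M lborel. norm (case x of (t, s) \<Rightarrow> w t * K t s)
        \<le> norm (B * norm (case x of (t, s) \<Rightarrow> K t s))"
    proof (rule AE_I2)
      fix x :: "real \<times> real"
      have "cmod (w t * K t s) \<le> \<bar>B\<bar> * cmod (K t s)" for t s
      proof (cases "t < 0")
        case False
        then have "cmod (w t) \<le> \<bar>B\<bar>" using w(2)[of t] by simp
        from mult_right_mono[OF this, of "cmod (K t s)"] show ?thesis by (simp add: norm_mult)
      qed (simp add: K0)
      then show "norm (case x of (t, s) \<Rightarrow> w t * K t s) \<le> norm (B * norm (case x of (t, s) \<Rightarrow> K t s))"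
        by (cases x) (simp add: abs_mult)
    qed
  qed
  have "(LINT t|half_line. w t * conv t) = (LINT t|lborel. w t * k t)"
    unfolding ck by (rule half[OF hm[OF km] km k0 _ w(1)]) auto
  also have "\<dots> = (LINT t|lborel. LINT s|lborel. w t * K t s)"
    by (simp add: k_def)
  also have "\<dots> = (LINT s|lborel. LINT t|lborel. w t * K t s)"
    using lborel_pair.Fubini_integral[OF wK] by simp
  also have "\<dots> = (LINT s|lborel. (\<Sum>j\<le>n. (LINT t|lborel. u j t * \<alpha> t) * (v j s * \<gamma> s)))"
  proof (rule Bochner_Integration.integral_cong)
    fix s
    have "(LINT t|lborel. w t * K t s) = (LINT t|lborel. w (s + t) * K (s + t) s)"
      using lborel_integral_real_affine[of 1 "\<lambda>t. w t * K t s" s] by simp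
    also have "\<dots> = (LINT t|lborel. (\<Sum>j\<le>n. (u j t * \<alpha> t) * (v j s * \<gamma> s)))"
    proof (rule Bochner_Integration.integral_cong)
      fix t
      show "w (s + t) * K (s + t) s = (\<Sum>j\<le>n. (u j t * \<alpha> t) * (v j s * \<gamma> s))"
        unfolding add.commute[of s t] add K_def sum_distrib_right
        by (rule sum.cong) (simp_all add: mult_ac)
    qed simp
    also have "\<dots> = (\<Sum>j\<le>n. LINT t|lborel. (u j t * \<alpha> t) * (v j s * \<gamma> s))"
      by (rule Bochner_Integration.integral_sum)
         (intro integrable_mult_left wint[OF il(1) \<alpha>(2) u(1) u(2)])
    also have "\<dots> = (\<Sum>j\<le>n. (LINT t|lborel. u j t * \<alpha> t) * (v j s * \<gamma> s))"
      by simp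
    finally show "(LINT t|lborel. w t * K t s) = (\<Sum>j\<le>n. (LINT t|lborel. u j t * \<alpha> t) * (v j s * \<gamma> s))" .
  qed simp
  also have "\<dots> = (\<Sum>j\<le>n. LINT s|lborel. (LINT t|lborel. u j t * \<alpha> t) * (v j s * \<gamma> s))"
    by (rule Bochner_Integration.integral_sum)
       (intro integrable_mult_right wint[OF il(2) \<gamma>(2) v(1) v(2)])
  also have "\<dots> = (\<Sum>j\<le>n. (LINT t|half_line. u j t * a t) * (LINT t|half_line. v j t * c t))"
    by (simp add: half[OF am \<alpha> u(1)] half[OF cm \<gamma> v(1)])
  finally show "(LINT t|half_line. w t * conv t) =
      (\<Sum>j\<le>n. (LINT t|half_line. u j t * a t) * (LINT t|half_line. v j t * c t))" .
qed

lemma reflect_measurable: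
  fixes a :: "real \<Rightarrow> complex"
  assumes a: "a \<in> borel_measurable half_line"
  shows "(\<lambda>s. a (t - s)) \<in> borel_measurable (lebesgue_on {0..t})"
proof -
  obtain \<alpha> where \<alpha>: "\<alpha> \<in> borel_measurable borel" "\<And>t. t < 0 \<Longrightarrow> \<alpha> t = 0"
      "AE t in lborel. 0 \<le> t \<longrightarrow> a t = \<alpha> t"
    using borel_version[OF a] by metis
  interpret I: complete_measure "lebesgue_on {0..t}"
    by (rule complete_measure_lebesgue_on) simp
  have "(\<lambda>s. \<alpha> (t - s)) \<in> borel_measurable borel"
    using \<alpha>(1) by measurable
  then have "(\<lambda>s. \<alpha> (t - s)) \<in> borel_measurable (lebesgue_on {0..t})"
    by (intro measurable_restrict_space1 measurable_completion) simp
  moreover have "AE s in lebesgue_on {0..t}. \<alpha> (t - s) = a (t - s)"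
    unfolding AE_restrict_space_iff[of "{0..t}" lebesgue, simplified] AE_completion_iff
    using AE_reflect[OF \<alpha>(3), of t] by eventually_elim auto
  ultimately show ?thesis by (rule I.borel_measurable_AE_eq)
qed

lemma L1_scalar_iff:
  fixes a :: "real \<Rightarrow> 'b::{banach, second_countable_topology}"
  shows "a \<in> L1 \<longleftrightarrow> integrable half_line a"
  by (simp add: L1_iff half_line.bochner_integral_eq_lebesgue(1))

text \<open>Young's inequality for the norms, as an identity between integrals; the vector-valued
  convolution is dominated by the real one.\<close>

lemma norm_convolution:
  fixes a :: "real \<Rightarrow> complex" and r :: "real \<Rightarrow> real"
  assumes a: "integrable half_line a" and r: "integrable half_line r"
  defines "maj \<equiv> \<lambda>t. LINT s|lebesgue_on {0..t}. cmod (a (t - s)) * r s"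
  shows "AE t in half_line. integrable (lebesgue_on {0..t}) (\<lambda>s. cmod (a (t - s)) * r s)"
    and "integrable half_line maj"
    and "(LINT t|half_line. maj t) = (LINT t|half_line. cmod (a t)) * (LINT t|half_line. r t)"
proof -
  have a': "integrable half_line (\<lambda>t. complex_of_real (cmod (a t)))"
    and r': "integrable half_line (\<lambda>t. complex_of_real (r t))"
    using a r by auto
  note sc = scalar_convolution[OF a' r', folded of_real_mult]
  have eq: "(LINT s|lebesgue_on {0..t}. complex_of_real (cmod (a (t - s)) * r s)) = complex_of_real (maj t)" for t
    unfolding maj_def by (rule integral_complex_of_real)
  show "AE t in half_line. integrable (lebesgue_on {0..t}) (\<lambda>s. cmod (a (t - s)) * r s)"
    using sc(1) by (simp only: complex_of_real_integrable_eq)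
  have "integrable half_line (\<lambda>t. complex_of_real (maj t))"
    using sc(2) unfolding eq .
  then show "integrable half_line maj" by (simp only: complex_of_real_integrable_eq)
  have "(LINT t|half_line. 1 * complex_of_real (maj t)) =
      (\<Sum>j\<le>0::nat. (LINT t|half_line. 1 * complex_of_real (cmod (a t))) * (LINT t|half_line. 1 * complex_of_real (r t)))"
    using sc(3)[of "\<lambda>_. 1" 1 "\<lambda>_ _. 1" "\<lambda>_ _. 1" "0::nat"] unfolding eq by simp
  then have "complex_of_real (LINT t|half_line. maj t)
      = complex_of_real ((LINT t|half_line. cmod (a t)) * (LINT t|half_line. r t))"
    by simp
  then show "(LINT t|half_line. maj t) = (LINT t|half_line. cmod (a t)) * (LINT t|half_line. r t)"
    by (simp only: of_real_eq_iff)
qed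

lemma lebesgue_on_half_line: "lebesgue_on {0..t} = restrict_space half_line {0..t::real}"
  by (subst restrict_restrict_space) (auto intro!: arg_cong[where f = "restrict_space lebesgue"])

lemma fun_conv_integrand_integrable:
  fixes f :: "real \<Rightarrow> 'a::complex_banach"
  assumes a: "integrable half_line a" and f: "f \<in> L1"
  shows "AE t in half_line. bochner_integrable (lebesgue_on {0..t}) (\<lambda>s. a (t - s) *\<^sub>C f s)"
proof -
  have nf: "integrable half_line (\<lambda>t. norm (f t))"
    using f half_line.bochner_integrableD(2) by (simp add: L1_iff)
  have sm: "strongly_measurable (lebesgue_on {0..t}) f" for t
    unfolding lebesgue_on_half_line
    by (rule strongly_measurable_restrict[OF half_line.bochner_integrableD(1)])
       (use f in \<open>auto simp: L1_iff sets_restrict_space_iff\<close>)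
  have am: "a \<in> borel_measurable half_line" using a by auto
  show ?thesis
    using norm_convolution(1)[OF a nf]
  proof eventually_elim
    case (elim t)
    interpret I: complete_measure "lebesgue_on {0..t}"
      by (rule complete_measure_lebesgue_on) simp
    show ?case
      by (rule I.bochner_integrable_bound[OF strongly_measurable_scaleC[OF
            strongly_measurable_borel[OF reflect_measurable[OF am]] sm] elim])
         (simp add: norm_scaleC)
  qed
qed

lemma fun_conv_add:
  fixes f g :: "real \<Rightarrow> 'a::complex_banach"
  assumes a: "integrable half_line a" and f: "f \<in> L1" and g: "g \<in> L1"
  shows "AE t in half_line. fun_conv a (\<lambda>t. f t + g t) t = fun_conv a f t + fun_conv a g t"
  using fun_conv_integrand_integrable[OF a f] fun_conv_integrand_integrable[OF a g]
proof eventually_elim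
  case (elim t)
  interpret I: complete_measure "lebesgue_on {0..t}"
    by (rule complete_measure_lebesgue_on) simp
  show ?case
    unfolding fun_conv_def scaleC_add_right by (rule I.bochner_integral_add[OF elim])
qed

lemma norm_fun_conv_diff_le:
  fixes f g :: "real \<Rightarrow> 'a::complex_banach"
  assumes a: "integrable half_line a" and f: "f \<in> L1" and g: "g \<in> L1"
  shows "AE t in half_line. norm (fun_conv a f t - fun_conv a g t)
    \<le> (LINT s|lebesgue_on {0..t}. cmod (a (t - s)) * norm (f s - g s))"
  using fun_conv_integrand_integrable[OF a f] fun_conv_integrand_integrable[OF a g]
proof eventually_elim
  case (elim t)
  interpret I: complete_measure "lebesgue_on {0..t}"
    by (rule complete_measure_lebesgue_on) simp
  have "fun_conv a f t - fun_conv a g t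
      = bochner_integral (lebesgue_on {0..t}) (\<lambda>s. a (t - s) *\<^sub>C (f s - g s))"
    unfolding fun_conv_def scaleC.diff_right by (rule I.bochner_integral_diff[OF elim, symmetric])
  moreover have "bochner_integrable (lebesgue_on {0..t}) (\<lambda>s. a (t - s) *\<^sub>C (f s - g s))"
    unfolding scaleC.diff_right by (rule I.bochner_integrable_diff[OF elim])
  ultimately show ?case
    using I.norm_bochner_integral_le by (fastforce simp: norm_scaleC)
qed

lemma poisson_scalar:
  fixes a :: "real \<Rightarrow> complex"
  assumes "integrable half_line a"
  shows "poisson a n = (LINT t|half_line. complex_of_real (poisson_weight n t) * a t)"
  using poisson_scaleC_const(2)[OF assms, of "1::complex" n] by (simp add: scaleC_complex_def)

lemma poisson_weight_add:
  "poisson_weight n (t + s) = (\<Sum>j\<le>n. poisson_weight (n - j) t * poisson_weight j s)"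
proof -
  have "(s + t) ^ n / fact n = (\<Sum>j\<le>n. s ^ j / fact j * (t ^ (n - j) / fact (n - j)))"
    using exp_series_add_commuting[of s t n] by (simp add: divide_inverse mult.commute)
  then show ?thesis
    unfolding poisson_weight_def minus_add_distrib exp_add
    by (simp add: add.commute[of t s] sum_distrib_left mult_ac)
qed

lemma norm_poisson_le_L1_norm:
  fixes f :: "real \<Rightarrow> 'a::complex_banach"
  assumes f: "f \<in> L1"
  shows "norm (poisson f n) \<le> L1_norm f"
proof -
  have sm: "summable (\<lambda>n. norm (poisson f n))"
    using poisson_in_l1(1)[OF f] by (simp add: l1_def)
  have "norm (poisson f n) \<le> l1_norm (poisson f)"
    unfolding l1_norm_def using sum_le_suminf[OF sm, of "{n}"] by simp
  then show ?thesis using poisson_in_l1(2)[OF f] by simp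
qed

text \<open>On a one-step function the convolution is a scalar convolution times a fixed vector, and the
  addition theorem of the Poisson weights turns it into the discrete convolution.\<close>

lemma fun_conv_indicator:
  fixes x :: "'a::complex_banach"
  assumes a: "integrable half_line a" and A: "A \<in> sets half_line" "emeasure half_line A < \<infinity>"
  shows "fun_conv a (\<lambda>t. indicator A t *\<^sub>R x) \<in> L1 \<and>
    poisson (fun_conv a (\<lambda>t. indicator A t *\<^sub>R x)) n = seq_conv (poisson a) (poisson (\<lambda>t. indicator A t *\<^sub>R x)) n"
proof -
  define c where "c t = complex_of_real (indicator A t)" for t
  have "integrable half_line (indicator A :: real \<Rightarrow> real)"
    using A by (rule integrable_real_indicator)
  then have c: "integrable half_line c" unfolding c_def by simp
  note sc = scalar_convolution[OF a c]
  have ic: "indicator A t *\<^sub>R x = c t *\<^sub>C x" for t by (simp add: c_def scaleR_eq_scaleC)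
  let ?conv = "\<lambda>t. LINT s|lebesgue_on {0..t}. a (t - s) * c s"
  have ae: "AE t in half_line. ?conv t *\<^sub>C x = fun_conv a (\<lambda>t. c t *\<^sub>C x) t"
    using sc(1)
  proof eventually_elim
    case (elim t)
    interpret I: complete_measure "lebesgue_on {0..t}"
      by (rule complete_measure_lebesgue_on) simp
    show ?case
      unfolding fun_conv_def scaleC_scaleC
      using I.bochner_integral_bounded_linear[OF scaleC.bounded_linear_left
          I.bochner_integral_eq_lebesgue(1)[THEN iffD2, OF elim], of x]
        I.bochner_integral_eq_lebesgue(2)[OF elim] by simp
  qed
  have L: "fun_conv a (\<lambda>t. c t *\<^sub>C x) \<in> L1"
    using half_line.bochner_integrable_cong[OF ae] poisson_scaleC_const(1)[OF sc(2), of x]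
    by (simp add: L1_iff)
  have "poisson (fun_conv a (\<lambda>t. c t *\<^sub>C x)) n = poisson (\<lambda>t. ?conv t *\<^sub>C x) n"
    by (rule poisson_cong[symmetric, OF ae])
  also have "\<dots> = (LINT t|half_line. complex_of_real (poisson_weight n t) * ?conv t) *\<^sub>C x"
    by (rule poisson_scaleC_const(2)[OF sc(2)])
  also have "(LINT t|half_line. complex_of_real (poisson_weight n t) * ?conv t) =
    (\<Sum>j\<le>n. (LINT t|half_line. complex_of_real (poisson_weight (n - j) t) * a t) *
      (LINT t|half_line. complex_of_real (poisson_weight j t) * c t))"
  proof (rule sc(3)[where B = 1 and w = "\<lambda>t. complex_of_real (poisson_weight n t)"
          and u = "\<lambda>j t. complex_of_real (poisson_weight (n - j) t)"
          and v = "\<lambda>j t. complex_of_real (poisson_weight j t)"])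
    show "complex_of_real (poisson_weight n (t + s)) =
        (\<Sum>j\<le>n. complex_of_real (poisson_weight (n - j) t) * complex_of_real (poisson_weight j s))" for t s
      by (simp add: poisson_weight_add)
  qed (auto intro!: continuous_on_of_real continuous_on_poisson_weight
        simp: poisson_weight_nonneg poisson_weight_le_1)
  also have "\<dots> *\<^sub>C x = seq_conv (poisson a) (poisson (\<lambda>t. c t *\<^sub>C x)) n"
    unfolding seq_conv_def poisson_scalar[OF a] poisson_scaleC_const(2)[OF c]
    by (simp add: scaleC.sum_left scaleC_scaleC)
  finally show ?thesis using L unfolding ic by simp
qed

text \<open>The induction transports not only the identity but also the membership of the convolution in
  \<open>L\<^sup>1\<close>, whose measurability part is obtained in the limit from the majorants.\<close>

lemma poisson_fun_conv:
  fixes f :: "real \<Rightarrow> 'a::complex_banach"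
  assumes a: "a \<in> L1" and f: "f \<in> L1"
  shows "fun_conv a f \<in> L1 \<and> (\<forall>n. poisson (fun_conv a f) n = seq_conv (poisson a) (poisson f) n)"
proof -
  have ai: "integrable half_line a" using a by (simp add: L1_scalar_iff)
  define C where "C = (LINT t|half_line. cmod (a t))"
  have C: "0 \<le> C" by (simp add: C_def)
  have "bochner_integrable half_line f" using f by (simp add: L1_iff)
  then show ?thesis
  proof (induction rule: half_line.bochner_integrable_induct)
    case (indicator A x)
    then show ?case using fun_conv_indicator[OF ai] by blast
  next
    case (add f g)
    then have fg: "f \<in> L1" "g \<in> L1" by (auto simp: L1_iff)
    have c: "fun_conv a f \<in> L1" "fun_conv a g \<in> L1" using add by auto
    note ae = fun_conv_add[OF ai fg]
    have ae': "AE t in half_line. fun_conv a f t + fun_conv a g t = fun_conv a (\<lambda>t. f t + g t) t"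
      using ae by eventually_elim simp
    have "fun_conv a (\<lambda>t. f t + g t) \<in> L1"
      using half_line.bochner_integrable_cong[OF ae'] L1_add[OF c] by (simp add: L1_iff)
    moreover have "poisson (fun_conv a (\<lambda>t. f t + g t)) n
        = seq_conv (poisson a) (poisson (\<lambda>t. f t + g t)) n" for n
      unfolding poisson_cong[OF ae] poisson_add[OF c] seq_conv_def poisson_add[OF fg]
        scaleC_add_right sum.distrib using add by (simp add: seq_conv_def)
    ultimately show ?case by blast
  next
    case (lim f)
    have f: "f \<in> L1" using lim by (simp add: L1_iff)
    let ?h = "\<lambda>g t. LINT s|lebesgue_on {0..t}. cmod (a (t - s)) * norm (f s - g s)"
    have nfg: "integrable half_line (\<lambda>t. norm (f t - g t))" if "g \<in> L1" for g
      using half_line.integrable_norm_diff lim(1) that by (simp add: L1_iff)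
    have approx: "\<exists>g. g \<in> L1 \<and> fun_conv a g \<in> L1 \<and>
        (\<forall>n. poisson (fun_conv a g) n = seq_conv (poisson a) (poisson g) n) \<and> L1_norm (\<lambda>t. f t - g t) < e"
      if "0 < e" for e
      using lim(2)[OF that] unfolding L1_iff L1_norm_def by blast
    have h: "integrable half_line (?h g)" "(LINT t|half_line. ?h g t) = C * L1_norm (\<lambda>t. f t - g t)"
      if "g \<in> L1" for g
      using norm_convolution(2,3)[OF ai nfg[OF that]] by (auto simp: C_def L1_norm_def)
    have L: "fun_conv a f \<in> L1"
      unfolding L1_iff
    proof (rule half_line.bochner_integrable_limit)
      fix e :: real assume e: "0 < e"
      then have "0 < e / (C + 1)" using C by simp
      from approx[OF this] obtain g where g: "g \<in> L1" "fun_conv a g \<in> L1"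
          "L1_norm (\<lambda>t. f t - g t) < e / (C + 1)" by blast
      have "C * L1_norm (\<lambda>t. f t - g t) \<le> C * (e / (C + 1))"
        using g(3) C by (intro mult_left_mono) auto
      also have "\<dots> < e" using C e by (simp add: field_simps)
      finally have "(LINT t|half_line. ?h g t) < e" using h(2)[OF g(1)] by simp
      then show "\<exists>g h. bochner_integrable half_line g \<and> integrable half_line h \<and>
          (AE t in half_line. norm (fun_conv a f t - g t) \<le> h t) \<and> (LINT t|half_line. h t) < e"
        using g(2) h(1)[OF g(1)] norm_fun_conv_diff_le[OF ai f g(1)] unfolding L1_iff by blast
    qed
    have "poisson (fun_conv a f) n = seq_conv (poisson a) (poisson f) n" for n
    proof -
      define B where "B = (\<Sum>j\<le>n. cmod (poisson a (n - j)))"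
      have B: "0 \<le> B" unfolding B_def by (simp add: sum_nonneg)
      have "norm (poisson (fun_conv a f) n - seq_conv (poisson a) (poisson f) n) \<le> 0"
      proof (rule field_le_epsilon)
        fix e :: real assume e: "0 < e"
        then have "0 < e / (C + B + 1)" using C B by simp
        from approx[OF this] obtain g where g: "g \<in> L1" "fun_conv a g \<in> L1"
            "poisson (fun_conv a g) n = seq_conv (poisson a) (poisson g) n"
            "L1_norm (\<lambda>t. f t - g t) < e / (C + B + 1)" by blast
        let ?d = "L1_norm (\<lambda>t. f t - g t)"
        have d0: "0 \<le> ?d" by (simp add: L1_norm_def)
        have 1: "norm (poisson (fun_conv a f) n - poisson (fun_conv a g) n) \<le> C * ?d"
        proof -
          have "norm (poisson (fun_conv a f) n - poisson (fun_conv a g) n)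
              \<le> L1_norm (\<lambda>t. fun_conv a f t - fun_conv a g t)"
            unfolding poisson_diff[OF L g(2), symmetric]
            by (rule norm_poisson_le_L1_norm[OF L1_diff[OF L g(2)]])
          also have "\<dots> \<le> (LINT t|half_line. ?h g t)"
            unfolding L1_norm_def
            by (rule integral_mono_AE[OF _ h(1)[OF g(1)] norm_fun_conv_diff_le[OF ai f g(1)]])
               (use half_line.integrable_norm_diff L g(2) in \<open>simp add: L1_iff\<close>)
          finally show ?thesis unfolding h(2)[OF g(1)] .
        qed
        have 2: "norm (seq_conv (poisson a) (poisson f) n - seq_conv (poisson a) (poisson g) n) \<le> B * ?d"
        proof -
          have "norm (seq_conv (poisson a) (poisson f) n - seq_conv (poisson a) (poisson g) n)
              = norm (\<Sum>j\<le>n. poisson a (n - j) *\<^sub>C poisson (\<lambda>t. f t - g t) j)"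
            unfolding seq_conv_def sum_subtractf[symmetric] scaleC.diff_right[symmetric]
              poisson_diff[OF f g(1)] ..
          also have "\<dots> \<le> (\<Sum>j\<le>n. cmod (poisson a (n - j)) * ?d)"
            by (rule sum_norm_le)
               (simp add: norm_scaleC mult_left_mono norm_poisson_le_L1_norm[OF L1_diff[OF f g(1)]])
          finally show ?thesis by (simp add: B_def sum_distrib_right)
        qed
        have "norm (poisson (fun_conv a f) n - seq_conv (poisson a) (poisson f) n) \<le> C * ?d + B * ?d"
          using norm_triangle_ineq4[of "poisson (fun_conv a f) n - poisson (fun_conv a g) n"
              "seq_conv (poisson a) (poisson f) n - seq_conv (poisson a) (poisson g) n"] 1 2 g(3) by simp
        also have "\<dots> \<le> (C + B + 1) * ?d" using d0 by (simp add: algebra_simps)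
        also have "\<dots> \<le> e" using g(4) C B by (simp add: field_simps)
        finally show "norm (poisson (fun_conv a f) n - seq_conv (poisson a) (poisson f) n) \<le> 0 + e" by simp
      qed
      then show ?thesis by simp
    qed
    with L show ?case by blast
  qed
qed

section \<open>Integrals in closed convex cones\<close>

context complete_measure
begin

text \<open>Replacing every value \<open>y\<close> of an approximating simple function by a point of the cone whose
  distance from \<open>y\<close> is at most twice the distance of \<open>y\<close> from the cone spoils the approximation only
  by the factor three. The integrals of the modified simple functions are conic combinations, and
  the cone is closed.\<close>

lemma bochner_integral_in_cone:
  fixes f :: "'a \<Rightarrow> 'b::banach"
  assumes f: "bochner_integrable M f" and K: "closed K" "0 \<in> K"
    and add: "\<And>x y. x \<in> K \<Longrightarrow> y \<in> K \<Longrightarrow> x + y \<in> K"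
    and scale: "\<And>r x. 0 \<le> r \<Longrightarrow> x \<in> K \<Longrightarrow> r *\<^sub>R x \<in> K"
    and ae: "AE x in M. f x \<in> K"
  shows "bochner_integral M f \<in> K"
proof -
  have "\<exists>z\<in>K. dist y z \<le> 2 * infdist y K" for y
  proof (cases "y \<in> K")
    case True
    then show ?thesis by (intro bexI[of _ y]) (auto simp: infdist_nonneg)
  next
    case False
    then have "0 < infdist y K"
      using in_closed_iff_infdist_zero[OF K(1), of y] K(2) infdist_nonneg[of y K] by fastforce
    moreover have "infdist y K = Inf (dist y ` K)"
      using K(2) by (intro infdist_notempty) auto
    ultimately have "Inf (dist y ` K) < 2 * infdist y K" by simp
    then obtain d where "d \<in> dist y ` K" "d < 2 * infdist y K"
      using cInf_lessD[of "dist y ` K"] K(2) by blast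
    then show ?thesis by force
  qed
  then obtain q where q: "\<And>y. q y \<in> K" "\<And>y. dist y (q y) \<le> 2 * infdist y K"
    by metis
  have q0: "q 0 = 0"
    using q(2)[of 0] infdist_zero[OF K(2)] by simp
  have "\<exists>z\<in>K. dist z (bochner_integral M f) < e" if e: "0 < e" for e
  proof -
    have "0 < e / 3" using e by simp
    with bochner_integrable_simple_approx[OF f] obtain s
      where s: "simple_bochner_integrable M s" "(LINT x|M. norm (f x - s x)) < e / 3"
      by blast
    have qs: "simple_bochner_integrable M (\<lambda>x. q (s x))"
      using simple_bochner_integrable_compose2[of "\<lambda>x y. q x" M s s] q0 s(1) by simp
    have "simple_bochner_integral M (\<lambda>x. q (s x)) \<in> K"
    proof -
      have "(\<Sum>y\<in>Y. measure M {x \<in> space M. q (s x) = y} *\<^sub>R y) \<in> K"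
        if "finite Y" "Y \<subseteq> K" for Y
        using that by (induction Y) (auto intro!: add scale K(2))
      moreover have "finite ((\<lambda>x. q (s x)) ` space M)"
        using simple_functionD(1)[OF simple_bochner_integrable_imp_simple[OF qs]] .
      moreover have "(\<lambda>x. q (s x)) ` space M \<subseteq> K" using q(1) by auto
      ultimately show ?thesis
        unfolding Bochner_Integration.simple_bochner_integral_def by blast
    qed
    moreover have "dist (simple_bochner_integral M (\<lambda>x. q (s x))) (bochner_integral M f) < e"
    proof -
      have "dist (simple_bochner_integral M (\<lambda>x. q (s x))) (bochner_integral M f)
          \<le> (LINT x|M. norm (f x - q (s x)))"
        using bochner_integral_dist_simple[OF f f qs] by (simp add: dist_norm norm_minus_commute)
      also have "\<dots> \<le> (LINT x|M. 3 * norm (f x - s x))"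
      proof (rule integral_mono_AE)
        show "AE x in M. norm (f x - q (s x)) \<le> 3 * norm (f x - s x)"
          using ae
        proof eventually_elim
          case (elim x)
          have "infdist (s x) K \<le> norm (f x - s x)"
            using infdist_le[OF elim, of "s x"] by (simp add: dist_norm norm_minus_commute)
          then show ?case
            using norm_triangle_ineq[of "f x - s x" "s x - q (s x)"] q(2)[of "s x"]
            by (simp add: dist_norm)
        qed
      qed (use integrable_norm_diff_simple[OF f qs] integrable_norm_diff_simple[OF f s(1)] in auto)
      also have "\<dots> < e" using s(2) by simp
      finally show ?thesis .
    qed
    ultimately show ?thesis by blast
  qed
  then have "bochner_integral M f \<in> closure K"
    unfolding closure_approachable by blast
  then show ?thesis using K(1) by simp
qed

end

text \<open>The positive cone of a Banach lattice is closed because the negative part of \<open>x\<close> is dominated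
  by the modulus of \<open>x - y\<close> for every positive \<open>y\<close>.\<close>

lemma closed_positive_cone:
  fixes E :: "'a::banach set"
  assumes "real_banach_lattice_on E le"
  shows "closed {x \<in> E. le 0 x}"
    and "0 \<in> {x \<in> E. le 0 x}"
    and "\<And>x y. x \<in> {x \<in> E. le 0 x} \<Longrightarrow> y \<in> {x \<in> E. le 0 x} \<Longrightarrow> x + y \<in> {x \<in> E. le 0 x}"
    and "\<And>r x. 0 \<le> r \<Longrightarrow> x \<in> {x \<in> E. le 0 x} \<Longrightarrow> r *\<^sub>R x \<in> {x \<in> E. le 0 x}"
proof -
  have E: "subspace E" "closed E"
    and refl: "\<And>x. x \<in> E \<Longrightarrow> le x x"
    and tr: "\<And>x y z. x \<in> E \<Longrightarrow> y \<in> E \<Longrightarrow> z \<in> E \<Longrightarrow> le x y \<Longrightarrow> le y z \<Longrightarrow> le x z"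
    and ad: "\<And>x y z. x \<in> E \<Longrightarrow> y \<in> E \<Longrightarrow> z \<in> E \<Longrightarrow> le x y \<Longrightarrow> le (x + z) (y + z)"
    and sc: "\<And>x y r. x \<in> E \<Longrightarrow> y \<in> E \<Longrightarrow> 0 \<le> r \<Longrightarrow> le x y \<Longrightarrow> le (r *\<^sub>R x) (r *\<^sub>R y)"
    and sup: "\<And>x y. x \<in> E \<Longrightarrow> y \<in> E \<Longrightarrow> \<exists>m. is_sup_in E le {x, y} m"
    and nrm: "\<And>x y a b. x \<in> E \<Longrightarrow> y \<in> E \<Longrightarrow> is_sup_in E le {x, - x} a \<Longrightarrow> is_sup_in E le {y, - y} b
      \<Longrightarrow> le a b \<Longrightarrow> norm x \<le> norm y"
    using assms unfolding real_banach_lattice_on_def by meson+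
  note sub = subspace_add[OF E(1)] subspace_diff[OF E(1)] subspace_neg[OF E(1)] subspace_scale[OF E(1)]
  have z: "0 \<in> E" by (rule subspace_0[OF E(1)])
  show "0 \<in> {x \<in> E. le 0 x}" using z refl by simp
  show "x + y \<in> {x \<in> E. le 0 x}" if "x \<in> {x \<in> E. le 0 x}" "y \<in> {x \<in> E. le 0 x}" for x y
  proof -
    have "le (0 + y) (x + y)" using that z by (intro ad) auto
    then show ?thesis using that z sub(1)[of x y] tr[of 0 y "x + y"] by auto
  qed
  show "r *\<^sub>R x \<in> {x \<in> E. le 0 x}" if "0 \<le> r" "x \<in> {x \<in> E. le 0 x}" for r x
    using that z sub(4)[of x r] sc[of 0 x r] by auto
  show "closed {x \<in> E. le 0 x}"
    unfolding closed_sequential_limits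
  proof (intro allI impI, elim conjE)
    fix x l assume x: "\<forall>n. x n \<in> {x \<in> E. le 0 x}" and lim: "x \<longlonglongrightarrow> l"
    have xE: "x n \<in> E" and x0: "le 0 (x n)" for n using x by auto
    have l: "l \<in> E" using E(2) xE lim by (rule closed_sequentially)
    \<comment> \<open>\<open>m\<close> is the negative part of the limit \<open>l\<close>.\<close>
    obtain m where m: "is_sup_in E le {0, - l} m" using sup[OF z sub(3)[OF l]] by blast
    have mE: "m \<in> E" and m0: "le 0 m" and ml: "le (- l) m"
      and mleast: "\<And>u. u \<in> E \<Longrightarrow> le 0 u \<Longrightarrow> le (- l) u \<Longrightarrow> le m u"
      using m by (auto simp: is_sup_in_def)
    have "le (0 + - m) (m + - m)" using z mE sub(3)[OF mE] m0 by (intro ad)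
    then have "le (- m) m" using tr[OF sub(3)[OF mE] z mE] m0 by simp
    then have msup: "is_sup_in E le {m, - m} m"
      using mE refl by (simp add: is_sup_in_def)
    have le: "norm m \<le> norm (l - x n)" for n
    proof -
      define v where "v = l - x n"
      have v1: "v \<in> E" unfolding v_def by (rule sub(2)[OF l xE])
      note v = v1 sub(3)[OF v1]
      obtain b where b: "is_sup_in E le {v, - v} b" using sup[OF v] by blast
      have bE: "b \<in> E" and vb: "le v b" "le (- v) b" using b by (auto simp: is_sup_in_def)
      have bb: "b + b \<in> E" "b - v \<in> E" using sub(1)[OF bE bE] sub(2)[OF bE v(1)] by auto
      have "le (v + - v) (b + - v)" by (rule ad[OF v(1) bE v(2) vb(1)])
      moreover have "le (- v + b) (b + b)" by (rule ad[OF v(2) bE bE vb(2)])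
      ultimately have "le 0 (b + b)" using tr[OF z bb(2,1)] by simp
      from sc[OF z bb(1) _ this, of "1 / 2"] have b0: "le 0 b"
        by (simp add: scaleR_2[symmetric])
      have "le (0 + - l) (x n + - l)" by (rule ad[OF z xE sub(3)[OF l] x0])
      then have "le (- l) (- v)" by (simp add: v_def)
      then have "le (- l) b" using tr[OF sub(3)[OF l] v(2) bE] vb(2) by blast
      from nrm[OF mE v(1) msup b mleast[OF bE b0 this]] show ?thesis by (simp add: v_def)
    qed
    have "(\<lambda>n. norm (l - x n)) \<longlonglongrightarrow> norm (l - l)" by (intro tendsto_intros lim)
    then have "norm m \<le> norm (l - l)"
      by (rule LIMSEQ_le_const) (use le in auto)
    then have "m = 0" by simp
    then have "le (- l + l) (0 + l)" using ml by (intro ad sub(3) l z) simp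
    then show "l \<in> {x \<in> E. le 0 x}" using l by simp
  qed
qed

lemma poisson_nonneg:
  fixes f :: "real \<Rightarrow> 'a::complex_banach"
  assumes lat: "complex_banach_lattice E le" and f: "f \<in> L1"
    and ae: "AE t in half_line. nonneg_in E le (f t)"
  shows "nonneg_in E le (poisson f n)"
proof -
  have "real_banach_lattice_on E le" using lat by (simp add: complex_banach_lattice_def)
  note K = closed_positive_cone[OF this]
  have "poisson f n \<in> {x \<in> E. le 0 x}"
    unfolding poisson_def
  proof (rule half_line.bochner_integral_in_cone[OF poisson_integrable[OF f] K])
    show "AE t in half_line. poisson_weight n t *\<^sub>R f t \<in> {x \<in> E. le 0 x}"
      using ae AE_space
    proof eventually_elim
      case (elim t)
      then show ?case by (intro K(4) poisson_weight_nonneg) (auto simp: nonneg_in_def)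
    qed
  qed
  then show ?thesis by (simp add: nonneg_in_def)
qed

section \<open>Compactness of strong integrals\<close>

lemma compact_closure_if_near_compact:
  fixes K :: "'a::banach set"
  assumes "\<And>e. 0 < e \<Longrightarrow> \<exists>C. compact C \<and> (\<forall>z\<in>K. \<exists>c\<in>C. dist z c < e)"
  shows "compact (closure K)"
  unfolding compact_eq_totally_bounded
proof (intro conjI allI impI)
  show "complete (closure K)" by (simp add: complete_eq_closed)
  fix e :: real assume "0 < e"
  then have e: "0 < e / 3" by simp
  obtain C where C: "compact C" "\<And>z. z \<in> K \<Longrightarrow> \<exists>c\<in>C. dist z c < e / 3"
    using assms[OF e] by blast
  obtain k where k: "finite k" "C \<subseteq> (\<Union>x\<in>k. ball x (e / 3))"
    using C(1) e unfolding compact_eq_totally_bounded by blast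
  have "closure K \<subseteq> (\<Union>x\<in>k. ball x e)"
  proof
    fix z assume "z \<in> closure K"
    then obtain z' where z': "z' \<in> K" "dist z' z < e / 3"
      using e unfolding closure_approachable by blast
    obtain c where c: "c \<in> C" "dist z' c < e / 3" using C(2)[OF z'(1)] by blast
    obtain x where x: "x \<in> k" "dist x c < e / 3" using k(2) c(1) by auto
    have "dist x z \<le> dist x c + dist z' c + dist z' z"
      using dist_triangle[of x z c] dist_triangle[of c z z'] dist_commute[of c z'] by linarith
    then show "z \<in> (\<Union>x\<in>k. ball x e)" using x c z' by (intro UN_I[OF x(1)]) simp
  qed
  with k(1) show "\<exists>k. finite k \<and> closure K \<subseteq> (\<Union>x\<in>k. ball x e)" by blast
qed

text \<open>Passing to sequences keeps the families of integrands below countable, so that suprema over them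
  are measurable.\<close>

lemma compact_closure_image_if_sequences:
  fixes T :: "'a \<Rightarrow> 'b::metric_space"
  assumes "\<And>X :: nat \<Rightarrow> 'a. range X \<subseteq> B \<Longrightarrow> compact (closure (range (\<lambda>n. T (X n))))"
  shows "compact (closure (T ` B))"
  unfolding compact_eq_seq_compact_metric seq_compact_def
proof (intro allI impI)
  fix y :: "nat \<Rightarrow> 'b" assume y: "\<forall>n. y n \<in> closure (T ` B)"
  have "\<exists>x\<in>B. dist (T x) (y n) < inverse (real (Suc n))" for n
    using y closure_approachable[of "y n" "T ` B"] by force
  then obtain X where X: "\<And>n. X n \<in> B" "\<And>n. dist (T (X n)) (y n) < inverse (real (Suc n))"
    by metis
  have "compact (closure (range (\<lambda>n. T (X n))))" using assms X(1) by blast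
  then have "seq_compact (closure (range (\<lambda>n. T (X n))))" by (rule compact_imp_seq_compact)
  moreover have "\<forall>n. T (X n) \<in> closure (range (\<lambda>n. T (X n)))"
    by (intro allI subsetD[OF closure_subset] rangeI)
  ultimately obtain l r where r: "strict_mono (r :: nat \<Rightarrow> nat)" "((\<lambda>n. T (X n)) \<circ> r) \<longlonglongrightarrow> l"
    by (rule seq_compactE)
  have "(\<lambda>n. dist (T (X n)) (y n)) \<longlonglongrightarrow> 0"
    by (rule tendsto_sandwich[OF _ _ tendsto_const LIMSEQ_inverse_real_of_nat])
       (use X(2) in \<open>auto intro!: always_eventually less_imp_le\<close>)
  from LIMSEQ_subseq_LIMSEQ[OF this r(1)]
  have d: "(\<lambda>n. dist (T (X (r n))) (y (r n))) \<longlonglongrightarrow> 0" by (simp add: o_def)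
  have "(\<lambda>n. dist (T (X (r n))) l) \<longlonglongrightarrow> 0"
    using r(2) by (simp add: tendsto_dist_iff[symmetric] o_def)
  from tendsto_add[OF d this] have s: "(\<lambda>n. dist (T (X (r n))) (y (r n)) + dist (T (X (r n))) l) \<longlonglongrightarrow> 0"
    by simp
  have "(\<lambda>n. dist (y (r n)) l) \<longlonglongrightarrow> 0"
    by (rule tendsto_sandwich[OF _ _ tendsto_const s])
       (auto intro!: always_eventually dist_triangle3)
  then have lim: "(y \<circ> r) \<longlonglongrightarrow> l" by (simp add: tendsto_dist_iff[of _ l] o_def)
  moreover have "l \<in> closure (T ` B)"
    by (rule closed_sequentially[OF closed_closure _ lim]) (use y in auto)
  ultimately show "\<exists>l\<in>closure (T ` B). \<exists>r. strict_mono r \<and> (y \<circ> r) \<longlonglongrightarrow> l"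
    using r(1) by blast
qed

context complete_measure
begin

text \<open>A family of integrals is relatively compact if the integrands are pointwise relatively
  compact, bounded, and take values in the closure of one sequence \<open>y\<close>. By pointwise compactness the
  largest distance \<open>D k x\<close> of the values at \<open>x\<close> from \<open>y 0, \<dots>, y k\<close> tends to zero, hence so does its
  integral. Replacing each value by the nearest of \<open>y 0, \<dots>, y k\<close> moves all integrals by at most
  that much, into the convex hull of finitely many points.\<close>

lemma compact_closure_integrals:
  fixes f :: "nat \<Rightarrow> 'a \<Rightarrow> 'b::banach" and p :: "'a \<Rightarrow> real" and y :: "nat \<Rightarrow> 'b"
  assumes p: "integrable M p" "\<And>x. x \<in> space M \<Longrightarrow> 0 \<le> p x" "(LINT x|M. p x) = 1"
    and f: "\<And>n. strongly_measurable M (f n)"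
    and B: "\<And>n x. x \<in> space M \<Longrightarrow> norm (f n x) \<le> B"
    and y: "\<And>n x e. x \<in> space M \<Longrightarrow> 0 < e \<Longrightarrow> \<exists>i. norm (f n x - y i) < e"
    and cpt: "\<And>x. x \<in> space M \<Longrightarrow> compact (closure (range (\<lambda>n. f n x)))"
  shows "compact (closure (range (\<lambda>n. bochner_integral M (\<lambda>x. p x *\<^sub>R f n x))))"
proof (rule compact_closure_if_near_compact)
  fix e :: real assume e: "0 < e"
  have pm: "p \<in> borel_measurable M" using p(1) by auto
  define d where "d k n x = Min ((\<lambda>i. norm (f n x - y i)) ` {..k})" for k :: nat and n x
  define D where "D k x = (SUP n. d k n x)" for k x
  have d_le: "d k n x \<le> norm (f n x - y i)" if "i \<le> k" for k n x i
    unfolding d_def using that by (intro Min_le) auto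
  have d_in: "\<exists>i\<le>k. norm (f n x - y i) = d k n x" for k n x
  proof -
    have "d k n x \<in> (\<lambda>i. norm (f n x - y i)) ` {..k}"
      unfolding d_def by (intro Min_in) auto
    then show ?thesis by auto
  qed
  have d0: "0 \<le> d k n x" for k n x using d_in[of k n x] by (metis norm_ge_zero)
  have dB: "d k n x \<le> B + norm (y 0)" if "x \<in> space M" for k n x
    using d_le[of 0 k n x] norm_triangle_ineq4[of "f n x" "y 0"] B[OF that, of n] by simp
  have bdd: "bdd_above (range (\<lambda>n. d k n x))" if "x \<in> space M" for k x
    using dB[OF that] by (intro bdd_aboveI[of _ "B + norm (y 0)"]) auto
  have dD: "d k n x \<le> D k x" if "x \<in> space M" for k n x
    unfolding D_def by (rule cSUP_upper[OF UNIV_I bdd[OF that]])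
  have D0: "0 \<le> D k x" if "x \<in> space M" for k x
    using dD[OF that, of k 0] d0[of k 0 x] by simp
  have DB: "D k x \<le> B + norm (y 0)" if "x \<in> space M" for k x
    unfolding D_def by (rule cSUP_least) (use dB[OF that] in auto)
  have nm: "(\<lambda>x. norm (f n x - y i)) \<in> borel_measurable M" for n i
    by (intro borel_measurable_norm_strongly_measurable strongly_measurable_diff f
        strongly_measurable_simple simple_function_const)
  have dm: "d k n \<in> borel_measurable M" for k n
    unfolding d_def by (intro borel_measurable_Min nm) auto
  have Dm: "D k \<in> borel_measurable M" for k
    unfolding D_def by (rule borel_measurable_cSUP) (use dm bdd in auto)
  have D_lim: "(\<lambda>k. D k x) \<longlonglongrightarrow> 0" if x: "x \<in> space M" for x
  proof (rule tendstoI)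
    fix \<epsilon> :: real assume "0 < \<epsilon>"
    define \<delta> where "\<delta> = \<epsilon> / 2"
    have \<delta>: "0 < \<delta>" "\<delta> < \<epsilon>" using \<open>0 < \<epsilon>\<close> by (auto simp: \<delta>_def)
    have cover: "closure (range (\<lambda>n. f n x)) \<subseteq> (\<Union>i. ball (y i) \<delta>)"
    proof
      fix z assume "z \<in> closure (range (\<lambda>n. f n x))"
      then obtain n where n: "dist (f n x) z < \<delta> / 2"
        using \<delta>(1) unfolding closure_approachable by (metis half_gt_zero rangeE)
      obtain i where i: "norm (f n x - y i) < \<delta> / 2" using y[OF x] \<delta>(1) by (metis half_gt_zero)
      have "dist (y i) z < \<delta>"
        using dist_triangle_half_r[of "f n x" "y i" \<delta> z] n i by (simp add: dist_norm norm_minus_commute)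
      then show "z \<in> (\<Union>i. ball (y i) \<delta>)" by auto
    qed
    obtain I where I: "finite I" "closure (range (\<lambda>n. f n x)) \<subseteq> (\<Union>i\<in>I. ball (y i) \<delta>)"
      using compactE_image[OF cpt[OF x], of UNIV "\<lambda>i. ball (y i) \<delta>"] cover by auto
    obtain k0 where k0: "\<And>i. i \<in> I \<Longrightarrow> i \<le> k0"
      using I(1) finite_nat_set_iff_bounded_le by auto
    have "dist (D k x) 0 < \<epsilon>" if k: "k0 \<le> k" for k
    proof -
      have "d k n x \<le> \<delta>" for n
      proof -
        have "f n x \<in> closure (range (\<lambda>n. f n x))"
          by (intro subsetD[OF closure_subset] rangeI)
        then obtain i where i: "i \<in> I" "dist (y i) (f n x) < \<delta>" using I(2) by auto
        then show ?thesis
          using d_le[of i k n x] k0[OF i(1)] k by (simp add: dist_norm norm_minus_commute)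
      qed
      then have "D k x \<le> \<delta>" unfolding D_def by (intro cSUP_least) auto
      then show ?thesis using D0[OF x, of k] \<delta>(2) by simp
    qed
    then show "\<forall>\<^sub>F k in sequentially. dist (D k x) 0 < \<epsilon>"
      unfolding eventually_sequentially by blast
  qed
  have "(\<lambda>k. LINT x|M. p x * D k x) \<longlonglongrightarrow> (LINT x|M. 0)"
  proof (rule integral_dominated_convergence[where w = "\<lambda>x. p x * (B + norm (y 0))"])
    show "AE x in M. (\<lambda>k. p x * D k x) \<longlonglongrightarrow> 0"
      by (rule AE_I2) (use tendsto_mult_right_zero[OF D_lim] in blast)
    show "AE x in M. norm (p x * D k x) \<le> p x * (B + norm (y 0))" for k
      by (rule AE_I2) (use p(2) D0 DB in \<open>auto simp: abs_mult intro!: mult_left_mono\<close>)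
    show "(\<lambda>x. p x * D k x) \<in> borel_measurable M" for k
      by (intro borel_measurable_times pm Dm)
  qed (use p(1) in auto)
  then have "\<forall>\<^sub>F k in sequentially. (LINT x|M. p x * D k x) < e"
    using e by (intro order_tendstoD(2)) auto
  then obtain k where k: "(LINT x|M. p x * D k x) < e"
    by (auto simp: eventually_sequentially)
  have pD: "integrable M (\<lambda>x. p x * D k x)"
  proof (rule Bochner_Integration.integrable_bound)
    show "integrable M (\<lambda>x. p x * (B + norm (y 0)))" using p(1) by simp
    show "AE x in M. norm (p x * D k x) \<le> norm (p x * (B + norm (y 0)))"
    proof (rule AE_I2)
      fix x assume x: "x \<in> space M"
      show "norm (p x * D k x) \<le> norm (p x * (B + norm (y 0)))"
        using D0[OF x, of k] DB[OF x, of k] by (simp add: abs_mult mult_left_mono)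
    qed
  qed (intro borel_measurable_times pm Dm)
  show "\<exists>C. compact C \<and> (\<forall>z\<in>range (\<lambda>n. bochner_integral M (\<lambda>x. p x *\<^sub>R f n x)). \<exists>c\<in>C. dist z c < e)"
  proof (intro exI[of _ "convex hull (y ` {..k})"] conjI ballI)
    show "compact (convex hull (y ` {..k}))" by (rule finite_imp_compact_convex_hull) simp
    fix z assume "z \<in> range (\<lambda>n. bochner_integral M (\<lambda>x. p x *\<^sub>R f n x))"
    then obtain n where z: "z = bochner_integral M (\<lambda>x. p x *\<^sub>R f n x)" by blast
    \<comment> \<open>\<open>S i\<close> is the set where \<open>y i\<close> is a nearest point; \<open>A\<close> breaks ties in favour of the least
      index.\<close>
    define S where "S i = {x \<in> space M. norm (f n x - y i) = d k n x}" for i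
    define A where "A = disjointed S"
    have "S i \<in> sets M" for i
      unfolding S_def using nm[of n i] dm[of k n] by measurable
    then have A: "A i \<in> sets M" for i
      unfolding A_def using sets.range_disjointed_sets[of S M] by auto
    have AS: "A i \<subseteq> S i" for i unfolding A_def by (rule disjointed_subset)
    have "(\<Union>i\<in>{0..<Suc k}. A i) = (\<Union>i\<in>{0..<Suc k}. S i)"
      unfolding A_def by (rule finite_UN_disjointed_eq)
    also have "\<dots> = space M"
      using d_in[of k n] by (force simp: S_def)
    finally have AU: "(\<Union>i\<in>{..k}. A i) = space M"
      by (simp add: atLeast0LessThan lessThan_Suc_atMost)
    have disj: "disjoint_family_on A {..k}"
      unfolding A_def using disjoint_family_disjointed[of S] by (auto simp: disjoint_family_on_def)
    define c where "c i = (LINT x|M. p x * indicator (A i) x)" for i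
    have pA: "integrable M (\<lambda>x. p x * indicator (A i) x)" for i
      by (rule integrable_real_mult_indicator[OF A p(1)])
    have step: "bochner_integrable M (\<lambda>x. (p x * indicator (A i) x) *\<^sub>R y i) \<and>
        bochner_integral M (\<lambda>x. (p x * indicator (A i) x) *\<^sub>R y i) = c i *\<^sub>R y i" for i
      using bochner_integrable_bounded_linear[OF bounded_linear_scaleR_left, of "\<lambda>x. p x * indicator (A i) x" "y i"]
        bochner_integral_bounded_linear[OF bounded_linear_scaleR_left, of "\<lambda>x. p x * indicator (A i) x" "y i"]
        bochner_integral_eq_lebesgue[of "\<lambda>x. p x * indicator (A i) x"] pA[of i]
      by (simp add: c_def)
    define g where "g x = (\<Sum>i\<le>k. (p x * indicator (A i) x) *\<^sub>R y i)" for x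
    have g: "bochner_integrable M g" "bochner_integral M g = (\<Sum>i\<le>k. c i *\<^sub>R y i)"
      unfolding g_def using bochner_integral_sum[of "{..k}" "\<lambda>i x. (p x * indicator (A i) x) *\<^sub>R y i"] step
      by auto
    have "(\<Sum>i\<le>k. c i) = (LINT x|M. (\<Sum>i\<le>k. p x * indicator (A i) x))"
      unfolding c_def by (rule Bochner_Integration.integral_sum[symmetric]) (rule pA)
    also have "\<dots> = (LINT x|M. p x)"
    proof (rule Bochner_Integration.integral_cong)
      fix x assume x: "x \<in> space M"
      have "(\<Sum>i\<le>k. indicator (A i) x) = (1::real)"
        using indicator_UN_disjoint[OF _ disj, of x] AU x by simp
      then show "(\<Sum>i\<le>k. p x * indicator (A i) x) = p x"
        by (simp only: sum_distrib_left[symmetric] mult_1_right)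
    qed simp
    finally have c1: "(\<Sum>i\<le>k. c i) = 1" using p(3) by simp
    have c0: "0 \<le> c i" for i
      unfolding c_def by (rule integral_nonneg_AE, rule AE_I2) (use p(2) in \<open>auto simp: indicator_def\<close>)
    have "bochner_integral M g \<in> convex hull (y ` {..k})"
      unfolding g(2) using c1 c0
      by (intro convex_sum[OF _ convex_convex_hull]) (auto intro: hull_inc)
    moreover have "dist z (bochner_integral M g) < e"
    proof -
      have pf: "bochner_integrable M (\<lambda>x. p x *\<^sub>R f n x)"
      proof (rule bochner_integrable_bound)
        show "strongly_measurable M (\<lambda>x. p x *\<^sub>R f n x)"
          by (intro strongly_measurable_scaleR strongly_measurable_borel pm f)
        show "AE x in M. norm (p x *\<^sub>R f n x) \<le> p x * B"
          by (rule AE_I2) (use p(2) B in \<open>auto intro!: mult_left_mono\<close>)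
      qed (use p(1) in simp)
      have pt: "norm (p x *\<^sub>R f n x - g x) \<le> p x * D k x" if x: "x \<in> space M" for x
      proof -
        obtain i where i: "i \<le> k" "x \<in> A i" using AU x by auto
        have "indicator (A j) x = (if j = i then 1 else 0::real)" if "j \<le> k" for j
          using disj i that by (auto simp: disjoint_family_on_def indicator_def)
        then have "g x = (\<Sum>j\<le>k. if j = i then p x *\<^sub>R y i else 0)"
          unfolding g_def by (intro sum.cong) auto
        also have "\<dots> = p x *\<^sub>R y i" using i(1) by simp
        finally have "norm (p x *\<^sub>R f n x - g x) = p x * norm (f n x - y i)"
          using p(2)[OF x] by (simp add: scaleR_diff_right[symmetric])
        also have "norm (f n x - y i) = d k n x" using AS i(2) by (auto simp: S_def)
        finally show ?thesis using mult_left_mono[OF dD[OF x, of k n] p(2)[OF x]] by simp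
      qed
      have "dist z (bochner_integral M g) \<le> (LINT x|M. norm (p x *\<^sub>R f n x - g x))"
        unfolding z dist_norm bochner_integral_diff[OF pf g(1), symmetric]
        by (rule norm_bochner_integral_le[OF bochner_integrable_diff[OF pf g(1)]])
      also have "\<dots> \<le> (LINT x|M. p x * D k x)"
        by (rule integral_mono[OF integrable_norm_diff[OF pf g(1)] pD pt])
      finally show ?thesis using k by simp
    qed
    ultimately show "\<exists>c\<in>convex hull (y ` {..k}). dist z c < e" by blast
  qed
qed

end

text \<open>The countable dense set of values consists of the \<open>S q (X m)\<close> with rational \<open>q\<close>, by strong
  continuity.\<close>

lemma poisson_op_compact:
  fixes S :: "real \<Rightarrow> 'a::complex_banach \<Rightarrow> 'a"
  assumes lin: "\<And>t. 0 \<le> t \<Longrightarrow> bounded_clinear (S t)"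
    and cont: "\<And>x. continuous_on {0..} (\<lambda>t. S t x)"
    and bound: "\<And>t. 0 \<le> t \<Longrightarrow> onorm (S t) \<le> M"
    and cpt: "\<And>t. 0 \<le> t \<Longrightarrow> compact_operator (S t)"
  shows "compact_operator (poisson_op S n)"
proof -
  have bl: "bounded_linear (S t)" and cl: "S t (c *\<^sub>C x) = c *\<^sub>C S t x" if "0 \<le> t" for t c x
    using lin[OF that] by (auto simp: bounded_clinear_def)
  have M: "norm (S t x) \<le> M * norm x" if "0 \<le> t" for t x
    using onorm[OF bl[OF that], of x] mult_right_mono[OF bound[OF that], of "norm x"] by simp
  have sm: "strongly_measurable half_line (\<lambda>t. S t x)" for x
    by (rule strongly_measurable_continuous[OF cont])
  have le: "AE t in half_line. norm (S t x) \<le> M * norm x * exp (- 0 * t)" for x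
    by (rule AE_half_lineI) (simp add: M)
  note dec = poisson_decay[OF sm order_refl le]
  have op: "poisson_op S n x = bochner_integral half_line (\<lambda>t. poisson_weight n t *\<^sub>R S t x)" for x
    by (simp add: poisson_op_def poisson_def)
  have clin: "bounded_clinear (poisson_op S n)"
    unfolding bounded_clinear_def
  proof (intro conjI allI)
    have scC: "poisson_op S n (c *\<^sub>C x) = c *\<^sub>C poisson_op S n x" for c x
    proof -
      have "poisson_op S n (c *\<^sub>C x) = bochner_integral half_line (\<lambda>t. c *\<^sub>C poisson_weight n t *\<^sub>R S t x)"
        unfolding op
        by (rule half_line.bochner_integral_cong, rule AE_half_lineI)
           (simp add: cl scaleR_eq_scaleC scaleC_scaleC mult.commute)
      also have "\<dots> = c *\<^sub>C poisson_op S n x"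
        unfolding op by (rule half_line.bochner_integral_bounded_linear[OF scaleC.bounded_linear_right dec(1)])
      finally show ?thesis .
    qed
    then show "poisson_op S n (c *\<^sub>C x) = c *\<^sub>C poisson_op S n x" for c x .
    show "bounded_linear (poisson_op S n)"
    proof (rule bounded_linear_intro)
      fix x y
      have "poisson_op S n (x + y) = bochner_integral half_line
          (\<lambda>t. poisson_weight n t *\<^sub>R S t x + poisson_weight n t *\<^sub>R S t y)"
        unfolding op
        by (rule half_line.bochner_integral_cong, rule AE_half_lineI)
           (simp add: linear_add[OF bounded_linear.linear[OF bl]] scaleR_add_right)
      also have "\<dots> = poisson_op S n x + poisson_op S n y"
        unfolding op by (rule half_line.bochner_integral_add[OF dec(1) dec(1)])
      finally show "poisson_op S n (x + y) = poisson_op S n x + poisson_op S n y" .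
      show "poisson_op S n (r *\<^sub>R x) = r *\<^sub>R poisson_op S n x" for r
        using scC[of "of_real r" x] by (simp add: scaleC_of_real)
      show "norm (poisson_op S n x) \<le> norm x * M"
        using dec(2)[of x n] by (simp add: poisson_op_def mult.commute)
    qed
  qed
  have "compact (closure (poisson_op S n ` B))" if B: "bounded B" for B
  proof (rule compact_closure_image_if_sequences)
    fix X :: "nat \<Rightarrow> 'a" assume X: "range X \<subseteq> B"
    obtain b where b: "0 < b" "\<And>x. x \<in> B \<Longrightarrow> norm x \<le> b"
      using B bounded_pos by blast
    define Y where "Y = (\<lambda>(q, m). S q (X m)) ` ((\<rat> \<inter> {0..}) \<times> UNIV)"
    have Y: "countable Y" "Y \<noteq> {}"
      unfolding Y_def using countable_rat by (auto intro!: countable_image countable_SIGMA countable_Int1)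
    show "compact (closure (range (\<lambda>m. poisson_op S n (X m))))"
      unfolding op
    proof (rule half_line.compact_closure_integrals[where y = "from_nat_into Y" and B = "\<bar>M\<bar> * b"])
      show "integrable half_line (poisson_weight n)" "(LINT t|half_line. poisson_weight n t) = 1"
        by (rule poisson_weight_integral)+
      show "strongly_measurable half_line (\<lambda>t. S t (X m))" for m by (rule sm)
      fix t :: real assume "t \<in> space half_line"
      then have t: "0 \<le> t" by simp
      show "0 \<le> poisson_weight n t" by (rule poisson_weight_nonneg[OF t])
      show "norm (S t (X m)) \<le> \<bar>M\<bar> * b" for m
      proof -
        have "norm (S t (X m)) \<le> M * norm (X m)" by (rule M[OF t])
        also have "\<dots> \<le> \<bar>M\<bar> * b" using X b by (intro mult_mono) auto
        finally show ?thesis .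
      qed
      show "\<exists>i. norm (S t (X m) - from_nat_into Y i) < e" if e: "0 < e" for m e
      proof -
        have "\<exists>\<delta>>0. \<forall>t'\<in>{0..}. dist t' t < \<delta> \<longrightarrow> dist (S t' (X m)) (S t (X m)) < e"
          using cont[of "X m"] t e unfolding continuous_on_iff by simp
        then obtain \<delta> where \<delta>: "0 < \<delta>"
            "\<And>t'. 0 \<le> t' \<Longrightarrow> dist t' t < \<delta> \<Longrightarrow> dist (S t' (X m)) (S t (X m)) < e"
          by auto
        obtain q where q: "q \<in> \<rat>" "t < q" "q < t + \<delta>"
          using Rats_dense_in_real[of t "t + \<delta>"] \<delta>(1) by auto
        have "S q (X m) \<in> Y" unfolding Y_def using q t by force
        then obtain i where "from_nat_into Y i = S q (X m)"
          using from_nat_into_surj[OF Y(1)] by blast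
        moreover have "dist (S q (X m)) (S t (X m)) < e"
          by (rule \<delta>(2)) (use q t in \<open>auto simp: dist_real_def\<close>)
        ultimately show ?thesis by (metis dist_norm norm_minus_commute)
      qed
      have "compact (closure (S t ` B))"
        using cpt[OF t] B by (simp add: compact_operator_def)
      moreover have "closure (range (\<lambda>m. S t (X m))) \<subseteq> closure (S t ` B)"
        using X by (intro closure_mono) auto
      ultimately show "compact (closure (range (\<lambda>m. S t (X m))))"
        using compact_Int_closed[OF _ closed_closure] by (metis inf.absorb_iff2)
    qed
  qed
  with clin show ?thesis by (simp add: compact_operator_def)
qed

theorem theorem5p2:
  assumes nonzero: "\<exists>x::'a::complex_banach. x \<noteq> 0"
  shows
    \<comment> \<open>(i)\<close>
    "(bounded_operator_L1_l1 (poisson :: (real \<Rightarrow> 'a) \<Rightarrow> nat \<Rightarrow> 'a) \<and>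
      opnorm_L1_l1 (poisson :: (real \<Rightarrow> 'a) \<Rightarrow> nat \<Rightarrow> 'a) = 1) \<and>
    \<comment> \<open>(ii)\<close>
    ((\<forall>\<psi> :: real \<Rightarrow> 'a. \<psi> \<in> L1 \<longrightarrow>
        (\<forall>n s. Re s > 0 \<longrightarrow> (\<exists>D. has_cderiv ((cderiv ^^ n) (laplace \<psi>)) D s)) \<and>
        (\<forall>n. poisson \<psi> n = ((- 1) ^ n / fact n) *\<^sub>R (cderiv ^^ n) (laplace \<psi>) 1)) \<and>
     (\<forall>\<psi> \<phi> :: real \<Rightarrow> 'a. \<psi> \<in> L1 \<longrightarrow> \<phi> \<in> L1 \<longrightarrow> poisson \<psi> = poisson \<phi> \<longrightarrow> L1_eq \<psi> \<phi>)) \<and>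
    \<comment> \<open>(iii)\<close>
    (\<forall>\<psi> :: real \<Rightarrow> 'a. \<psi> \<in> L1 \<longrightarrow> (\<forall>z. cmod z > 1 \<longrightarrow>
        summable (\<lambda>j. (1 / z ^ j) *\<^sub>C poisson \<psi> j) \<and>
        Z_transform (poisson \<psi>) z = laplace \<psi> (1 - 1 / z))) \<and>
    \<comment> \<open>(iv)\<close>
    (\<forall>(a :: real \<Rightarrow> complex) (\<psi> :: real \<Rightarrow> 'a). a \<in> L1 \<longrightarrow> \<psi> \<in> L1 \<longrightarrow>
        fun_conv a \<psi> \<in> L1 \<and>
        poisson (fun_conv a \<psi>) = seq_conv (poisson a) (poisson \<psi>)) \<and>
    \<comment> \<open>(v)\<close>
    ((\<forall>(\<psi> :: real \<Rightarrow> 'a) M \<omega>. strongly_measurable half_line \<psi> \<longrightarrow> M > 0 \<longrightarrow> \<omega> \<ge> 0 \<longrightarrow>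
        (AE t in half_line. norm (\<psi> t) \<le> M * exp (- \<omega> * t)) \<longrightarrow>
        (\<forall>n. norm (poisson \<psi> n) \<le> M / (1 + \<omega>) ^ (n + 1))) \<and>
     (\<forall>\<psi> :: real \<Rightarrow> 'a. strongly_measurable half_line \<psi> \<longrightarrow> bounded (\<psi> ` {0..}) \<longrightarrow>
        (\<forall>n. bochner_integrable half_line (\<lambda>t. poisson_weight n t *\<^sub>R \<psi> t)) \<and>
        bounded (range (poisson \<psi>)))) \<and>
    \<comment> \<open>(vi)\<close>
    (\<forall>(E :: 'a set) le (\<psi> :: real \<Rightarrow> 'a). complex_banach_lattice E le \<longrightarrow> \<psi> \<in> L1 \<longrightarrow>
        (AE t in half_line. nonneg_in E le (\<psi> t)) \<longrightarrow>
        (\<forall>n. nonneg_in E le (poisson \<psi> n))) \<and>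
    \<comment> \<open>(vii)\<close>
    (\<forall>S :: real \<Rightarrow> 'a \<Rightarrow> 'a.
        (\<forall>t\<ge>0. bounded_clinear (S t)) \<longrightarrow>
        (\<forall>x. continuous_on {0..} (\<lambda>t. S t x)) \<longrightarrow>
        (\<exists>M. \<forall>t\<ge>0. onorm (S t) \<le> M) \<longrightarrow>
        (\<forall>t\<ge>0. compact_operator (S t)) \<longrightarrow>
        (\<forall>n. compact_operator (poisson_op S n)))"
proof (intro conjI allI impI)
  show "bounded_operator_L1_l1 (poisson :: (real \<Rightarrow> 'a) \<Rightarrow> nat \<Rightarrow> 'a)"
    by (rule poisson_bounded_operator)
  show "opnorm_L1_l1 (poisson :: (real \<Rightarrow> 'a) \<Rightarrow> nat \<Rightarrow> 'a) = 1"
    by (rule opnorm_poisson[OF nonzero])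
next
  fix \<psi> :: "real \<Rightarrow> 'a" and n s assume \<psi>: "\<psi> \<in> L1" and s: "0 < Re s"
  show "\<exists>D. has_cderiv ((cderiv ^^ n) (laplace \<psi>)) D s"
    using has_cderiv_laplace(2)[OF \<psi> s] by blast
next
  fix \<psi> :: "real \<Rightarrow> 'a" and n assume \<psi>: "\<psi> \<in> L1"
  show "poisson \<psi> n = ((- 1) ^ n / fact n) *\<^sub>R (cderiv ^^ n) (laplace \<psi>) 1"
    using poisson_eq_laplace_moment[OF \<psi>] has_cderiv_laplace(1)[OF \<psi>, of 1 n] by simp
next
  fix \<psi> \<phi> :: "real \<Rightarrow> 'a" assume L: "\<psi> \<in> L1" "\<phi> \<in> L1" and eq: "poisson \<psi> = poisson \<phi>"
  have "poisson (\<lambda>t. \<psi> t - \<phi> t) n = 0" for n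
    by (simp add: poisson_diff[OF L] eq)
  from poisson_eq_0_imp_AE_0[OF L1_diff[OF L] this] show "L1_eq \<psi> \<phi>"
    unfolding L1_eq_def by eventually_elim simp
next
  fix \<psi> :: "real \<Rightarrow> 'a" and z assume \<psi>: "\<psi> \<in> L1" and z: "1 < cmod z"
  note s = poisson_Z_transform[OF \<psi> z]
  show "summable (\<lambda>j. (1 / z ^ j) *\<^sub>C poisson \<psi> j)" by (rule sums_summable[OF s])
  show "Z_transform (poisson \<psi>) z = laplace \<psi> (1 - 1 / z)"
    unfolding Z_transform_def by (rule sums_unique[OF s, symmetric])
next
  fix a :: "real \<Rightarrow> complex" and \<psi> :: "real \<Rightarrow> 'a" assume "a \<in> L1" "\<psi> \<in> L1"
  note c = poisson_fun_conv[OF this]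
  show "fun_conv a \<psi> \<in> L1" using c by blast
  show "poisson (fun_conv a \<psi>) = seq_conv (poisson a) (poisson \<psi>)" using c by blast
next
  fix \<psi> :: "real \<Rightarrow> 'a" and M \<omega> :: real and n
  assume \<psi>: "strongly_measurable half_line \<psi>" and "0 < M" and \<omega>: "0 \<le> \<omega>"
    and le: "AE t in half_line. norm (\<psi> t) \<le> M * exp (- \<omega> * t)"
  show "norm (poisson \<psi> n) \<le> M / (1 + \<omega>) ^ (n + 1)"
    by (rule poisson_decay(2)[OF \<psi> \<omega> le])
next
  fix \<psi> :: "real \<Rightarrow> 'a"
  assume \<psi>: "strongly_measurable half_line \<psi>" and "bounded (\<psi> ` {0..})"
  then obtain C where "\<And>t. 0 \<le> t \<Longrightarrow> norm (\<psi> t) \<le> C"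
    unfolding bounded_iff by auto
  then have "AE t in half_line. norm (\<psi> t) \<le> C * exp (- 0 * t)"
    by (intro AE_half_lineI) simp
  note dec = poisson_decay[OF \<psi> order_refl this]
  show "bochner_integrable half_line (\<lambda>t. poisson_weight n t *\<^sub>R \<psi> t)" for n
    by (rule dec(1))
  show "bounded (range (poisson \<psi>))"
    unfolding bounded_iff using dec(2) by (intro exI[of _ C]) auto
next
  fix E :: "'a set" and le and \<psi> :: "real \<Rightarrow> 'a" and n
  assume "complex_banach_lattice E le" "\<psi> \<in> L1" "AE t in half_line. nonneg_in E le (\<psi> t)"
  then show "nonneg_in E le (poisson \<psi> n)" by (rule poisson_nonneg)
next
  fix S :: "real \<Rightarrow> 'a \<Rightarrow> 'a" and n
  assume S: "\<forall>t\<ge>0. bounded_clinear (S t)" "\<forall>x. continuous_on {0..} (\<lambda>t. S t x)"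
    "\<exists>M. \<forall>t\<ge>0. onorm (S t) \<le> M" "\<forall>t\<ge>0. compact_operator (S t)"
  then obtain M where "\<And>t. 0 \<le> t \<Longrightarrow> onorm (S t) \<le> M" by blast
  then show "compact_operator (poisson_op S n)"
    using S by (intro poisson_op_compact[where M = M]) auto
qed

end
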